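(* Let $\mathcal{F}$ be a non-degenerated foliation of degree $r$ on $\mathbb{P}^2=\mathbb{P}^2_{\mathbb{C}}$, such that at every singularity the pair of associated eigenvalues is, up to a common non-zero factor, a pair of coprime integers. Assume that $\mathcal{F}$ has a rational first integral. Then $$r+1\leq n,$$ where $n$ is the number of non-reduced singularities of $\mathcal{F}$.
   Context: A foliation $\mathcal{F}$ of degree $r\ge 0$ on $\mathbb{P}^2$ is given, up to a non-zero scalar, by a homogeneous 1-form $\Omega=A\,dX+B\,dY+C\,dZ$, where $A,B,C\in\mathbb{C}[X,Y,Z]$ are homogeneous of degree $r+1$ without common factors and $XA+YB+ZC=0$. Its singularities are the common zeros of $A,B,C$. If near a point $p$ the foliation is given by a local 1-form $a\,dx+b\,dy$ ($a,b$ without common factors), the Milnor number of $\mathcal{F}$ at $p$ is $\mu_p(\mathcal{F})=\dim_{\mathbb{C}}\mathcal{O}_{\mathbb{P}^2,p}/(a,b)$. $\mathcal{F}$ is non-degenerated if all its singularities have Milnor number $1$. At a singularity $p$ of a non-degenerated foliation, the associated pair of eigenvalues $(\delta,\rho)$ consists of the two (non-zero) eigenvalues of the linear part at $p$ of a local vector field defining $\mathcal{F}$ (e.g. $b\,\partial_x-a\,\partial_y$); it is defined up to a common non-zero factor and is assumed to be normalized to a pair of coprime integers. The singularity $p$ is reduced if $\delta/\rho$ is not positive, and non-reduced if $\delta/\rho$ is positive. $\mathcal{F}$ has a rational first integral if there is a non-constant rational function $S$ of $\mathbb{P}^2$ with $dS\wedge\Omega=0$. *)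

theory Defs
  imports
    "HOL-Library.Extended_Nat"
    "HOL-Computational_Algebra.Computational_Algebra"
    "Jordan_Normal_Form.Char_Poly"
begin

section \<open>Polynomials in two and three variables\<close>

text \<open>
  \<open>\<complex>[u, v]\<close> is \<open>\<complex>[u][v]\<close> and \<open>\<complex>[X, Y, Z]\<close> is \<open>\<complex>[X][Y][Z]\<close>: the outermost variable
  comes last.
\<close>

type_synonym poly2 = "complex poly poly"
type_synonym poly3 = "complex poly poly poly"

definition const2 :: "complex \<Rightarrow> poly2" where
  "const2 c = [:[:c:]:]"

definition eval2 :: "poly2 \<Rightarrow> complex \<times> complex \<Rightarrow> complex" where
  "eval2 f = (\<lambda>(u, v). poly (poly f [:v:]) u)"

definition partial_u :: "poly2 \<Rightarrow> poly2" where
  "partial_u f = map_poly pderiv f"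

definition partial_v :: "poly2 \<Rightarrow> poly2" where
  "partial_v f = pderiv f"

definition const3 :: "complex \<Rightarrow> poly3" where
  "const3 c = [:[:[:c:]:]:]"

definition varX :: poly3 where
  "varX = [:[:[:0, 1:]:]:]"

definition varY :: poly3 where
  "varY = [:[:0, 1:]:]"

definition varZ :: poly3 where
  "varZ = [:0, 1:]"

definition eval3 :: "poly3 \<Rightarrow> complex \<times> complex \<times> complex \<Rightarrow> complex" where
  "eval3 F = (\<lambda>(x, y, z). poly (poly (poly F [:[:z:]:]) [:y:]) x)"

definition partial_X :: "poly3 \<Rightarrow> poly3" where
  "partial_X F = map_poly (map_poly pderiv) F"

definition partial_Y :: "poly3 \<Rightarrow> poly3" where
  "partial_Y F = map_poly pderiv F"

definition partial_Z :: "poly3 \<Rightarrow> poly3" where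
  "partial_Z F = pderiv F"

text \<open>The zero polynomial is homogeneous of every degree.\<close>

definition homogeneous :: "nat \<Rightarrow> poly3 \<Rightarrow> bool" where
  "homogeneous d F \<longleftrightarrow>
     (\<forall>i j k. coeff (coeff (coeff F k) j) i \<noteq> 0 \<longrightarrow> i + j + k = d)"

text \<open>\<open>F(1, u, v)\<close>, \<open>F(u, 1, v)\<close> and \<open>F(u, v, 1)\<close>, respectively.\<close>

definition dehomX :: "poly3 \<Rightarrow> poly2" where
  "dehomX F = map_poly (map_poly (\<lambda>f. poly f 1)) F"

definition dehomY :: "poly3 \<Rightarrow> poly2" where
  "dehomY F = map_poly (\<lambda>f. poly f 1) F"

definition dehomZ :: "poly3 \<Rightarrow> poly2" where
  "dehomZ F = poly F 1"


section \<open>The projective plane\<close>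

definition proj_eq ::
  "complex \<times> complex \<times> complex \<Rightarrow> complex \<times> complex \<times> complex \<Rightarrow> bool" where
  "proj_eq = (\<lambda>(x, y, z) w. (x, y, z) \<noteq> (0, 0, 0) \<and>
     (\<exists>c. c \<noteq> 0 \<and> w = (c * x, c * y, c * z)))"

lemma proj_eq_iff:
  "proj_eq (x, y, z) (x', y', z') \<longleftrightarrow> (x, y, z) \<noteq> (0, 0, 0) \<and>
     (\<exists>c. c \<noteq> 0 \<and> x' = c * x \<and> y' = c * y \<and> z' = c * z)"
  by (simp add: proj_eq_def)

lemma part_equivp_proj_eq: "part_equivp proj_eq"
proof (rule part_equivpI)
  have "proj_eq (1, 0, 0) (1, 0, 0)"
    unfolding proj_eq_iff by (simp add: exI[of _ 1])
  then show "\<exists>v. proj_eq v v" by blast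
  show "symp proj_eq"
  proof (rule sympI)
    fix v w assume vw: "proj_eq v w"
    obtain x y z x' y' z' where v: "v = (x, y, z)" and w: "w = (x', y', z')"
      by (metis surj_pair)
    from vw obtain c where "(x, y, z) \<noteq> (0, 0, 0)" "c \<noteq> 0"
        "x' = c * x" "y' = c * y" "z' = c * z"
      unfolding v w proj_eq_iff by blast
    then have "(x', y', z') \<noteq> (0, 0, 0)" "inverse c \<noteq> 0"
        "x = inverse c * x'" "y = inverse c * y'" "z = inverse c * z'"
      by auto
    then show "proj_eq w v" unfolding v w proj_eq_iff by blast
  qed
  show "transp proj_eq"
  proof (rule transpI)
    fix u v w assume uv: "proj_eq u v" and vw: "proj_eq v w"
    obtain x y z x' y' z' x'' y'' z'' where
      u: "u = (x, y, z)" and v: "v = (x', y', z')" and w: "w = (x'', y'', z'')"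
      by (metis surj_pair)
    from uv obtain c where c: "(x, y, z) \<noteq> (0, 0, 0)" "c \<noteq> 0"
        "x' = c * x" "y' = c * y" "z' = c * z"
      unfolding u v proj_eq_iff by blast
    from vw obtain d where d: "d \<noteq> 0" "x'' = d * x'" "y'' = d * y'" "z'' = d * z'"
      unfolding v w proj_eq_iff by blast
    have "d * c \<noteq> 0" "x'' = (d * c) * x" "y'' = (d * c) * y" "z'' = (d * c) * z"
      using c d by auto
    then show "proj_eq u w" unfolding u w proj_eq_iff using c(1) by blast
  qed
qed

quotient_type proj_plane = "complex \<times> complex \<times> complex" / partial: proj_eq
  by (rule part_equivp_proj_eq)

lift_definition homogeneous_coords ::
  "proj_plane \<Rightarrow> (complex \<times> complex \<times> complex) set" is
  "\<lambda>v. {w. proj_eq v w}"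
  using part_equivp_symp[OF part_equivp_proj_eq] part_equivp_transp[OF part_equivp_proj_eq]
  by blast


section \<open>Foliations\<close>

text \<open>The triple \<open>(A, B, C)\<close> stands for the 1-form \<open>A dX + B dY + C dZ\<close>.\<close>

type_synonym form3 = "poly3 \<times> poly3 \<times> poly3"

definition foliation :: "nat \<Rightarrow> form3 \<Rightarrow> bool" where
  "foliation r = (\<lambda>(A, B, C).
     homogeneous (r + 1) A \<and> homogeneous (r + 1) B \<and> homogeneous (r + 1) C \<and>
     (\<forall>D. D dvd A \<and> D dvd B \<and> D dvd C \<longrightarrow> is_unit D) \<and>
     varX * A + varY * B + varZ * C = 0)"

definition singular :: "form3 \<Rightarrow> proj_plane \<Rightarrow> bool" where
  "singular = (\<lambda>(A, B, C) p.
     \<forall>w \<in> homogeneous_coords p. eval3 A w = 0 \<and> eval3 B w = 0 \<and> eval3 C w = 0)"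

text \<open>
  \<open>(a, b, q)\<close> stands for the 1-form \<open>a du + b dv\<close> near the point \<open>q\<close> of an affine chart
  with coordinates \<open>(u, v)\<close>. It is the restriction of \<open>\<Omega>\<close> to the plane \<open>Z = 1\<close>,
  with \<open>(u, v) = (X, Y)\<close>, if \<open>p\<close> lies in that chart, and otherwise to \<open>Y = 1\<close>, with
  \<open>(u, v) = (X, Z)\<close>, or to \<open>X = 1\<close>, with \<open>(u, v) = (Y, Z)\<close>. If \<open>A, B, C\<close> have no common factor
  and \<open>X A + Y B + Z C = 0\<close>, then \<open>a\<close> and \<open>b\<close> have no common factor either.
\<close>

lift_definition local_form ::
  "form3 \<Rightarrow> proj_plane \<Rightarrow> poly2 \<times> poly2 \<times> complex \<times> complex" is
  "\<lambda>(A, B, C) (x, y, z).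
     if z \<noteq> 0 then (dehomZ A, dehomZ B, (x / z, y / z))
     else if y \<noteq> 0 then (dehomY A, dehomY C, (x / y, z / y))
     else (dehomX B, dehomX C, (y / x, z / x))"
  by (auto simp: proj_eq_def split: if_splits)


section \<open>Milnor number\<close>

definition local_ring :: "complex \<times> complex \<Rightarrow> poly2 fract set" where
  "local_ring q = {Fraction_Field.Fract f g | f g. eval2 g q \<noteq> 0}"

definition local_ideal ::
  "complex \<times> complex \<Rightarrow> poly2 \<Rightarrow> poly2 \<Rightarrow> poly2 fract set" where
  "local_ideal q a b =
     {s * to_fract a + t * to_fract b | s t. s \<in> local_ring q \<and> t \<in> local_ring q}"

text \<open>
  For complex subspaces \<open>W \<subseteq> V\<close> of \<open>\<complex>(u, v)\<close>, a quotient basis is a set of representatives of a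
  basis of \<open>V / W\<close>. Independence modulo \<open>W\<close> makes distinct representatives have distinct classes,
  so the cardinality of a finite quotient basis is the dimension of \<open>V / W\<close>.
\<close>

definition quotient_basis ::
  "poly2 fract set \<Rightarrow> poly2 fract set \<Rightarrow> poly2 fract set \<Rightarrow> bool" where
  "quotient_basis V W B \<longleftrightarrow> B \<subseteq> V \<and>
     (\<forall>f \<in> V. \<exists>S c. finite S \<and> S \<subseteq> B \<and> f - (\<Sum>e\<in>S. to_fract (const2 (c e)) * e) \<in> W) \<and>
     (\<forall>S c. finite S \<and> S \<subseteq> B \<and> (\<Sum>e\<in>S. to_fract (const2 (c e)) * e) \<in> W \<longrightarrow>
        (\<forall>e\<in>S. c e = 0))"

definition quotient_dim :: "poly2 fract set \<Rightarrow> poly2 fract set \<Rightarrow> enat" where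
  "quotient_dim V W =
     (if \<exists>B. finite B \<and> quotient_basis V W B
      then enat (card (SOME B. finite B \<and> quotient_basis V W B)) else \<infinity>)"

definition milnor_number :: "form3 \<Rightarrow> proj_plane \<Rightarrow> enat" where
  "milnor_number \<Omega> p =
     (case local_form \<Omega> p of (a, b, q) \<Rightarrow> quotient_dim (local_ring q) (local_ideal q a b))"

definition nondegenerate :: "form3 \<Rightarrow> bool" where
  "nondegenerate \<Omega> \<longleftrightarrow> (\<forall>p. singular \<Omega> p \<longrightarrow> milnor_number \<Omega> p = 1)"


section \<open>Eigenvalues at a singularity\<close>

text \<open>The linear part at \<open>p\<close> of the vector field \<open>b \<partial>/\<partial>u - a \<partial>/\<partial>v\<close>.\<close>

definition linear_part :: "form3 \<Rightarrow> proj_plane \<Rightarrow> complex mat" where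
  "linear_part \<Omega> p = (case local_form \<Omega> p of (a, b, q) \<Rightarrow>
     mat_of_rows_list 2
       [[eval2 (partial_u b) q, eval2 (partial_v b) q],
        [- eval2 (partial_u a) q, - eval2 (partial_v a) q]])"

text \<open>
  The eigenvalues are counted with multiplicity. The order of the pair and, for coprime
  integers, its sign remain free.
\<close>

definition eigenvalue_pair :: "form3 \<Rightarrow> proj_plane \<Rightarrow> complex \<Rightarrow> complex \<Rightarrow> bool" where
  "eigenvalue_pair \<Omega> p \<alpha> \<beta> \<longleftrightarrow>
     char_poly (linear_part \<Omega> p) = [:- \<alpha>, 1:] * [:- \<beta>, 1:]"

definition coprime_eigenvalue_pair :: "form3 \<Rightarrow> proj_plane \<Rightarrow> int \<Rightarrow> int \<Rightarrow> bool" where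
  "coprime_eigenvalue_pair \<Omega> p \<delta> \<rho> \<longleftrightarrow> coprime \<delta> \<rho> \<and>
     (\<exists>\<kappa>. \<kappa> \<noteq> 0 \<and> eigenvalue_pair \<Omega> p (\<kappa> * of_int \<delta>) (\<kappa> * of_int \<rho>))"

definition non_reduced :: "form3 \<Rightarrow> proj_plane \<Rightarrow> bool" where
  "non_reduced \<Omega> p \<longleftrightarrow> singular \<Omega> p \<and>
     (\<exists>\<delta> \<rho>. coprime_eigenvalue_pair \<Omega> p \<delta> \<rho> \<and> real_of_int \<delta> / real_of_int \<rho> > 0)"


section \<open>Rational first integrals\<close>

lemma map_poly_add:
  assumes "f 0 = 0" "\<And>x y. f (x + y) = f x + f y"
  shows "map_poly f (p + q) = map_poly f p + map_poly f q"
  by (rule poly_eqI) (simp add: coeff_map_poly assms)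

lemma map_poly_leibniz:
  fixes D :: "'a :: comm_ring_1 \<Rightarrow> 'a"
  assumes zero: "D 0 = 0" and add: "\<And>x y. D (x + y) = D x + D y"
    and mult: "\<And>x y. D (x * y) = x * D y + y * D x"
  shows "map_poly D (p * q) = p * map_poly D q + q * map_poly D p"
proof (rule poly_eqI)
  fix n
  have sum: "D (sum f S) = (\<Sum>i\<in>S. D (f i))" if "finite S" for f and S :: "nat set"
    using that by (induction S rule: finite_induct) (simp_all add: zero add)
  have "coeff (map_poly D (p * q)) n = D (\<Sum>i\<le>n. coeff p i * coeff q (n - i))"
    by (simp add: coeff_map_poly zero coeff_mult)
  also have "\<dots> = (\<Sum>i\<le>n. coeff p i * D (coeff q (n - i))) +
      (\<Sum>i\<le>n. D (coeff p i) * coeff q (n - i))"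
    by (simp add: sum mult sum.distrib mult.commute)
  also have "\<dots> = coeff (p * map_poly D q + map_poly D p * q) n"
    by (simp add: coeff_mult coeff_map_poly zero)
  finally show "coeff (map_poly D (p * q)) n = coeff (p * map_poly D q + q * map_poly D p) n"
    by (simp add: mult.commute)
qed

lemma partial_Z_mult: "partial_Z (F * G) = F * partial_Z G + G * partial_Z F"
  by (simp add: partial_Z_def pderiv_mult)

lemma partial_Y_mult: "partial_Y (F * G) = F * partial_Y G + G * partial_Y F"
  unfolding partial_Y_def
  by (rule map_poly_leibniz) (simp_all add: pderiv_add pderiv_mult)

lemma partial_X_mult: "partial_X (F * G) = F * partial_X G + G * partial_X F"
  unfolding partial_X_def
  by (intro map_poly_leibniz map_poly_add) (simp_all add: pderiv_add pderiv_mult)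

text \<open>
  The quotient rule. The value does not depend on the representation \<open>S = F / G\<close> if \<open>D\<close>
  satisfies the Leibniz rule, as the lemma below shows.
\<close>

definition fract_deriv :: "('a :: idom \<Rightarrow> 'a) \<Rightarrow> 'a fract \<Rightarrow> 'a fract" where
  "fract_deriv D S = (THE T. \<exists>F G. G \<noteq> 0 \<and> S = Fraction_Field.Fract F G \<and>
     T = Fraction_Field.Fract (G * D F - F * D G) (G * G))"

lemma fract_deriv_Fract:
  fixes D :: "'a :: idom \<Rightarrow> 'a"
  assumes mult: "\<And>x y. D (x * y) = x * D y + y * D x" and G: "G \<noteq> 0"
  shows "fract_deriv D (Fraction_Field.Fract F G) =
    Fraction_Field.Fract (G * D F - F * D G) (G * G)"
  unfolding fract_deriv_def
proof (rule the_equality, goal_cases)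
  case 1
  show ?case using G by blast
next
  case (2 T)
  then obtain F' G' where G': "G' \<noteq> 0"
    and FG: "Fraction_Field.Fract F G = Fraction_Field.Fract F' G'"
    and T: "T = Fraction_Field.Fract (G' * D F' - F' * D G') (G' * G')"
    by blast
  from FG G G' have eq: "F * G' = F' * G" by (simp add: eq_fract)
  have "F * D G' + G' * D F = F' * D G + G * D F'"
    using arg_cong[OF eq, of D] by (simp add: mult)
  then have "G' * D F - F' * D G = G * D F' - F * D G'"
    by (simp add: algebra_simps)
  then have "G * G' * (G' * D F - F' * D G) = G * G' * (G * D F' - F * D G')"
    by simp
  moreover have "(G * D F - F * D G) * (G' * G') = G * G' * (G' * D F) - (F * G') * G' * D G"
    by (simp add: algebra_simps)
  moreover have "(G' * D F' - F' * D G') * (G * G) = G * G' * (G * D F') - (F' * G) * G * D G'"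
    by (simp add: algebra_simps)
  moreover have "(F * G') * G' * D G = G * G' * (F' * D G)"
    unfolding eq by (simp only: mult_ac)
  moreover have "(F' * G) * G * D G' = G * G' * (F * D G')"
    unfolding eq[symmetric] by (simp only: mult_ac)
  ultimately have "(G' * D F' - F' * D G') * (G * G) = (G * D F - F * D G) * (G' * G')"
    by (simp only: right_diff_distrib)
  then show ?case using G G' by (simp add: T eq_fract)
qed

definition fract_partial_X :: "poly3 fract \<Rightarrow> poly3 fract" where
  "fract_partial_X = fract_deriv partial_X"

definition fract_partial_Y :: "poly3 fract \<Rightarrow> poly3 fract" where
  "fract_partial_Y = fract_deriv partial_Y"

definition fract_partial_Z :: "poly3 fract \<Rightarrow> poly3 fract" where
  "fract_partial_Z = fract_deriv partial_Z"

lemma fract_partial_Fract: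
  assumes "G \<noteq> 0"
  shows "fract_partial_X (Fraction_Field.Fract F G) =
      Fraction_Field.Fract (G * partial_X F - F * partial_X G) (G * G)"
    and "fract_partial_Y (Fraction_Field.Fract F G) =
      Fraction_Field.Fract (G * partial_Y F - F * partial_Y G) (G * G)"
    and "fract_partial_Z (Fraction_Field.Fract F G) =
      Fraction_Field.Fract (G * partial_Z F - F * partial_Z G) (G * G)"
  using assms
  by (simp_all add: fract_partial_X_def fract_partial_Y_def fract_partial_Z_def
      fract_deriv_Fract partial_X_mult partial_Y_mult partial_Z_mult)

definition rational_functions :: "poly3 fract set" where
  "rational_functions =
     {Fraction_Field.Fract F G | F G. G \<noteq> 0 \<and> (\<exists>d. homogeneous d F \<and> homogeneous d G)}"

text \<open>
  The three equations say that the coefficients of \<open>dX \<and> dY\<close>, \<open>dX \<and> dZ\<close> and \<open>dY \<and> dZ\<close> in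
  \<open>dS \<and> \<Omega>\<close> vanish.
\<close>

definition rational_first_integral :: "form3 \<Rightarrow> poly3 fract \<Rightarrow> bool" where
  "rational_first_integral = (\<lambda>(A, B, C) S.
     S \<in> rational_functions \<and> S \<notin> range (\<lambda>c. to_fract (const3 c)) \<and>
     fract_partial_X S * to_fract B - fract_partial_Y S * to_fract A = 0 \<and>
     fract_partial_X S * to_fract C - fract_partial_Z S * to_fract A = 0 \<and>
     fract_partial_Y S * to_fract C - fract_partial_Z S * to_fract B = 0)"

end

theory Submission
  imports Defs "HOL-Computational_Algebra.Field_as_Ring"
begin

text \<open>
  A first integral \<open>F / G\<close> singles out, among the homogeneous vector fields that define the foliation, the
  one, \<open>X\<close>, that annihilates \<open>F\<close> and \<open>G\<close>. Writing \<open>R\<close> for the radial field, \<open>\<Omega> = R \<times> X\<close>, and at a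
  singular point \<open>X\<close> is a multiple of \<open>R\<close>. If this multiple is nonzero, then \<open>F\<close> and \<open>G\<close> are local
  eigenfunctions of \<open>X\<close> with the same nonzero eigenvalue. At a saddle both would then vanish along a
  common formal separatrix; so \<open>X\<close> vanishes at all reduced singularities.

  Since all Milnor numbers are one and the ideal \<open>(A, B, C)\<close> is saturated, a form that vanishes at all
  singularities lies in \<open>(A, B, C)\<close>. Hence a form \<open>g = x g\<^sub>1 + y g\<^sub>2 + z g\<^sub>3\<close> that vanishes at the
  non-reduced singularities yields \<open>g\<^sub>1 X\<^sub>1 + g\<^sub>2 X\<^sub>2 + g\<^sub>3 X\<^sub>3 \<in> (A, B, C)\<close>, which means that \<open>g\<close> is the
  contraction with \<open>R\<close> of a syzygy of \<open>X\<close>. Two syzygies of degrees \<open>a, b\<close> with \<open>a + b < r\<close> are proportional,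
  because their cross product is a multiple of \<open>X\<close>. So, if \<open>a\<close> is the minimal degree of a syzygy, the
  forms of degree \<open>r - a\<close> that vanish at the non-reduced singularities are multiples of a single form of
  degree \<open>a + 1\<close>, and at least \<open>r + 1\<close> monomials of degree \<open>r - a\<close> are not divisible by its leading monomial.
  No form of degree \<open>a\<close> vanishes at the non-reduced singularities, which settles the case of large \<open>a\<close>.
\<close>

section \<open>Polynomials in two and three variables\<close>

text \<open>Triples of forms are treated as vectors: \<open>A\<close>, \<open>B\<close>,
  \<open>C\<close> are the components of R x X, and the algebra consists of cross product identities
  and the Koszul complex of the variables. A field defining the foliation is determined only up to
  multiples of R, and adding one may alter its value at singular points; the normalisation X F = X G
  = 0 is what makes the value at saddles zero. Forms and syzygies are linked because the elements of
  (A, B, C) are the products w . X with w . R = 0: if g . X = w . X, then g - w is a syzygy with the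
  same contraction with R as g. The degree r - a is the largest possible one: its syzygies have
  degree r - a - 1, and a + (r - a - 1) < r. Two obstacles shape the proof. Milnor numbers give
  membership in (A, B, C) only locally; a Nullstellensatz in each chart makes it global up to powers
  of the variables, which saturation removes. And quotients by a gcd must be shown to be
  homogeneous, so homogeneity is treated as an eigenvalue equation of Euler's operator.\<close>

abbreviation cf :: "poly3 \<Rightarrow> nat \<Rightarrow> nat \<Rightarrow> nat \<Rightarrow> complex" where
  "cf F i j k \<equiv> coeff (coeff (coeff F k) j) i"

lemma poly3_eqI: "(\<And>i j k. cf F i j k = cf G i j k) \<Longrightarrow> F = G"
  by (intro poly_eqI) blast

lemma poly_induct_ring [case_names const var add mult]:
  fixes p :: "'a :: comm_ring_1 poly"
  assumes "\<And>c. P [:c:]" "P [:0, 1:]"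
    and "\<And>p q. P p \<Longrightarrow> P q \<Longrightarrow> P (p + q)" "\<And>p q. P p \<Longrightarrow> P q \<Longrightarrow> P (p * q)"
  shows "P p"
proof (induction p)
  case 0
  show ?case using assms(1)[of 0] by simp
next
  case (pCons a p)
  have "pCons a p = [:a:] + [:0, 1:] * p" by simp
  then show ?case using assms pCons.IH by metis
qed

lemma poly2_induct [case_names const varu varv add mult]:
  fixes f :: poly2
  assumes c: "\<And>c. P (const2 c)" and u: "P [:[:0, 1:]:]" and v: "P [:0, 1:]"
    and add: "\<And>p q. P p \<Longrightarrow> P q \<Longrightarrow> P (p + q)" and mult: "\<And>p q. P p \<Longrightarrow> P q \<Longrightarrow> P (p * q)"
  shows "P f"
proof (induction f rule: poly_induct_ring)
  case (const p)
  show ?case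
  proof (induction p rule: poly_induct_ring)
    case (const c) then show ?case using c by (simp add: const2_def)
  next
    case var then show ?case by (rule u)
  next
    case (add p q) then show ?case using assms(4)[of "[:p:]" "[:q:]"] by simp
  next
    case (mult p q) then show ?case using assms(5)[of "[:p:]" "[:q:]"] by (simp add: mult.commute)
  qed
qed (use assms in blast)+

lemma cf_varX: "cf (varX * F) i j k = (if i = 0 then 0 else cf F (i - 1) j k)"
  by (cases i) (simp_all add: varX_def)

lemma cf_varY: "cf (varY * F) i j k = (if j = 0 then 0 else cf F i (j - 1) k)"
  by (cases j) (simp_all add: varY_def)

lemma cf_varZ: "cf (varZ * F) i j k = (if k = 0 then 0 else cf F i j (k - 1))"
  by (cases k) (simp_all add: varZ_def)

lemma cf_const3: "cf (const3 c * F) i j k = c * cf F i j k"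
  by (simp add: const3_def)

lemma cf_const3': "cf (const3 c) i j k = (if i = 0 \<and> j = 0 \<and> k = 0 then c else 0)"
  by (auto simp: const3_def coeff_pCons split: nat.splits)

lemma cf_partial_X: "cf (partial_X F) i j k = of_nat (Suc i) * cf F (Suc i) j k"
  by (simp add: partial_X_def coeff_map_poly coeff_pderiv)

lemma cf_partial_Y: "cf (partial_Y F) i j k = of_nat (Suc j) * cf F i (Suc j) k"
  by (simp add: partial_Y_def coeff_map_poly coeff_pderiv of_nat_poly distrib_right)

lemma cf_partial_Z: "cf (partial_Z F) i j k = of_nat (Suc k) * cf F i j (Suc k)"
  by (simp add: partial_Z_def coeff_pderiv of_nat_poly distrib_right)

lemma const3_add: "const3 (a + b) = const3 a + const3 b"
  and const3_mult: "const3 (a * b) = const3 a * const3 b"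
  and const3_0: "const3 0 = 0" and const3_1: "const3 1 = 1"
  by (simp_all add: const3_def one_pCons)

lemma const3_eq_0_iff: "const3 a = 0 \<longleftrightarrow> a = 0"
  by (simp add: const3_def)

lemma const3_inverse: "a \<noteq> 0 \<Longrightarrow> const3 a * const3 (inverse a) = 1"
  by (simp add: const3_mult[symmetric] const3_1)

lemma const3_of_nat: "const3 (of_nat n) = of_nat n"
  by (induction n) (simp_all add: const3_0 const3_1 const3_add)

lemma vars_nonzero [simp]: "varX \<noteq> 0" "varY \<noteq> 0" "varZ \<noteq> 0"
  by (simp_all add: varX_def varY_def varZ_def)

lemma partial_X_add: "partial_X (F + G) = partial_X F + partial_X G"
  and partial_Y_add: "partial_Y (F + G) = partial_Y F + partial_Y G"
  and partial_Z_add: "partial_Z (F + G) = partial_Z F + partial_Z G"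
  by (intro poly3_eqI, simp add: cf_partial_X cf_partial_Y cf_partial_Z algebra_simps)+

section \<open>The Euler operator and homogeneity\<close>

definition euler :: "poly3 \<Rightarrow> poly3" where
  "euler F = varX * partial_X F + varY * partial_Y F + varZ * partial_Z F"

lemma cf_euler: "cf (euler F) i j k = of_nat (i + j + k) * cf F i j k"
  by (cases i; cases j; cases k)
    (simp_all add: euler_def cf_varX cf_varY cf_varZ cf_partial_X cf_partial_Y cf_partial_Z algebra_simps)

lemma euler_add: "euler (F + G) = euler F + euler G"
  by (simp add: euler_def partial_X_add partial_Y_add partial_Z_add algebra_simps)

lemma euler_mult: "euler (F * G) = F * euler G + G * euler F"
  by (simp add: euler_def partial_X_mult partial_Y_mult partial_Z_mult algebra_simps)

lemma euler_uminus: "euler (- F) = - euler F"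
  by (intro poly3_eqI) (simp add: cf_euler)

lemma euler_diff: "euler (F - G) = euler F - euler G"
  using euler_add[of F "- G"] by (simp add: euler_uminus)

text \<open>A monomial of degree n is an eigenvector of \<open>euler\<close> with eigenvalue n, and
  distinct natural numbers stay distinct in characteristic zero. As an equation in the ring,
  homogeneity passes to products by the Leibniz rule and can be recovered for factors.\<close>

lemma homogeneous_iff_euler: "homogeneous d F \<longleftrightarrow> euler F = of_nat d * F"
proof
  assume "homogeneous d F"
  then have "cf (euler F) i j k = cf (const3 (of_nat d) * F) i j k" for i j k
    unfolding cf_euler cf_const3 homogeneous_def by (cases "cf F i j k = 0") (auto simp del: of_nat_add)
  then have "euler F = const3 (of_nat d) * F" by (rule poly3_eqI)
  then show "euler F = of_nat d * F" by (simp add: const3_of_nat)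
next
  assume "euler F = of_nat d * F"
  then have eq: "euler F = const3 (of_nat d) * F" by (simp add: const3_of_nat)
  have "i + j + k = d" if "cf F i j k \<noteq> 0" for i j k
    using arg_cong[OF eq, of "\<lambda>p. cf p i j k"] that unfolding cf_euler cf_const3
    by (simp del: of_nat_add)
  then show "homogeneous d F"
    unfolding homogeneous_def by blast
qed

lemma homogeneous_0 [simp]: "homogeneous d 0"
  by (simp add: homogeneous_def)

lemma homogeneous_const3 [simp]: "homogeneous 0 (const3 c)"
  by (simp add: homogeneous_def cf_const3')

lemma homogeneous_vars [simp]:
  "homogeneous (Suc 0) varX" "homogeneous (Suc 0) varY" "homogeneous (Suc 0) varZ"
  by (auto simp: homogeneous_def varX_def varY_def varZ_def coeff_pCons split: nat.splits)

lemma homogeneous_add: "homogeneous d F \<Longrightarrow> homogeneous d G \<Longrightarrow> homogeneous d (F + G)"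
  by (simp add: homogeneous_iff_euler euler_add algebra_simps)

lemma homogeneous_uminus: "homogeneous d F \<Longrightarrow> homogeneous d (- F)"
  by (simp add: homogeneous_iff_euler euler_uminus)

lemma homogeneous_diff: "homogeneous d F \<Longrightarrow> homogeneous d G \<Longrightarrow> homogeneous d (F - G)"
  by (simp add: homogeneous_iff_euler euler_diff algebra_simps)

lemma homogeneous_mult: "homogeneous d F \<Longrightarrow> homogeneous e G \<Longrightarrow> homogeneous (d + e) (F * G)"
  by (simp add: homogeneous_iff_euler euler_mult algebra_simps)

lemma homogeneous_const3_mult: "homogeneous d F \<Longrightarrow> homogeneous d (const3 c * F)"
  using homogeneous_mult[OF homogeneous_const3] by simp

lemma homogeneous_power: "homogeneous d F \<Longrightarrow> homogeneous (n * d) (F ^ n)"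
proof (induction n)
  case 0 show ?case using homogeneous_const3[of 1] by (simp add: const3_1)
next
  case (Suc n) then show ?case using homogeneous_mult[of d F "n * d" "F ^ n"] by simp
qed

lemma homogeneous_partial:
  assumes "homogeneous (Suc d) F"
  shows "homogeneous d (partial_X F)" "homogeneous d (partial_Y F)" "homogeneous d (partial_Z F)"
proof -
  have *: "i + j + k = Suc d" if "cf F i j k \<noteq> 0" for i j k
    using assms that unfolding homogeneous_def by blast
  show "homogeneous d (partial_X F)" "homogeneous d (partial_Y F)" "homogeneous d (partial_Z F)"
    unfolding homogeneous_def cf_partial_X cf_partial_Y cf_partial_Z
    using * by fastforce+
qed

lemma homogeneous_degree_0:
  assumes "homogeneous 0 F" shows "\<exists>c. F = const3 c"
proof -
  have "F = const3 (cf F 0 0 0)"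
    by (rule poly3_eqI) (use assms in \<open>auto simp: cf_const3' homogeneous_def\<close>)
  then show ?thesis by blast
qed


text \<open>\<open>euler\<close> only rescales coefficients, so it raises no degree. Comparing
  degrees in the last, the middle and the first variable makes \<open>c\<close> a constant, and the
  lexicographically leading coefficient reads it off as \<open>i + j + k\<close>.\<close>

lemma euler_eigenvalue:
  assumes "F \<noteq> 0" and E: "euler F = c * F"
  shows "\<exists>n. c = of_nat n \<and> homogeneous n F"
proof -
  have degree_0: "degree a = 0" if "p \<noteq> 0" "degree (a * p) \<le> degree p" for a p :: "'a :: idom poly"
    using that by (cases "a = 0") (simp_all add: degree_mult_eq)
  define k where "k = degree F"
  define G where "G = coeff F k"
  define j where "j = degree G"
  define H where "H = coeff G j"
  define i where "i = degree H"
  have "G \<noteq> 0" using \<open>F \<noteq> 0\<close> by (simp add: G_def k_def)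
  then have "H \<noteq> 0" by (simp add: H_def j_def)
  have "degree (c * F) \<le> degree F"
    unfolding E[symmetric]
  proof (intro degree_le allI impI poly_eqI)
    fix n m l assume "degree F < n"
    then show "cf (euler F) l m n = coeff (coeff 0 m) l" unfolding cf_euler by (simp add: coeff_eq_0)
  qed
  then obtain c1 where c1: "c = [:c1:]" using degree_0[OF \<open>F \<noteq> 0\<close>] by (metis degree_eq_zeroE)
  have EG: "coeff (coeff (c1 * G) m) l = of_nat (l + m + k) * coeff (coeff G m) l" for l m
    using arg_cong[OF E, of "\<lambda>p. cf p l m k"] unfolding cf_euler c1 by (simp add: G_def)
  have "degree (c1 * G) \<le> degree G"
    by (intro degree_le allI impI poly_eqI) (simp only: EG, simp add: coeff_eq_0)
  then obtain c2 where c2: "c1 = [:c2:]" using degree_0[OF \<open>G \<noteq> 0\<close>] by (metis degree_eq_zeroE)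
  have EH: "coeff (c2 * H) l = of_nat (l + j + k) * coeff H l" for l
    using EG[of j l] by (simp add: c2 H_def)
  have "degree (c2 * H) \<le> degree H"
    by (intro degree_le allI impI) (simp only: EH, simp add: coeff_eq_0)
  then obtain c3 where c3: "c2 = [:c3:]" using degree_0[OF \<open>H \<noteq> 0\<close>] by (metis degree_eq_zeroE)
  have "c3 = of_nat (i + j + k)"
    using EH[of i] \<open>H \<noteq> 0\<close> by (simp add: c3 i_def)
  then have "c = of_nat (i + j + k)"
    by (simp only: c1 c2 c3 of_nat_poly)
  then show ?thesis using E homogeneous_iff_euler by blast
qed

text \<open>Cancelling \<open>P\<close> in the Leibniz rule leaves \<open>Q\<close> with eigenvalue
  m - n, taken in the polynomial ring. By \<open>euler_eigenvalue\<close> this is a natural number,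
  which yields both the inequality and the degree of \<open>Q\<close>.\<close>

lemma homogeneous_factor:
  assumes PQ: "homogeneous m (P * Q)" and P: "homogeneous n P" "P \<noteq> 0" and "Q \<noteq> 0"
  shows "n \<le> m" "homogeneous (m - n) Q"
proof -
  have "P * (euler Q + of_nat n * Q) = P * (of_nat m * Q)"
    using PQ P by (simp add: homogeneous_iff_euler euler_mult algebra_simps)
  then have "euler Q + of_nat n * Q = of_nat m * Q"
    using \<open>P \<noteq> 0\<close> by (metis mult_left_cancel)
  then have "euler Q = (of_nat m - of_nat n) * Q"
    by (simp add: algebra_simps)
  then obtain k where k: "of_nat m - of_nat n = (of_nat k :: poly3)" "homogeneous k Q"
    using euler_eigenvalue \<open>Q \<noteq> 0\<close> by blast
  then have "of_nat m = (of_nat (k + n) :: poly3)" by (simp add: algebra_simps)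
  then have "m = k + n" by (simp only: of_nat_eq_iff)
  then show "n \<le> m" "homogeneous (m - n) Q" using k by auto
qed

section \<open>Vectors of polynomials\<close>

definition coprime3 :: "'a :: algebraic_semidom \<Rightarrow> 'a \<Rightarrow> 'a \<Rightarrow> bool" where
  "coprime3 a b c \<longleftrightarrow> (\<forall>D. D dvd a \<and> D dvd b \<and> D dvd c \<longrightarrow> is_unit D)"

lemma coprime3_rotate: "coprime3 a b c \<Longrightarrow> coprime3 b c a"
  by (auto simp: coprime3_def)

lemma coprime3_dvd:
  fixes a :: "'a :: ring_gcd"
  assumes "coprime3 a b c" and "a dvd q * b" "a dvd q * c"
  shows "a dvd q"
proof -
  have "a dvd normalize (q * gcd b c)"
    using gcd_mult_left[of q b c] assms(2,3) by (metis gcd_greatest)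
  then have "a dvd q * gcd b c" by simp
  moreover have "coprime a (gcd b c)"
    using assms(1) by (auto simp: coprime3_def intro: coprimeI)
  ultimately show ?thesis using coprime_dvd_mult_left_iff by blast
qed

lemma parallel3_aux:
  fixes a :: "'a :: {idom, ring_gcd}"
  assumes "coprime3 a b c" "a \<noteq> 0"
    and "u * b = v * a" "u * c = w * a"
  shows "\<exists>p. u = p * a \<and> v = p * b \<and> w = p * c"
proof -
  obtain p where "u = p * a"
    using coprime3_dvd[OF assms(1), of u] assms(3,4) by (metis dvd_triv_right dvdE mult.commute)
  then show ?thesis using assms by (auto simp: mult_ac)
qed

text \<open>The three equations say that the cross product of the two vectors vanishes. They are
  then proportional over the fraction field, and coprimality of \<open>a\<close>, \<open>b\<close>,
  \<open>c\<close> removes the denominator of the factor. Some entry is nonzero, and a rotation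
  makes it the first one.\<close>

lemma parallel3:
  fixes a :: "'a :: {idom, ring_gcd}"
  assumes "coprime3 a b c"
    and "u * b = v * a" "u * c = w * a" "v * c = w * b"
  shows "\<exists>p. u = p * a \<and> v = p * b \<and> w = p * c"
proof -
  have "a \<noteq> 0 \<or> b \<noteq> 0 \<or> c \<noteq> 0"
    using assms(1) unfolding coprime3_def by (metis dvd_0_right not_is_unit_0)
  then consider "a \<noteq> 0" | "b \<noteq> 0" | "c \<noteq> 0" by blast
  then show ?thesis
  proof cases
    case 1 then show ?thesis using parallel3_aux assms by blast
  next
    case 2 then show ?thesis
      using parallel3_aux[of b c a v w u] assms by (metis coprime3_rotate)
  next
    case 3 then show ?thesis
      using parallel3_aux[of c a b w u v] assms by (metis coprime3_rotate)
  qed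
qed

lemma poly3_split: "\<exists>p q. F = [:p:] + varZ * q"
proof (cases F)
  case (pCons a q)
  then have "F = [:a:] + varZ * q" by (simp add: varZ_def)
  then show ?thesis by blast
qed

text \<open>Makes \<open>parallel3\<close> applicable to the radial field: what has zero cross
  product with it is a multiple of it.\<close>

lemma coprime3_vars: "coprime3 varX varY varZ"
  unfolding coprime3_def
proof (intro allI impI, elim conjE)
  fix D assume D: "D dvd varX" "D dvd varY"
  have const: "\<exists>d. p = [:d:]" if "p dvd [:q:]" "q \<noteq> 0" for p and q :: "'a :: idom"
  proof -
    have "degree p \<le> degree [:q:]" by (rule dvd_imp_degree_le) (use that in auto)
    then have "degree p = 0" by simp
    then show ?thesis using degree_eq_zeroE by metis
  qed
  obtain d where d: "D = [:d:]" using const[OF D(1)[unfolded varX_def]] by auto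
  have "d dvd [:[:0, 1:]:]" using D(1) unfolding varX_def d by simp
  then obtain e where e: "d = [:e:]" using const[of d "[:0, 1:]"] by auto
  have "[:e:] dvd [:0, 1:]" using D(2) unfolding varY_def d e by simp
  then obtain q where q: "[:0, 1:] = [:e:] * q" by blast
  have "1 = e * coeff q 1" using arg_cong[OF q, of "\<lambda>p. coeff p 1"] by simp
  then have "e dvd 1" by (rule dvdI)
  then show "is_unit D" unfolding d e is_unit_const_poly_iff .
qed

text \<open>Exactness of the Koszul complex of the variables: a vector orthogonal to the radial one
  is a cross product with it. Modulo \<open>varZ\<close> the relation reads X a0 + Y b0 = 0, which
  forces a0 = Y e and b0 = - X e; what remains is divisible by \<open>varZ\<close> and determines
  \<open>c\<close>.\<close>

lemma koszul:
  assumes "varX * a + varY * b + varZ * c = 0"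
  shows "\<exists>u v w. a = varZ * v - varY * w \<and> b = varX * w - varZ * u \<and> c = varY * u - varX * v"
proof -
  obtain a0 a1 where a: "a = [:a0:] + varZ * a1" using poly3_split by blast
  obtain b0 b1 where b: "b = [:b0:] + varZ * b1" using poly3_split by blast
  define X Y :: poly2 where "X = [:[:0, 1:]:]" and "Y = [:0, 1:]"
  have XY: "varX = [:X:]" "varY = [:Y:]" by (simp_all add: varX_def varY_def X_def Y_def)
  have eq: "[:X * a0 + Y * b0:] + varZ * ([:X:] * a1 + [:Y:] * b1 + c) = 0"
  proof -
    have "[:X * a0 + Y * b0:] = [:X:] * [:a0:] + [:Y:] * [:b0:]" by simp
    then show ?thesis using assms unfolding a b XY by (simp only: algebra_simps)
  qed
  then have 0: "X * a0 + Y * b0 = 0"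
    using arg_cong[OF eq, of "\<lambda>p. coeff p 0"] by (simp add: varZ_def)
  then have 1: "[:X:] * a1 + [:Y:] * b1 + c = 0" using eq by simp
  have "coeff a0 0 = 0"
    using arg_cong[OF 0, of "\<lambda>p. coeff p 0"] by (simp add: X_def Y_def)
  then obtain e where e: "a0 = Y * e" by (cases a0) (auto simp: Y_def)
  have "Y * (X * e + b0) = 0" using 0 e by (simp add: algebra_simps)
  moreover have "Y \<noteq> 0" by (simp add: Y_def)
  ultimately have "X * e + b0 = 0" by (metis mult_eq_0_iff)
  then have b0: "b0 = - (X * e)" by (metis minus_unique)
  show ?thesis
  proof (intro exI conjI)
    show "a = varZ * a1 - varY * (- [:e:])" by (simp add: a e XY algebra_simps)
    show "b = varX * (- [:e:]) - varZ * (- b1)" by (simp add: b b0 XY algebra_simps)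
    show "c = varY * (- b1) - varX * a1"
    proof -
      have "c = - ([:X:] * a1 + [:Y:] * b1)" using 1 by (metis minus_unique)
      then show ?thesis
        unfolding XY by (simp only: mult_minus_right minus_add_distrib diff_conv_add_uminus add.commute)
    qed
  qed
qed

section \<open>Homogeneous components\<close>

definition monom3 :: "nat \<times> nat \<times> nat \<Rightarrow> poly3" where
  "monom3 = (\<lambda>(i, j, k). varX ^ i * varY ^ j * varZ ^ k)"

lemma varX_power: "varX ^ i = [:[:monom 1 i:]:]"
proof (induction i)
  case 0 show ?case by (simp add: one_pCons monom_0)
qed (simp add: varX_def monom_Suc)

lemma varY_power: "varY ^ j = [:monom 1 j:]"
proof (induction j)
  case 0 show ?case by (simp add: one_pCons monom_0)
qed (simp add: varY_def monom_Suc)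

lemma varZ_power: "varZ ^ k = monom 1 k"
proof (induction k)
  case 0 show ?case by (simp add: one_pCons monom_0)
qed (simp add: varZ_def monom_Suc)

lemma cf_monom3: "cf (monom3 (i, j, k)) i' j' k' = (if i' = i \<and> j' = j \<and> k' = k then 1 else 0)"
  by (simp add: monom3_def varX_power varY_power varZ_power smult_monom)


lemma poly3_induct [case_names const add varX varY varZ]:
  fixes F :: poly3
  assumes c: "\<And>c. P (const3 c)" and add: "\<And>F G. P F \<Longrightarrow> P G \<Longrightarrow> P (F + G)"
    and X: "\<And>F. P F \<Longrightarrow> P (varX * F)" and Y: "\<And>F. P F \<Longrightarrow> P (varY * F)"
    and Z: "\<And>F. P F \<Longrightarrow> P (varZ * F)"
  shows "P F"
proof -
  have 1: "P [:[:p:]:]" for p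
  proof (induction p)
    case 0 then show ?case using c[of 0] by (simp add: const3_def)
  next
    case (pCons a p)
    show ?case using add[OF c[of a] X[OF pCons.IH]] by (simp add: const3_def varX_def)
  qed
  have 2: "P [:p:]" for p
  proof (induction p)
    case 0 then show ?case using c[of 0] by (simp add: const3_def)
  next
    case (pCons a p)
    show ?case using add[OF 1[of a] Y[OF pCons.IH]] by (simp add: varY_def)
  qed
  show ?thesis
  proof (induction F)
    case 0 then show ?case using c[of 0] by (simp add: const3_def)
  next
    case (pCons a p)
    show ?case using add[OF 2[of a] Z[OF pCons.IH]] by (simp add: varZ_def)
  qed
qed

lemma finite_support: "\<exists>N. \<forall>i j k. cf F i j k \<noteq> 0 \<longrightarrow> i + j + k \<le> N"
proof (induction F rule: poly3_induct)
  case (const c)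
  show ?case by (auto simp: cf_const3')
next
  case (add F G)
  then obtain M N where M: "\<And>i j k. cf F i j k \<noteq> 0 \<Longrightarrow> i + j + k \<le> M"
    and N: "\<And>i j k. cf G i j k \<noteq> 0 \<Longrightarrow> i + j + k \<le> N" by blast
  have "i + j + k \<le> max M N" if "cf (F + G) i j k \<noteq> 0" for i j k
  proof -
    from that have "cf F i j k \<noteq> 0 \<or> cf G i j k \<noteq> 0" by auto
    then show ?thesis using M N by (meson max.coboundedI1 max.coboundedI2)
  qed
  then show ?case by blast
next
  case (varX F)
  then obtain N where "\<And>i j k. cf F i j k \<noteq> 0 \<Longrightarrow> i + j + k \<le> N" by blast
  note N = this
  have "i + j + k \<le> Suc N" if "cf (varX * F) i j k \<noteq> 0" for i j k
    using that N[of k j i] N[where i = "i - 1" and j = j and k = k] N[where i = i and j = "j - 1" and k = k]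
      N[where i = i and j = j and k = "k - 1"] unfolding cf_varX by (simp split: if_splits)
  then show ?case by blast
next
  case (varY F)
  then obtain N where "\<And>i j k. cf F i j k \<noteq> 0 \<Longrightarrow> i + j + k \<le> N" by blast
  note N = this
  have "i + j + k \<le> Suc N" if "cf (varY * F) i j k \<noteq> 0" for i j k
    using that N[of k j i] N[where i = "i - 1" and j = j and k = k] N[where i = i and j = "j - 1" and k = k]
      N[where i = i and j = j and k = "k - 1"] unfolding cf_varY by (simp split: if_splits)
  then show ?case by blast
next
  case (varZ F)
  then obtain N where "\<And>i j k. cf F i j k \<noteq> 0 \<Longrightarrow> i + j + k \<le> N" by blast
  note N = this
  have "i + j + k \<le> Suc N" if "cf (varZ * F) i j k \<noteq> 0" for i j k
    using that N[of k j i] N[where i = "i - 1" and j = j and k = k] N[where i = i and j = "j - 1" and k = k]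
      N[where i = i and j = j and k = "k - 1"] unfolding cf_varZ by (simp split: if_splits)
  then show ?case by blast
qed

definition triples :: "nat \<Rightarrow> (nat \<times> nat \<times> nat) set" where
  "triples d = {(i, j, k). i + j + k = d}"

lemma finite_triples [simp]: "finite (triples d)"
  by (rule finite_subset[of _ "{..d} \<times> {..d} \<times> {..d}"]) (auto simp: triples_def)

lemma cf_sum: "cf (\<Sum>x\<in>S. f x) i j k = (\<Sum>x\<in>S. cf (f x) i j k)"
  by (simp add: coeff_sum)

lemma cf_sum_monom3:
  assumes "finite M"
  shows "cf (\<Sum>m\<in>M. const3 (c m) * monom3 m) i j k = (if (i, j, k) \<in> M then c (i, j, k) else 0)"
proof -
  have "cf (\<Sum>m\<in>M. const3 (c m) * monom3 m) i j k = (\<Sum>m\<in>M. if m = (i, j, k) then c m else 0)"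
    unfolding cf_sum
  proof (intro sum.cong refl)
    fix m :: "nat \<times> nat \<times> nat"
    obtain a b d where "m = (a, b, d)" by (cases m)
    then show "cf (const3 (c m) * monom3 m) i j k = (if m = (i, j, k) then c m else 0)"
      unfolding cf_const3 by (simp add: cf_monom3)
  qed
  then show ?thesis using assms by simp
qed

definition homogeneous_part :: "nat \<Rightarrow> poly3 \<Rightarrow> poly3" where
  "homogeneous_part d F = (\<Sum>m\<in>triples d. const3 (case m of (i, j, k) \<Rightarrow> cf F i j k) * monom3 m)"

lemma cf_homogeneous_part: "cf (homogeneous_part d F) i j k = (if i + j + k = d then cf F i j k else 0)"
  unfolding homogeneous_part_def cf_sum_monom3[OF finite_triples] by (simp add: triples_def)

lemma homogeneous_homogeneous_part [simp]: "homogeneous d (homogeneous_part d F)"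
  by (simp add: homogeneous_def cf_homogeneous_part)

lemma homogeneous_part_homogeneous: "homogeneous d F \<Longrightarrow> homogeneous_part e F = (if e = d then F else 0)"
  by (intro poly3_eqI) (auto simp: homogeneous_def cf_homogeneous_part)

lemma homogeneous_part_add: "homogeneous_part d (F + G) = homogeneous_part d F + homogeneous_part d G"
  by (intro poly3_eqI) (simp add: cf_homogeneous_part)

lemma homogeneous_part_sum: "homogeneous_part d (\<Sum>x\<in>S. f x) = (\<Sum>x\<in>S. homogeneous_part d (f x))"
  by (intro poly3_eqI) (simp add: cf_homogeneous_part cf_sum)

text \<open>Serves to replace the coefficients in an ideal membership of a form by forms.\<close>

lemma homogeneous_part_mult:
  assumes "homogeneous a A"
  shows "homogeneous_part d (F * A) = (if a \<le> d then homogeneous_part (d - a) F * A else 0)"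
proof -
  obtain N where N: "\<And>i j k. cf F i j k \<noteq> 0 \<Longrightarrow> i + j + k \<le> N" using finite_support by blast
  have "F = (\<Sum>e\<le>N. homogeneous_part e F)"
  proof (rule poly3_eqI)
    fix i j k
    show "cf F i j k = cf (\<Sum>e\<le>N. homogeneous_part e F) i j k"
      unfolding cf_sum cf_homogeneous_part using N[of k j i] by auto
  qed
  \<comment> \<open>The range is enlarged so that the index \<open>d - a\<close>, the only one that
    contributes, certainly lies in it.\<close>
  also have "\<dots> = (\<Sum>e\<le>max N d. homogeneous_part e F)"
  proof (rule sum.mono_neutral_left)
    have "cf (homogeneous_part e F) i j k = 0" if "e > N" for e i j k
      unfolding cf_homogeneous_part using that N[of k j i] by (cases "cf F i j k = 0") auto
    then show "\<forall>e\<in>{..max N d} - {..N}. homogeneous_part e F = 0"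
      by (auto intro: poly3_eqI)
  qed auto
  finally have "F * A = (\<Sum>e\<le>max N d. homogeneous_part e F) * A" by simp
  then have "homogeneous_part d (F * A) = (\<Sum>e\<le>max N d. homogeneous_part d (homogeneous_part e F * A))"
    by (simp only: sum_distrib_right homogeneous_part_sum)
  also have "\<dots> = (\<Sum>e\<le>max N d. if e = d - a \<and> a \<le> d then homogeneous_part e F * A else 0)"
    by (intro sum.cong refl)
      (use homogeneous_part_homogeneous[OF homogeneous_mult[OF homogeneous_homogeneous_part assms]] in auto)
  also have "\<dots> = (if a \<le> d then homogeneous_part (d - a) F * A else 0)"
    by (auto simp: le_diff_conv max.coboundedI2)
  finally show ?thesis .
qed

text \<open>Every polynomial without constant term splits in this way; taking parts of degree
  \<open>Suc d\<close> then makes the coefficients homogeneous.\<close>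

lemma homogeneous_split:
  assumes "homogeneous (Suc d) F"
  shows "\<exists>a b c. homogeneous d a \<and> homogeneous d b \<and> homogeneous d c \<and>
    F = varX * a + varY * b + varZ * c"
proof -
  have "\<exists>a b c. F = varX * a + varY * b + varZ * c + const3 (cf F 0 0 0)" for F
  proof (induction F rule: poly3_induct)
    case (const c)
    show ?case by (intro exI[of _ 0]) (simp add: cf_const3')
  next
    case (add F G)
    then obtain a b c a' b' c' where "F = varX * a + varY * b + varZ * c + const3 (cf F 0 0 0)"
      "G = varX * a' + varY * b' + varZ * c' + const3 (cf G 0 0 0)" by blast
    then have "F + G = (varX * a + varY * b + varZ * c + const3 (cf F 0 0 0)) +
        (varX * a' + varY * b' + varZ * c' + const3 (cf G 0 0 0))" by (rule arg_cong2)
    moreover have "const3 (cf (F + G) 0 0 0) = const3 (cf F 0 0 0) + const3 (cf G 0 0 0)"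
      by (simp add: const3_add)
    ultimately have "F + G = varX * (a + a') + varY * (b + b') + varZ * (c + c') + const3 (cf (F + G) 0 0 0)"
      by (simp only: algebra_simps)
    then show ?case by blast
  next
    case (varX F)
    show ?case by (intro exI[of _ F] exI[of _ 0]) (simp add: cf_varX const3_0)
  next
    case (varY F)
    have "varY * F = varX * 0 + varY * F + varZ * 0 + const3 (cf (varY * F) 0 0 0)"
      by (simp add: cf_varY const3_0)
    then show ?case by blast
  next
    case (varZ F)
    have "varZ * F = varX * 0 + varY * 0 + varZ * F + const3 (cf (varZ * F) 0 0 0)"
      by (simp add: cf_varZ const3_0)
    then show ?case by blast
  qed
  then obtain a b c where "F = varX * a + varY * b + varZ * c + const3 (cf F 0 0 0)" by blast
  moreover have "cf F 0 0 0 = 0" using assms unfolding homogeneous_def by fastforce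
  ultimately have "F = a * varX + b * varY + c * varZ" by (simp add: const3_0 mult.commute)
  then have "homogeneous_part (Suc d) F = homogeneous_part (Suc d) (a * varX + b * varY + c * varZ)" by simp
  also have "\<dots> = homogeneous_part d a * varX + homogeneous_part d b * varY + homogeneous_part d c * varZ"
    unfolding homogeneous_part_add by (simp add: homogeneous_part_mult[of "Suc 0"])
  finally have "F = varX * homogeneous_part d a + varY * homogeneous_part d b + varZ * homogeneous_part d c"
    using assms by (simp add: homogeneous_part_homogeneous mult.commute)
  then show ?thesis using homogeneous_homogeneous_part by blast
qed

lemma map_poly_ring_hom:
  assumes "comm_ring_hom h"
  shows "map_poly h (f + g) = map_poly h f + map_poly h g" "map_poly h (f - g) = map_poly h f - map_poly h g"
    "map_poly h (f * g) = map_poly h f * map_poly h g" "map_poly h (- f) = - map_poly h f"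
    "map_poly h 1 = 1" "map_poly h 0 = 0" "comm_ring_hom (map_poly h)"
proof -
  interpret h: comm_ring_hom h by fact
  interpret m: map_poly_comm_ring_hom h ..
  show "map_poly h (f + g) = map_poly h f + map_poly h g" "map_poly h (f - g) = map_poly h f - map_poly h g"
    "map_poly h (f * g) = map_poly h f * map_poly h g" "map_poly h (- f) = - map_poly h f"
    "map_poly h 1 = 1" "map_poly h 0 = 0"
    by (simp_all add: m.hom_add m.hom_minus m.hom_mult m.hom_uminus)
  show "comm_ring_hom (map_poly h)" ..
qed

lemma poly_comm_ring_hom: "comm_ring_hom (\<lambda>p. poly p z)"
  by unfold_locales

section \<open>Ideals of bivariate polynomials\<close>

definition ideal_set :: "'a :: comm_ring_1 set \<Rightarrow> bool" where
  "ideal_set K \<longleftrightarrow> (\<forall>x\<in>K. \<forall>y\<in>K. x + y \<in> K) \<and> (\<forall>x\<in>K. \<forall>r. r * x \<in> K)"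

lemma ideal_setD:
  assumes "ideal_set K"
  shows "x \<in> K \<Longrightarrow> y \<in> K \<Longrightarrow> x + y \<in> K" "x \<in> K \<Longrightarrow> r * x \<in> K" "x \<in> K \<Longrightarrow> x * r \<in> K"
    "x \<in> K \<Longrightarrow> y \<in> K \<Longrightarrow> x - y \<in> K"
proof -
  show *: "x \<in> K \<Longrightarrow> y \<in> K \<Longrightarrow> x + y \<in> K" "x \<in> K \<Longrightarrow> r * x \<in> K" for x y r
    using assms by (auto simp: ideal_set_def)
  show "x \<in> K \<Longrightarrow> x * r \<in> K" using *(2)[of x r] by (simp add: mult.commute)
  show "x \<in> K \<Longrightarrow> y \<in> K \<Longrightarrow> x - y \<in> K" using *(1)[of x "- 1 * y"] *(2)[of y "- 1"] by simp
qed

lemma ideal_set_colon: "ideal_set K \<Longrightarrow> ideal_set {g. h * g \<in> K}"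
  unfolding ideal_set_def by (auto simp: distrib_left mult.left_commute)

text \<open>A root z of \<open>e\<close> is removed by passing to the colon ideal of x - z, which
  contains e / (x - z) and still has no common zero. By induction it contains 1, so x - z lies in
  \<open>K\<close>; an element of \<open>K\<close> that is nonzero at z then leaves a nonzero
  constant modulo x - z. This argument carries over to two variables.\<close>

lemma nullstellensatz1:
  fixes K :: "complex poly set"
  assumes "ideal_set K" "e \<in> K" "e \<noteq> 0" "\<And>z. \<exists>g\<in>K. poly g z \<noteq> 0"
  shows "1 \<in> K"
  using assms
proof (induction "degree e" arbitrary: e K rule: less_induct)
  case less
  show ?case
  proof (cases "degree e = 0")
    case True
    then obtain c where c: "e = [:c:]" by (rule degree_eq_zeroE)
    then have "[:inverse c:] * e = 1" using \<open>e \<noteq> 0\<close> by (simp add: one_pCons)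
    then show ?thesis using ideal_setD(2)[OF less.prems(1,2), of "[:inverse c:]"] by simp
  next
    case False
    then obtain z where "poly e z = 0"
      using fundamental_theorem_of_algebra_alt[of e] by (metis degree_pCons_0)
    then obtain h where h: "e = [:- z, 1:] * h" using poly_eq_0_iff_dvd by blast
    then have "h \<noteq> 0" "degree h < degree e" using \<open>e \<noteq> 0\<close> by (auto simp: degree_mult_eq simp del: mult_pCons_left)
    moreover have "\<exists>g\<in>{g. [:- z, 1:] * g \<in> K}. poly g x \<noteq> 0" for x
      using less.prems(4)[of x] ideal_setD(2)[OF less.prems(1)] by blast
    ultimately have "1 \<in> {g. [:- z, 1:] * g \<in> K}"
      using less.hyps[of h "{g. [:- z, 1:] * g \<in> K}"] ideal_set_colon[OF less.prems(1)] less.prems(2) h by blast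
    then have zK: "[:- z, 1:] \<in> K" by (simp only: mem_Collect_eq mult_1_right)
    obtain g where g: "g \<in> K" "poly g z \<noteq> 0" using less.prems(4) by blast
    have "poly (g - [:poly g z:]) z = 0" by simp
    then obtain q where "g - [:poly g z:] = [:- z, 1:] * q" using poly_eq_0_iff_dvd by blast
    then have "[:poly g z:] = g - [:- z, 1:] * q" by (simp add: algebra_simps)
    then have "[:poly g z:] \<in> K"
      using ideal_setD(4)[OF less.prems(1) g(1) ideal_setD(3)[OF less.prems(1) zK]] by simp
    from ideal_setD(2)[OF less.prems(1) this, of "[:inverse (poly g z):]"]
    show ?thesis using g(2) by (simp add: one_pCons)
  qed
qed

lemma eval2_ring_hom:
  "eval2 (f + g) q = eval2 f q + eval2 g q" "eval2 (f - g) q = eval2 f q - eval2 g q"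
  "eval2 (f * g) q = eval2 f q * eval2 g q" "eval2 (- f) q = - eval2 f q"
  "eval2 0 q = 0" "eval2 1 q = 1" "eval2 (const2 c) q = c"
  by (simp_all add: eval2_def const2_def split: prod.split)

lemma eval2_vars: "eval2 [:[:0, 1:]:] q = fst q" "eval2 [:0, 1:] q = snd q" "eval2 [:p:] q = poly p (fst q)"
  by (simp_all add: eval2_def split: prod.split)

lemma const_dvd_iff:
  fixes f :: poly2
  shows "[:[:- z, 1:]:] dvd f \<longleftrightarrow> map_poly (\<lambda>p. poly p z) f = 0"
  unfolding const_poly_dvd_iff
  by (auto simp: poly_eq_iff coeff_map_poly poly_eq_0_iff_dvd)

lemma map_poly_const: "h 0 = 0 \<Longrightarrow> map_poly h [:a:] = [:h a:]"
  by (simp add: poly_eq_iff coeff_map_poly coeff_pCons split: nat.splits)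

lemma eval2_specialize: "eval2 f (z, v) = poly (map_poly (\<lambda>p. poly p z) f) v"
  by (induction f rule: poly2_induct)
    (simp_all add: eval2_ring_hom eval2_vars map_poly_ring_hom[OF poly_comm_ring_hom],
      simp_all add: const2_def map_poly_const)

text \<open>\<open>[:c:]\<close> depends on u alone. As in one variable, induction on the degree of
  \<open>c\<close> with colon ideals puts u - z into \<open>K\<close>; the restriction of
  \<open>K\<close> to the line u = z is then an ideal in one variable without zeros.\<close>

lemma nullstellensatz2:
  fixes K :: "poly2 set"
  assumes "ideal_set K" "[:c:] \<in> K" "c \<noteq> 0" "\<And>q. \<exists>g\<in>K. eval2 g q \<noteq> 0"
  shows "1 \<in> K"
  using assms
proof (induction "degree c" arbitrary: c K rule: less_induct)
  case less
  show ?case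
  proof (cases "degree c = 0")
    case True
    then obtain b where b: "c = [:b:]" by (rule degree_eq_zeroE)
    then have "[:[:inverse b:]:] * [:c:] = 1" using \<open>c \<noteq> 0\<close> by (simp add: one_pCons)
    then show ?thesis using ideal_setD(2)[OF less.prems(1,2), of "[:[:inverse b:]:]"] by simp
  next
    case False
    then obtain z where "poly c z = 0"
      using fundamental_theorem_of_algebra_alt[of c] by (metis degree_pCons_0)
    then obtain h where h: "c = [:- z, 1:] * h" using poly_eq_0_iff_dvd by blast
    let ?K = "{g. [:[:- z, 1:]:] * g \<in> K}"
    have "h \<noteq> 0" "degree h < degree c"
      using h \<open>c \<noteq> 0\<close> by (auto simp: degree_mult_eq simp del: mult_pCons_left)
    moreover have "\<exists>g\<in>?K. eval2 g x \<noteq> 0" for x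
      using less.prems(4)[of x] ideal_setD(2)[OF less.prems(1)] by blast
    moreover have "[:h:] \<in> ?K" using less.prems(2) h by simp
    ultimately have "1 \<in> ?K"
      using less.hyps[of h ?K] ideal_set_colon[OF less.prems(1)] by blast
    then have zK: "[:[:- z, 1:]:] \<in> K" by (simp only: mem_Collect_eq mult_1_right)
    define sp :: "poly2 \<Rightarrow> complex poly" where "sp = map_poly (\<lambda>p. poly p z)"
    have sp_hom: "sp (f + g) = sp f + sp g" "sp (f * g) = sp f * sp g" "sp (f - g) = sp f - sp g" for f g
      by (simp_all add: sp_def map_poly_ring_hom[OF poly_comm_ring_hom])
    have sp_lift: "sp (map_poly (\<lambda>x. [:x:]) p) = p" for p
      by (simp add: sp_def map_poly_map_poly o_def)
    have "ideal_set (sp ` K)"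
      unfolding ideal_set_def
    proof (intro conjI ballI allI)
      fix x y r assume "x \<in> sp ` K"
      then obtain f where f: "f \<in> K" "x = sp f" by blast
      have "r * x = sp (map_poly (\<lambda>x. [:x:]) r * f)" by (simp add: sp_hom sp_lift f)
      then show "r * x \<in> sp ` K" using ideal_setD(2)[OF less.prems(1) f(1)] by blast
    next
      fix x y assume "x \<in> sp ` K" "y \<in> sp ` K"
      then obtain f g where "f \<in> K" "x = sp f" "g \<in> K" "y = sp g" by blast
      then show "x + y \<in> sp ` K" using ideal_setD(1)[OF less.prems(1)] sp_hom(1)[of f g] by (metis imageI)
    qed
    moreover have roots: "\<exists>g\<in>sp ` K. poly g x \<noteq> 0" for x
      using less.prems(4)[of "(z, x)"] by (auto simp: eval2_specialize sp_def)
    then obtain g0 where "g0 \<in> sp ` K" "g0 \<noteq> 0" by (metis poly_0)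
    ultimately have "1 \<in> sp ` K" using nullstellensatz1[of "sp ` K"] roots by blast
    then obtain g where g: "g \<in> K" "sp g = 1" by auto
    have "sp (g - 1) = 0" using g(2) by (simp add: sp_hom(3)) (simp add: sp_def)
    then have "[:[:- z, 1:]:] dvd g - 1" by (simp add: const_dvd_iff sp_def)
    then obtain q where "g - 1 = [:[:- z, 1:]:] * q" by blast
    then have "1 = g - [:[:- z, 1:]:] * q" by (simp add: algebra_simps)
    moreover have "g - [:[:- z, 1:]:] * q \<in> K"
      using ideal_setD(4)[OF less.prems(1) g(1) ideal_setD(3)[OF less.prems(1) zK]] .
    ultimately show ?thesis by simp
  qed
qed

text \<open>Pseudo-division shows that an element of least degree in v generates \<open>K\<close>
  over the field of rational functions in u. By Gauss's lemma its primitive part divides all of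
  \<open>K\<close>, hence is a unit, and the element depends on u alone.\<close>

lemma elimination:
  fixes K :: "poly2 set"
  assumes K: "ideal_set K" and cop: "\<And>D. (\<And>g. g \<in> K \<Longrightarrow> D dvd g) \<Longrightarrow> is_unit D"
  shows "\<exists>c. c \<noteq> 0 \<and> [:c:] \<in> K"
proof -
  have "\<exists>g\<in>K. g \<noteq> 0" using cop[of 0] by force
  then obtain e where e: "e \<in> K" "e \<noteq> 0" and min: "\<And>g. g \<in> K \<Longrightarrow> g \<noteq> 0 \<Longrightarrow> degree e \<le> degree g"
    using ex_has_least_nat[of "\<lambda>g. g \<in> K \<and> g \<noteq> 0" _ degree] by blast
  have "primitive_part e dvd g" if "g \<in> K" for g
  proof -
    obtain q r where qr: "pseudo_divmod g e = (q, r)" by fastforce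
    define c where "c = lead_coeff e ^ (Suc (degree g) - degree e)"
    have c: "c \<noteq> 0" using e(2) by (simp add: c_def)
    have gr: "Polynomial.smult c g = e * q + r" "r = 0 \<or> degree r < degree e"
      using pseudo_divmod[OF e(2) qr] by (simp_all add: c_def)
    have "r = [:c:] * g - e * q" using gr(1) by simp
    then have "r \<in> K"
      using ideal_setD(4)[OF K ideal_setD(2)[OF K that] ideal_setD(3)[OF K e(1)]] by blast
    then have "r = 0" using min gr(2) by force
    then have "Polynomial.smult c g = primitive_part e * Polynomial.smult (content e) q"
      using gr(1) by (metis add_0_right content_times_primitive_part mult_smult_left mult_smult_right)
    then have "primitive_part e dvd Polynomial.smult c g" by (metis dvd_triv_left)
    then have "fract_poly (primitive_part e) dvd Polynomial.smult (to_fract c) (fract_poly g)"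
      by (metis fract_poly_dvd fract_poly_smult)
    then have "fract_poly (primitive_part e) dvd fract_poly g" using c by (simp add: dvd_smult_iff)
    then show ?thesis by (rule fract_poly_dvdD) (use e(2) in simp)
  qed
  then have "is_unit (primitive_part e)" by (rule cop)
  then have "degree (primitive_part e) = 0" by (metis is_unit_poly_iff degree_pCons_0)
  then have "degree e = 0" by simp
  then show ?thesis using e by (metis degree_eq_zeroE pCons_0_0)
qed

section \<open>Affine charts\<close>

lemma eval3_ring_hom:
  "eval3 (f + g) w = eval3 f w + eval3 g w" "eval3 (f - g) w = eval3 f w - eval3 g w"
  "eval3 (f * g) w = eval3 f w * eval3 g w" "eval3 (- f) w = - eval3 f w"
  "eval3 0 w = 0" "eval3 1 w = 1" "eval3 (const3 c) w = c" "eval3 (f ^ n) w = eval3 f w ^ n"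
proof -
  show *: "eval3 (f + g) w = eval3 f w + eval3 g w" "eval3 (f - g) w = eval3 f w - eval3 g w"
    "eval3 (f * g) w = eval3 f w * eval3 g w" "eval3 (- f) w = - eval3 f w"
    "eval3 0 w = 0" "eval3 1 w = 1" "eval3 (const3 c) w = c" for f g
    by (simp_all add: eval3_def const3_def split: prod.split)
  show "eval3 (f ^ n) w = eval3 f w ^ n" by (induction n) (simp_all add: *)
qed

lemma eval3_vars: "eval3 varX (x, y, z) = x" "eval3 varY (x, y, z) = y" "eval3 varZ (x, y, z) = z"
  by (simp_all add: eval3_def varX_def varY_def varZ_def)

lemma eval3_sum: "eval3 (\<Sum>m\<in>M. f m) w = (\<Sum>m\<in>M. eval3 (f m) w)"
  by (induction M rule: infinite_finite_induct) (simp_all add: eval3_ring_hom)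

lemma eval3_scale:
  assumes "homogeneous d F"
  shows "eval3 F (c * x, c * y, c * z) = c ^ d * eval3 F (x, y, z)"
proof -
  define a where "a = (\<lambda>m. case m of (i, j, k) \<Rightarrow> cf F i j k)"
  have F: "F = (\<Sum>m\<in>triples d. const3 (a m) * monom3 m)"
    using homogeneous_part_homogeneous[OF assms, of d] by (simp add: homogeneous_part_def a_def)
  have "eval3 (const3 (a m) * monom3 m) (c * x, c * y, c * z)
      = c ^ d * eval3 (const3 (a m) * monom3 m) (x, y, z)" if "m \<in> triples d" for m
  proof -
    obtain i j k where m: "m = (i, j, k)" by (cases m)
    have d: "d = i + j + k" using that m by (simp add: triples_def)
    show ?thesis
      by (simp add: m d monom3_def eval3_ring_hom eval3_vars power_mult_distrib power_add mult_ac)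
  qed
  then show ?thesis
    unfolding F eval3_sum sum_distrib_left by (rule sum.cong[OF refl])
qed

definition ideal3 :: "poly3 \<Rightarrow> poly3 \<Rightarrow> poly3 \<Rightarrow> poly3 set" where
  "ideal3 A B C = {a * A + b * B + c * C | a b c. True}"

lemma ideal_set_ideal3: "ideal_set (ideal3 A B C)"
  unfolding ideal_set_def ideal3_def
proof (intro conjI ballI allI)
  fix x y r assume "x \<in> {a * A + b * B + c * C | a b c. True}"
  then obtain a b c where x: "x = a * A + b * B + c * C" by blast
  have "r * x = (r * a) * A + (r * b) * B + (r * c) * C" by (simp add: x algebra_simps)
  then show "r * x \<in> {a * A + b * B + c * C | a b c. True}" by blast
next
  fix x y assume "x \<in> {a * A + b * B + c * C | a b c. True}" "y \<in> {a * A + b * B + c * C | a b c. True}"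
  then obtain a b c a' b' c' where x: "x = a * A + b * B + c * C" "y = a' * A + b' * B + c' * C" by blast
  have "x + y = (a + a') * A + (b + b') * B + (c + c') * C" by (simp add: x algebra_simps)
  then show "x + y \<in> {a * A + b * B + c * C | a b c. True}" by blast
qed

lemma dvd_power_mult_prime:
  fixes p :: poly3
  assumes "prime_elem p" "\<not> p dvd H" "H dvd p ^ m * A"
  shows "H dvd A"
proof -
  have "coprime H (p ^ m)"
    using prime_elem_imp_coprime[OF assms(1,2)] by (simp add: coprime_commute)
  then show ?thesis using assms(3) coprime_dvd_mult_right_iff by blast
qed

text \<open>One set of lemmas for the three standard charts: \<open>T\<close> is the variable put
  equal to 1, \<open>U\<close> and \<open>V\<close> become the coordinates, and \<open>pt\<close>
  embeds the affine plane. Injectivity of \<open>D\<close> on forms of one degree is what lifts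
  identities in the chart to forms.\<close>

locale chart =
  fixes D :: "poly3 \<Rightarrow> poly2" and T U V :: poly3
    and dT dU dV :: "poly3 \<Rightarrow> poly3"
    and pt :: "complex \<times> complex \<Rightarrow> complex \<times> complex \<times> complex"
  assumes D_add: "D (F + G) = D F + D G" and D_mult: "D (F * G) = D F * D G"
    and D_const: "D (const3 c) = const2 c"
    and D_vars: "D T = 1" "D U = [:[:0, 1:]:]" "D V = [:0, 1:]"
    and D_inj: "homogeneous d F \<Longrightarrow> D F = 0 \<Longrightarrow> F = 0"
    and hom_vars: "homogeneous (Suc 0) T" "homogeneous (Suc 0) U" "homogeneous (Suc 0) V"
    and prime_T: "prime_elem T"
    and eval_D: "eval2 (D F) q = eval3 F (pt q)"
    and euler_vars: "euler F = U * dU F + V * dV F + T * dT F"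
    and partial_D: "partial_u (D F) = D (dU F)" "partial_v (D F) = D (dV F)"
begin

lemma D_0 [simp]: "D 0 = 0" using D_add[of 0 0] by simp
lemma D_1 [simp]: "D 1 = 1" using D_const[of 1] by (simp add: const3_1 const2_def one_pCons)
lemma D_uminus: "D (- F) = - D F" using D_add[of F "- F"] by (simp add: eq_neg_iff_add_eq_0 add.commute)
lemma D_diff: "D (F - G) = D F - D G" using D_add[of F "- G"] by (simp add: D_uminus)
lemma D_power: "D (F ^ n) = D F ^ n" by (induction n) (simp_all add: D_mult)
lemma D_of_nat: "D (of_nat n) = of_nat n" by (induction n) (simp_all add: D_add)

lemma D_eqI: "homogeneous d F \<Longrightarrow> homogeneous d G \<Longrightarrow> D F = D G \<Longrightarrow> F = G"
  using D_inj[OF homogeneous_diff[of d F G]] by (simp add: D_diff)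

text \<open>Powers of \<open>T\<close> pad the degree, so all large degrees occur; this allows
  several polynomials to be lifted to one common degree.\<close>

lemma homogenize: "\<exists>N. \<forall>n\<ge>N. \<exists>F. homogeneous n F \<and> D F = f"
proof (induction f rule: poly2_induct)
  case (const c)
  have "homogeneous n (const3 c * T ^ n)" for n
    using homogeneous_const3_mult[OF homogeneous_power[OF hom_vars(1), of n]] by simp
  moreover have "D (const3 c * T ^ n) = const2 c" for n
    by (simp add: D_mult D_power D_const D_vars)
  ultimately show ?case by blast
next
  case varu
  have "\<exists>F. homogeneous n F \<and> D F = [:[:0, 1:]:]" if "n \<ge> 1" for n
  proof (intro exI conjI)
    show "homogeneous n (U * T ^ (n - 1))"
      using homogeneous_mult[OF hom_vars(2) homogeneous_power[OF hom_vars(1), of "n - 1"]] that by simp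
    show "D (U * T ^ (n - 1)) = [:[:0, 1:]:]" by (simp add: D_mult D_power D_vars)
  qed
  then show ?case by blast
next
  case varv
  have "\<exists>F. homogeneous n F \<and> D F = [:0, 1:]" if "n \<ge> 1" for n
  proof (intro exI conjI)
    show "homogeneous n (V * T ^ (n - 1))"
      using homogeneous_mult[OF hom_vars(3) homogeneous_power[OF hom_vars(1), of "n - 1"]] that by simp
    show "D (V * T ^ (n - 1)) = [:0, 1:]" by (simp add: D_mult D_power D_vars)
  qed
  then show ?case by blast
next
  case (add p q)
  then obtain M N where M: "\<And>n. n \<ge> M \<Longrightarrow> \<exists>F. homogeneous n F \<and> D F = p"
    and N: "\<And>n. n \<ge> N \<Longrightarrow> \<exists>F. homogeneous n F \<and> D F = q" by blast
  have "\<exists>F. homogeneous n F \<and> D F = p + q" if "n \<ge> max M N" for n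
    using M[of n] N[of n] that homogeneous_add D_add by (metis max.bounded_iff)
  then show ?case by blast
next
  case (mult p q)
  then obtain M N where M: "\<And>n. n \<ge> M \<Longrightarrow> \<exists>F. homogeneous n F \<and> D F = p"
    and N: "\<And>n. n \<ge> N \<Longrightarrow> \<exists>F. homogeneous n F \<and> D F = q" by blast
  have "\<exists>F. homogeneous n F \<and> D F = p * q" if "n \<ge> M + N" for n
  proof -
    obtain F G where "homogeneous M F" "D F = p" "homogeneous (n - M) G" "D G = q"
      using M[of M] N[of "n - M"] \<open>n \<ge> M + N\<close> by (auto simp: le_diff_conv2)
    then show ?thesis
      using homogeneous_mult[of M F "n - M" G] that by (intro exI[of _ "F * G"]) (simp add: D_mult)
  qed
  then show ?case by blast
qed

text \<open>A lift of least degree works, since a factor \<open>T\<close> could be removed without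
  changing the image in the chart.\<close>

lemma homogenize_reduced:
  assumes "f \<noteq> 0"
  shows "\<exists>n H. homogeneous n H \<and> D H = f \<and> \<not> T dvd H"
proof -
  define n where "n = (LEAST n. \<exists>H. homogeneous n H \<and> D H = f)"
  have "\<exists>n H. homogeneous n H \<and> D H = f" using homogenize[of f] by blast
  then have "\<exists>H. homogeneous n H \<and> D H = f" unfolding n_def by (rule LeastI_ex)
  then obtain H where H: "homogeneous n H" "D H = f" by blast
  have "\<not> T dvd H"
  proof
    assume "T dvd H"
    then obtain G where G: "H = T * G" by blast
    have "G \<noteq> 0" using H G assms by auto
    then have *: "Suc 0 \<le> n" "homogeneous (n - Suc 0) G"
      using homogeneous_factor[of n T G] H(1) G hom_vars(1) prime_T by auto
    moreover have "D G = f" using H(2) G by (simp add: D_mult D_vars)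
    ultimately have "n \<le> n - Suc 0"
      unfolding n_def by (intro Least_le) (auto simp: n_def)
    then show False using * by simp
  qed
  then show ?thesis using H by blast
qed

lemma dvd_homogenize:
  assumes A: "homogeneous a A" and H: "homogeneous h H" "\<not> T dvd H" and dvd: "D H dvd D A"
  shows "H dvd A"
proof -
  obtain g where g: "D A = D H * g" using dvd by blast
  obtain N where N: "\<And>n. n \<ge> N \<Longrightarrow> \<exists>F. homogeneous n F \<and> D F = g" using homogenize by blast
  \<comment> \<open>The degree N + a, instead of N, makes \<open>H * B\<close> a form of degree h +
    N + a, so that its defect against \<open>A\<close> is the power
    \<open>T ^ (h + N)\<close>.\<close>
  obtain B where B: "homogeneous (N + a) B" "D B = g" using N[of "N + a"] by auto
  have "homogeneous (h + (N + a)) (H * B)" by (rule homogeneous_mult[OF H(1) B(1)])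
  moreover have "homogeneous (h + (N + a)) (T ^ (h + N) * A)"
    using homogeneous_mult[OF homogeneous_power[OF hom_vars(1), of "h + N"] A] by (simp add: ac_simps)
  moreover have "D (H * B) = D (T ^ (h + N) * A)"
    by (simp add: D_mult D_power D_vars g B)
  ultimately have "H * B = T ^ (h + N) * A" by (rule D_eqI)
  then have "H dvd T ^ (h + N) * A" by (metis dvd_triv_left)
  then show ?thesis using dvd_power_mult_prime[OF prime_T H(2)] by blast
qed

text \<open>Coprimality passes to the chart: a common divisor there has a lift without factor
  \<open>T\<close>, and this lift divides the three forms.\<close>

lemma is_unit_D:
  assumes "coprime3 A B C" and "homogeneous a A" "homogeneous b B" "homogeneous c C"
    and "f dvd D A" "f dvd D B" "f dvd D C"
  shows "is_unit f"
proof -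
  have "f \<noteq> 0"
  proof
    assume "f = 0"
    then have "A = 0" "B = 0" "C = 0" using assms(2-) D_inj by auto
    then show False using assms(1) unfolding coprime3_def by (metis dvd_0_right not_is_unit_0)
  qed
  then obtain n H where H: "homogeneous n H" "D H = f" "\<not> T dvd H" using homogenize_reduced by blast
  then have "H dvd A" "H dvd B" "H dvd C"
    using dvd_homogenize[OF _ H(1,3)] assms by auto
  then have "is_unit H" using assms(1) unfolding coprime3_def by blast
  then obtain G where "1 = H * G" by blast
  then have "1 = D H * D G" using D_mult[of H G] D_1 by simp
  then show ?thesis unfolding H(2) by (rule dvdI)
qed

text \<open>The coefficients are lifted to degree \<open>M + d\<close> and the multiplier to degree
  \<open>M + e\<close>; both sides are then forms of degree \<open>M + d + e\<close> with equal
  images in the chart, hence equal.\<close>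

lemma ideal_homogenize:
  assumes F: "homogeneous d F" and A: "homogeneous e A" "homogeneous e B" "homogeneous e C"
    and eq: "g * D F = a * D A + b * D B + c * D C"
  shows "\<exists>n G. homogeneous n G \<and> D G = g \<and> G * F \<in> ideal3 A B C"
proof -
  have hom: "\<exists>N. \<forall>n\<ge>N. \<exists>F. homogeneous n F \<and> D F = f" for f by (rule homogenize)
  obtain Na where Na: "\<And>n. n \<ge> Na \<Longrightarrow> \<exists>F. homogeneous n F \<and> D F = a" using hom[of a] by blast
  obtain Nb where Nb: "\<And>n. n \<ge> Nb \<Longrightarrow> \<exists>F. homogeneous n F \<and> D F = b" using hom[of b] by blast
  obtain Nc where Nc: "\<And>n. n \<ge> Nc \<Longrightarrow> \<exists>F. homogeneous n F \<and> D F = c" using hom[of c] by blast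
  obtain Ng where Ng: "\<And>n. n \<ge> Ng \<Longrightarrow> \<exists>F. homogeneous n F \<and> D F = g" using hom[of g] by blast
  define M where "M = Na + Nb + Nc + Ng"
  have le: "Na \<le> M + d" "Nb \<le> M + d" "Nc \<le> M + d" "Ng \<le> M + e" by (simp_all add: M_def)
  obtain a' where a': "homogeneous (M + d) a'" "D a' = a" using Na[OF le(1)] by blast
  obtain b' where b': "homogeneous (M + d) b'" "D b' = b" using Nb[OF le(2)] by blast
  obtain c' where c': "homogeneous (M + d) c'" "D c' = c" using Nc[OF le(3)] by blast
  obtain G where G: "homogeneous (M + e) G" "D G = g" using Ng[OF le(4)] by blast
  have "homogeneous (M + d + e) (a' * A + b' * B + c' * C)"
    by (intro homogeneous_add homogeneous_mult A a' b' c')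
  moreover have "homogeneous (M + d + e) (G * F)"
    using homogeneous_mult[OF G(1) F] by (simp add: ac_simps)
  moreover have "D (G * F) = D (a' * A + b' * B + c' * C)"
    by (simp add: D_mult D_add G eq a' b' c')
  ultimately have "G * F = a' * A + b' * B + c' * C" using D_eqI by blast
  then have "G * F \<in> ideal3 A B C" unfolding ideal3_def by blast
  then show ?thesis using G by blast
qed

text \<open>\<open>K\<close> is the ideal of multipliers that carry \<open>D F\<close> into the
  ideal of the chart. It has no zeros by the local hypothesis and contains the coprime
  \<open>D A\<close>, \<open>D B\<close>, \<open>D C\<close>, so it contains 1. A form that lifts
  the multiplier 1 is a power of \<open>T\<close>.\<close>

lemma power_in_ideal:
  assumes F: "homogeneous d F" and A: "homogeneous e A" "homogeneous e B" "homogeneous e C"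
    and cop: "coprime3 A B C"
    and loc: "\<And>q. \<exists>G. eval3 G (pt q) \<noteq> 0 \<and> G * F \<in> ideal3 A B C"
  shows "\<exists>n. T ^ n * F \<in> ideal3 A B C"
proof -
  define K where "K = {g. \<exists>a b c. g * D F = a * D A + b * D B + c * D C}"
  have K: "ideal_set K"
    unfolding ideal_set_def
  proof (intro conjI ballI allI)
    fix x y r assume "x \<in> K"
    then obtain a b c where "x * D F = a * D A + b * D B + c * D C" unfolding K_def by blast
    then have "(r * x) * D F = (r * a) * D A + (r * b) * D B + (r * c) * D C"
      by (simp add: mult.assoc distrib_left)
    then show "r * x \<in> K" unfolding K_def by blast
  next
    fix x y assume "x \<in> K" "y \<in> K"
    then obtain a b c a' b' c' where "x * D F = a * D A + b * D B + c * D C"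
      "y * D F = a' * D A + b' * D B + c' * D C" unfolding K_def by blast
    then have "(x + y) * D F = (a + a') * D A + (b + b') * D B + (c + c') * D C"
      by (simp add: distrib_right)
    then show "x + y \<in> K" unfolding K_def by blast
  qed
  have in_K: "g \<in> K" if "g * D F = a * D A + b * D B + c * D C" for g a b c
    using that unfolding K_def by blast
  have ABC: "D A \<in> K" "D B \<in> K" "D C \<in> K"
    by (rule in_K[of _ "D F" 0 0] in_K[of _ 0 "D F" 0] in_K[of _ 0 0 "D F"], simp add: mult.commute)+
  have "\<exists>c. c \<noteq> 0 \<and> [:c:] \<in> K"
  proof (rule elimination[OF K])
    fix f assume "\<And>g. g \<in> K \<Longrightarrow> f dvd g"
    then show "is_unit f" using is_unit_D[OF cop A] ABC by blast
  qed
  then obtain c where c: "c \<noteq> 0" "[:c:] \<in> K" by blast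
  have "\<exists>g\<in>K. eval2 g q \<noteq> 0" for q
  proof -
    obtain G where G: "eval3 G (pt q) \<noteq> 0" "G * F \<in> ideal3 A B C" using loc by blast
    then obtain a b c where "G * F = a * A + b * B + c * C" unfolding ideal3_def by blast
    then have "D (G * F) = D (a * A + b * B + c * C)" by simp
    then have "D G \<in> K" unfolding D_mult D_add by (rule in_K)
    moreover have "eval2 (D G) q \<noteq> 0" using G(1) by (simp add: eval_D)
    ultimately show ?thesis by blast
  qed
  then have "1 \<in> K" using nullstellensatz2[OF K c(2,1)] by blast
  then obtain a b c where "1 * D F = a * D A + b * D B + c * D C" unfolding K_def by blast
  then obtain n G where G: "homogeneous n G" "D G = 1" "G * F \<in> ideal3 A B C"
    using ideal_homogenize[OF F A] by blast
  have "homogeneous n (T ^ n)" using homogeneous_power[OF hom_vars(1), of n] by simp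
  then have "G = T ^ n" using D_eqI[OF G(1)] G(2) by (simp add: D_power D_vars)
  then show ?thesis using G by blast
qed

end

section \<open>Construction of the three standard charts\<close>

lemma poly_eq_0_of_infinite_roots:
  fixes p :: "'a :: idom poly"
  assumes "\<And>x. x \<in> S \<Longrightarrow> poly p x = 0" "infinite S"
  shows "p = 0"
proof (rule ccontr)
  assume "p \<noteq> 0"
  then have "finite {x. poly p x = 0}" by (rule poly_roots_finite)
  moreover have "S \<subseteq> {x. poly p x = 0}" using assms(1) by blast
  ultimately show False using assms(2) finite_subset by blast
qed

lemma eval3_eq_0_imp:
  assumes "\<And>x y z. eval3 F (x, y, z) = 0"
  shows "F = 0"
proof (rule poly_eq_0_of_infinite_roots[where S = "range (\<lambda>z. [:[:z:]:])"])
  have inf: "infinite (UNIV :: complex set)" by (rule infinite_UNIV_char_0)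
  then show "infinite (range (\<lambda>z :: complex. [:[:z:]:]))"
    by (simp add: finite_image_iff inj_def)
  fix x assume "x \<in> range (\<lambda>z :: complex. [:[:z:]:])"
  then obtain z where x: "x = [:[:z:]:]" by blast
  show "poly F x = 0"
  proof (rule poly_eq_0_of_infinite_roots[where S = "range (\<lambda>y. [:y:])"])
    show "infinite (range (\<lambda>y :: complex. [:y:]))"
      using inf by (simp add: finite_image_iff inj_def)
    fix y' assume "y' \<in> range (\<lambda>y :: complex. [:y:])"
    then obtain y where y: "y' = [:y:]" by blast
    show "poly (poly F x) y' = 0"
      by (rule poly_eq_0_of_infinite_roots[where S = UNIV])
        (use assms inf in \<open>simp_all add: eval3_def x y\<close>)
  qed
qed

lemma prime_elem_var: "prime_elem ([:0, 1:] :: 'a :: idom poly)"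
proof (rule prime_elemI)
  fix p q :: "'a poly"
  assume "[:0, 1:] dvd p * q"
  then show "[:0, 1:] dvd p \<or> [:0, 1:] dvd q"
    using poly_eq_0_iff_dvd[of p 0] poly_eq_0_iff_dvd[of q 0] poly_eq_0_iff_dvd[of "p * q" 0] by simp
qed (auto simp: is_unit_poly_iff)

lemma prime_vars: "prime_elem varX" "prime_elem varY" "prime_elem varZ"
  unfolding varX_def varY_def varZ_def by (simp_all add: prime_elem_const_poly_iff prime_elem_var)

lemma partial_u_mult: "partial_u (f * g) = f * partial_u g + g * partial_u f"
  unfolding partial_u_def by (rule map_poly_leibniz) (simp_all add: pderiv_add pderiv_mult)

lemma partial_v_mult: "partial_v (f * g) = f * partial_v g + g * partial_v f"
  by (simp add: partial_v_def pderiv_mult)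

lemma partial_uv_add: "partial_u (f + g) = partial_u f + partial_u g" "partial_v (f + g) = partial_v f + partial_v g"
  by (simp_all add: partial_u_def partial_v_def pderiv_add map_poly_add)

lemma partial_uv_diff: "partial_u (f - g) = partial_u f - partial_u g" "partial_v (f - g) = partial_v f - partial_v g"
  by (simp_all add: partial_u_def partial_v_def pderiv_diff poly_eq_iff coeff_map_poly)

lemma partial_uv_vars:
  "partial_u [:[:0, 1:]:] = 1" "partial_v [:[:0, 1:]:] = 0"
  "partial_u [:0, 1:] = 0" "partial_v [:0, 1:] = 1"
  "partial_u (const2 c) = 0" "partial_v (const2 c) = 0" "partial_u 1 = 0" "partial_v 1 = 0"
proof -
  show "partial_u [:[:0, 1:]:] = 1" "partial_v [:[:0, 1:]:] = 0"
    "partial_u [:0, 1:] = 0" "partial_v [:0, 1:] = 1"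
    "partial_u (const2 c) = 0" "partial_v (const2 c) = 0" "partial_u 1 = 0" "partial_v 1 = 0"
    by (simp_all add: partial_u_def partial_v_def const2_def pderiv_pCons poly_eq_iff
        coeff_map_poly coeff_pCons split: nat.splits)
qed

lemma partial_vars:
  "partial_X varX = 1" "partial_X varY = 0" "partial_X varZ = 0"
  "partial_Y varX = 0" "partial_Y varY = 1" "partial_Y varZ = 0"
  "partial_Z varX = 0" "partial_Z varY = 0" "partial_Z varZ = 1"
  "partial_X (const3 c) = 0" "partial_Y (const3 c) = 0" "partial_Z (const3 c) = 0"
proof -
  have 1: "cf 1 i j k = (if i = 0 \<and> j = 0 \<and> k = 0 then 1 else 0)" for i j k
    using cf_const3'[of 1] by (simp add: const3_1)
  have vars: "cf varX i j k = (if i = 1 \<and> j = 0 \<and> k = 0 then 1 else 0)"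
    "cf varY i j k = (if i = 0 \<and> j = 1 \<and> k = 0 then 1 else 0)"
    "cf varZ i j k = (if i = 0 \<and> j = 0 \<and> k = 1 then 1 else 0)" for i j k
    using cf_monom3[of 1 0 0] cf_monom3[of 0 1 0] cf_monom3[of 0 0 1] by (simp_all add: monom3_def)
  show
    "partial_X varX = 1" "partial_X varY = 0" "partial_X varZ = 0"
    "partial_Y varX = 0" "partial_Y varY = 1" "partial_Y varZ = 0"
    "partial_Z varX = 0" "partial_Z varY = 0" "partial_Z varZ = 1"
    "partial_X (const3 c) = 0" "partial_Y (const3 c) = 0" "partial_Z (const3 c) = 0"
    by (rule poly3_eqI, simp only: cf_partial_X cf_partial_Y cf_partial_Z cf_const3' vars 1, simp)+
qed

lemma dehom_ring_hom: "comm_ring_hom dehomX" "comm_ring_hom dehomY" "comm_ring_hom dehomZ"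
  unfolding dehomX_def[abs_def] dehomY_def[abs_def] dehomZ_def[abs_def]
  by (intro map_poly_ring_hom(7) poly_comm_ring_hom)+

lemma dehom_vars:
  "dehomX varX = 1" "dehomX varY = [:[:0, 1:]:]" "dehomX varZ = [:0, 1:]" "dehomX (const3 c) = const2 c"
  "dehomY varX = [:[:0, 1:]:]" "dehomY varY = 1" "dehomY varZ = [:0, 1:]" "dehomY (const3 c) = const2 c"
  "dehomZ varX = [:[:0, 1:]:]" "dehomZ varY = [:0, 1:]" "dehomZ varZ = 1" "dehomZ (const3 c) = const2 c"
  by (simp_all add: dehomX_def dehomY_def dehomZ_def varX_def varY_def varZ_def const2_def const3_def
      map_poly_const one_pCons)

lemma eval2_dehom:
  "eval2 (dehomX F) (u, v) = eval3 F (1, u, v)"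
  "eval2 (dehomY F) (u, v) = eval3 F (u, 1, v)"
  "eval2 (dehomZ F) (u, v) = eval3 F (u, v, 1)"
proof -
  interpret X: comm_ring_hom dehomX by (rule dehom_ring_hom)
  interpret Y: comm_ring_hom dehomY by (rule dehom_ring_hom)
  interpret Z: comm_ring_hom dehomZ by (rule dehom_ring_hom)
  show "eval2 (dehomX F) (u, v) = eval3 F (1, u, v)"
    by (induction F rule: poly3_induct)
      (simp_all add: dehom_vars X.hom_add X.hom_mult eval2_ring_hom eval2_vars eval3_ring_hom eval3_vars
        del: mult_pCons_left)
  show "eval2 (dehomY F) (u, v) = eval3 F (u, 1, v)"
    by (induction F rule: poly3_induct)
      (simp_all add: dehom_vars Y.hom_add Y.hom_mult eval2_ring_hom eval2_vars eval3_ring_hom eval3_vars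
        del: mult_pCons_left)
  show "eval2 (dehomZ F) (u, v) = eval3 F (u, v, 1)"
    by (induction F rule: poly3_induct)
      (simp_all add: dehom_vars Z.hom_add Z.hom_mult eval2_ring_hom eval2_vars eval3_ring_hom eval3_vars
        del: mult_pCons_left)
qed

lemma partial_dehom:
  "partial_u (dehomX F) = dehomX (partial_Y F)" "partial_v (dehomX F) = dehomX (partial_Z F)"
  "partial_u (dehomY F) = dehomY (partial_X F)" "partial_v (dehomY F) = dehomY (partial_Z F)"
  "partial_u (dehomZ F) = dehomZ (partial_X F)" "partial_v (dehomZ F) = dehomZ (partial_Y F)"
proof -
  interpret X: comm_ring_hom dehomX by (rule dehom_ring_hom)
  interpret Y: comm_ring_hom dehomY by (rule dehom_ring_hom)
  interpret Z: comm_ring_hom dehomZ by (rule dehom_ring_hom)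
  note rules = dehom_vars partial_vars partial_uv_vars partial_uv_add partial_u_mult partial_v_mult
    partial_X_add partial_Y_add partial_Z_add partial_X_mult partial_Y_mult partial_Z_mult
  show "partial_u (dehomX F) = dehomX (partial_Y F)" "partial_v (dehomX F) = dehomX (partial_Z F)"
    by (induction F rule: poly3_induct; simp add: rules X.hom_add X.hom_mult del: mult_pCons_left)+
  show "partial_u (dehomY F) = dehomY (partial_X F)" "partial_v (dehomY F) = dehomY (partial_Z F)"
    by (induction F rule: poly3_induct; simp add: rules Y.hom_add Y.hom_mult del: mult_pCons_left)+
  show "partial_u (dehomZ F) = dehomZ (partial_X F)" "partial_v (dehomZ F) = dehomZ (partial_Y F)"
    by (induction F rule: poly3_induct; simp add: rules Z.hom_add Z.hom_mult del: mult_pCons_left)+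
qed

text \<open>The chart sees no point with T = 0; multiplying by \<open>T\<close> makes the form
  vanish there as well.\<close>

lemma eq_0_of_eval_chart:
  assumes F: "homogeneous d F" and "prime_elem T"
    and eval: "\<And>x y z. eval3 T (x, y, z) \<noteq> 0 \<Longrightarrow>
      eval3 F (x / eval3 T (x, y, z), y / eval3 T (x, y, z), z / eval3 T (x, y, z)) = 0"
  shows "F = 0"
proof -
  have "eval3 (T * F) (x, y, z) = 0" for x y z
  proof (cases "eval3 T (x, y, z) = 0")
    case False
    define t where "t = eval3 T (x, y, z)"
    have "eval3 F (t * (x / t), t * (y / t), t * (z / t)) = t ^ d * eval3 F (x / t, y / t, z / t)"
      by (rule eval3_scale[OF F])
    then show ?thesis using False eval[of x y z] by (simp add: eval3_ring_hom t_def)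
  qed (simp add: eval3_ring_hom)
  then have "T * F = 0" by (rule eval3_eq_0_imp)
  then show ?thesis using \<open>prime_elem T\<close> by auto
qed

interpretation chartX: chart dehomX varX varY varZ partial_X partial_Y partial_Z "\<lambda>(u, v). (1, u, v)"
proof (unfold_locales, goal_cases)
  case (1 F G)
  interpret comm_ring_hom dehomX by (rule dehom_ring_hom)
  show ?case by (rule hom_add)
next
  case (2 F G)
  interpret comm_ring_hom dehomX by (rule dehom_ring_hom)
  show ?case by (rule hom_mult)
next
  case (7 d F)
  show ?case
  proof (rule eq_0_of_eval_chart[OF 7(1) prime_vars(1)])
    fix x y z show "eval3 F (x / eval3 varX (x, y, z), y / eval3 varX (x, y, z), z / eval3 varX (x, y, z)) = 0"
      if "eval3 varX (x, y, z) \<noteq> 0"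
      using that 7(2) eval2_dehom(1)[of F "y / x" "z / x"] by (simp add: eval3_vars eval2_ring_hom)
  qed
next
  case (12 F q) show ?case by (cases q) (simp add: eval2_dehom)
qed (simp_all add: dehom_vars prime_vars euler_def partial_dehom)

interpretation chartY: chart dehomY varY varX varZ partial_Y partial_X partial_Z "\<lambda>(u, v). (u, 1, v)"
proof (unfold_locales, goal_cases)
  case (1 F G)
  interpret comm_ring_hom dehomY by (rule dehom_ring_hom)
  show ?case by (rule hom_add)
next
  case (2 F G)
  interpret comm_ring_hom dehomY by (rule dehom_ring_hom)
  show ?case by (rule hom_mult)
next
  case (7 d F)
  show ?case
  proof (rule eq_0_of_eval_chart[OF 7(1) prime_vars(2)])
    fix x y z show "eval3 F (x / eval3 varY (x, y, z), y / eval3 varY (x, y, z), z / eval3 varY (x, y, z)) = 0"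
      if "eval3 varY (x, y, z) \<noteq> 0"
      using that 7(2) eval2_dehom(2)[of F "x / y" "z / y"] by (simp add: eval3_vars eval2_ring_hom)
  qed
next
  case (12 F q) show ?case by (cases q) (simp add: eval2_dehom)
qed (simp_all add: dehom_vars prime_vars euler_def partial_dehom)

interpretation chartZ: chart dehomZ varZ varX varY partial_Z partial_X partial_Y "\<lambda>(u, v). (u, v, 1)"
proof (unfold_locales, goal_cases)
  case (1 F G)
  interpret comm_ring_hom dehomZ by (rule dehom_ring_hom)
  show ?case by (rule hom_add)
next
  case (2 F G)
  interpret comm_ring_hom dehomZ by (rule dehom_ring_hom)
  show ?case by (rule hom_mult)
next
  case (7 d F)
  show ?case
  proof (rule eq_0_of_eval_chart[OF 7(1) prime_vars(3)])
    fix x y z show "eval3 F (x / eval3 varZ (x, y, z), y / eval3 varZ (x, y, z), z / eval3 varZ (x, y, z)) = 0"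
      if "eval3 varZ (x, y, z) \<noteq> 0"
      using that 7(2) eval2_dehom(3)[of F "x / z" "y / z"] by (simp add: eval3_vars eval2_ring_hom)
  qed
next
  case (12 F q) show ?case by (cases q) (simp add: eval2_dehom)
qed (simp_all add: dehom_vars prime_vars euler_def partial_dehom)

section \<open>Singularities of Milnor number one\<close>

lemma local_ideal_fraction:
  assumes "w \<in> local_ideal q a b"
  shows "\<exists>d s t. eval2 d q \<noteq> 0 \<and> to_fract d * w = to_fract (s * a + t * b)"
proof -
  obtain s t where w: "w = s * to_fract a + t * to_fract b" "s \<in> local_ring q" "t \<in> local_ring q"
    using assms by (auto simp: local_ideal_def)
  obtain f g f' g' where s: "s = Fraction_Field.Fract f g" "eval2 g q \<noteq> 0"
    and t: "t = Fraction_Field.Fract f' g'" "eval2 g' q \<noteq> 0"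
    using w by (auto simp: local_ring_def)
  have "g \<noteq> 0" "g' \<noteq> 0" using s t by (auto simp: eval2_ring_hom)
  then have "to_fract g * s = to_fract f" "to_fract g' * t = to_fract f'"
    by (simp_all add: s t to_fract_def eq_fract)
  moreover have "to_fract (g * g') * w = to_fract g' * (to_fract g * s) * to_fract a
      + to_fract g * (to_fract g' * t) * to_fract b"
    by (simp add: w algebra_simps)
  ultimately have "to_fract (g * g') * w = to_fract (g' * f * a + g * f' * b)"
    by simp
  moreover have "eval2 (g * g') q \<noteq> 0" using s t by (simp add: eval2_ring_hom)
  ultimately show ?thesis by blast
qed

lemma quotient_dim_1:
  assumes "quotient_dim V W = 1"
  shows "\<exists>e. \<forall>f\<in>V. \<exists>c. f - to_fract (const2 c) * e \<in> W"
proof -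
  have ex: "\<exists>B. finite B \<and> quotient_basis V W B"
    using assms by (auto simp: quotient_dim_def split: if_splits)
  define B where "B = (SOME B. finite B \<and> quotient_basis V W B)"
  have B: "finite B \<and> quotient_basis V W B"
    unfolding B_def using ex by (rule someI_ex)
  have "card B = 1"
    using assms ex by (simp add: quotient_dim_def B_def one_enat_def)
  then obtain e where e: "B = {e}" by (auto simp: card_1_singleton_iff)
  have "\<exists>c. f - to_fract (const2 c) * e \<in> W" if f: "f \<in> V" for f
  proof -
    have "\<forall>f\<in>V. \<exists>S c. finite S \<and> S \<subseteq> B \<and> f - (\<Sum>e\<in>S. to_fract (const2 (c e)) * e) \<in> W"
      using B unfolding quotient_basis_def by (elim conjE)
    from bspec[OF this f] obtain S c where S: "S \<subseteq> {e}"
      and W: "f - (\<Sum>e\<in>S. to_fract (const2 (c e)) * e) \<in> W"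
      unfolding e by (elim exE conjE)
    consider "S = {}" | "S = {e}" using S by (auto simp: subset_singleton_iff)
    then show ?thesis
    proof cases
      case 1 then show ?thesis using W by (intro exI[of _ 0]) (simp add: const2_def)
    next
      case 2 then show ?thesis using W by (intro exI[of _ "c e"]) simp
    qed
  qed
  then show ?thesis by blast
qed

text \<open>The quotient is spanned by one class \<open>e\<close>, so 1 and \<open>f\<close> are c1
  e and c2 e modulo the local ideal, and c1 is nonzero because \<open>a\<close> and \<open>b\<close>
  vanish at \<open>q\<close>. Eliminating \<open>e\<close> puts c1 f - c2 into the ideal, and
  evaluation at \<open>q\<close> gives c2 = 0. The multiplier \<open>g\<close> collects the
  denominators.\<close>

lemma milnor_one:
  assumes dim: "quotient_dim (local_ring q) (local_ideal q a b) = 1"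
    and ab: "eval2 a q = 0" "eval2 b q = 0" and f: "eval2 f q = 0"
  shows "\<exists>g s t. eval2 g q \<noteq> 0 \<and> g * f = s * a + t * b"
proof -
  have in_ring: "to_fract h \<in> local_ring q" for h
    unfolding local_ring_def to_fract_def mem_Collect_eq
    by (intro exI[of _ h] exI[of _ 1]) (simp add: eval2_ring_hom)
  obtain e where e: "\<And>h. h \<in> local_ring q \<Longrightarrow> \<exists>c. h - to_fract (const2 c) * e \<in> local_ideal q a b"
    using quotient_dim_1[OF dim] by blast
  obtain c1 where c1: "to_fract 1 - to_fract (const2 c1) * e \<in> local_ideal q a b" using e in_ring by blast
  obtain c2 where c2: "to_fract f - to_fract (const2 c2) * e \<in> local_ideal q a b" using e in_ring by blast
  obtain d1 s1 t1 where 1: "eval2 d1 q \<noteq> 0"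
    "to_fract d1 * (to_fract 1 - to_fract (const2 c1) * e) = to_fract (s1 * a + t1 * b)"
    using local_ideal_fraction[OF c1] by blast
  obtain d2 s2 t2 where 2: "eval2 d2 q \<noteq> 0"
    "to_fract d2 * (to_fract f - to_fract (const2 c2) * e) = to_fract (s2 * a + t2 * b)"
    using local_ideal_fraction[OF c2] by blast
  have "c1 \<noteq> 0"
  proof
    assume "c1 = 0"
    then have "to_fract d1 = to_fract (s1 * a + t1 * b)" using 1(2) by (simp add: const2_def)
    then have "d1 = s1 * a + t1 * b" by (simp only: to_fract_eq_iff)
    then show False using 1(1) ab by (simp add: eval2_ring_hom)
  qed
  have "to_fract (d1 * d2 * (const2 c1 * f - const2 c2))
      = to_fract (const2 c1 * d1) * (to_fract d2 * (to_fract f - to_fract (const2 c2) * e))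
      - to_fract (const2 c2 * d2) * (to_fract d1 * (to_fract 1 - to_fract (const2 c1) * e))"
    by (simp add: algebra_simps)
  also have "\<dots> = to_fract (const2 c1 * d1 * (s2 * a + t2 * b) - const2 c2 * d2 * (s1 * a + t1 * b))"
    unfolding 1(2) 2(2) by simp
  finally have eq: "d1 * d2 * (const2 c1 * f - const2 c2)
      = const2 c1 * d1 * (s2 * a + t2 * b) - const2 c2 * d2 * (s1 * a + t1 * b)"
    by (simp only: to_fract_eq_iff)
  have "eval2 d1 q * eval2 d2 q * c2 = 0"
    using arg_cong[OF eq, of "\<lambda>p. eval2 p q"] ab f by (simp add: eval2_ring_hom)
  then have "const2 c2 = 0" using 1(1) 2(1) by (simp add: const2_def)
  then have "d1 * d2 * const2 c1 * f = (const2 c1 * d1 * s2) * a + (const2 c1 * d1 * t2) * b"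
    using eq by (simp add: algebra_simps)
  moreover have "eval2 (d1 * d2 * const2 c1) q \<noteq> 0"
    using 1(1) 2(1) \<open>c1 \<noteq> 0\<close> by (simp add: eval2_ring_hom)
  ultimately show ?thesis by blast
qed

text \<open>By \<open>milnor_one\<close> the local ideal contains both coordinate functions centred
  at \<open>q\<close>. Differentiating these memberships at \<open>q\<close> shows that the
  gradients of \<open>a\<close> and \<open>b\<close> span the plane.\<close>

lemma milnor_one_det:
  assumes dim: "quotient_dim (local_ring q) (local_ideal q a b) = 1"
    and ab: "eval2 a q = 0" "eval2 b q = 0"
  shows "eval2 (partial_u a) q * eval2 (partial_v b) q \<noteq> eval2 (partial_v a) q * eval2 (partial_u b) q"
proof
  assume det: "eval2 (partial_u a) q * eval2 (partial_v b) q = eval2 (partial_v a) q * eval2 (partial_u b) q"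
  define U V :: poly2 where "U = [:[:0, 1:]:] - const2 (fst q)" and "V = [:0, 1:] - const2 (snd q)"
  have UV: "eval2 U q = 0" "eval2 V q = 0" by (simp_all add: U_def V_def eval2_ring_hom eval2_vars)
  obtain g s t where g: "eval2 g q \<noteq> 0" and gU: "g * U = s * a + t * b"
    using milnor_one[OF dim ab UV(1)] by blast
  obtain h m n where h: "eval2 h q \<noteq> 0" and hV: "h * V = m * a + n * b"
    using milnor_one[OF dim ab UV(2)] by blast
  note rules = partial_u_mult partial_v_mult partial_uv_add partial_uv_diff partial_uv_vars eval2_ring_hom ab UV
  have dUV: "partial_u U = 1" "partial_v U = 0" "partial_u V = 0" "partial_v V = 1"
    by (simp_all add: U_def V_def partial_uv_diff partial_uv_vars)
  have 1: "eval2 g q = eval2 s q * eval2 (partial_u a) q + eval2 t q * eval2 (partial_u b) q"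
    and 2: "0 = eval2 s q * eval2 (partial_v a) q + eval2 t q * eval2 (partial_v b) q"
    using arg_cong[OF gU, of "\<lambda>p. eval2 (partial_u p) q"] arg_cong[OF gU, of "\<lambda>p. eval2 (partial_v p) q"]
    by (simp_all add: rules dUV)
  have 3: "eval2 h q = eval2 m q * eval2 (partial_v a) q + eval2 n q * eval2 (partial_v b) q"
    using arg_cong[OF hV, of "\<lambda>p. eval2 (partial_v p) q"] by (simp add: rules dUV)
  \<comment> \<open>Cramer's rule for the first membership: if the Jacobian vanished, the
    v-derivatives of \<open>a\<close> and \<open>b\<close> would both be zero at \<open>q\<close>,
    against the identity for \<open>h\<close>.\<close>
  have aux: "G * bv = 0 \<and> G * av = 0"
    if "G = S * au + T * bu" "0 = S * av + T * bv" "au * bv = av * bu" for G S T au av bu bv :: complex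
  proof -
    have "G * bv = S * (au * bv) + T * bu * bv" "G * av = S * au * av + T * (av * bu)"
      by (simp_all add: that(1) algebra_simps)
    then have "G * bv = bu * (S * av + T * bv)" "G * av = au * (S * av + T * bv)"
      by (simp_all add: that(3)[symmetric]) (simp_all add: that(3) algebra_simps)
    then show ?thesis by (simp flip: that(2))
  qed
  have "eval2 g q * eval2 (partial_v b) q = 0" "eval2 g q * eval2 (partial_v a) q = 0"
    using aux[OF 1 2 det] by blast+
  then show False using g h 3 by simp
qed

no_notation vec_index (infixl "$" 100)

section \<open>Formal separatrices\<close>

definition fps_eval :: "poly2 \<Rightarrow> complex fps \<Rightarrow> complex fps \<Rightarrow> complex fps" where
  "fps_eval f U V = poly (map_poly (\<lambda>p. poly (map_poly fps_const p) U) f) V"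

lemma fps_const_hom: "comm_ring_hom (fps_const :: complex \<Rightarrow> complex fps)"
  by unfold_locales (simp_all flip: fps_const_add fps_const_mult)

lemma poly_fps_hom: "comm_ring_hom (\<lambda>p. poly (map_poly fps_const p) (U :: complex fps))"
  by unfold_locales (simp_all add: map_poly_ring_hom[OF fps_const_hom])

lemma fps_eval_hom:
  "fps_eval (f + g) U V = fps_eval f U V + fps_eval g U V"
  "fps_eval (f - g) U V = fps_eval f U V - fps_eval g U V"
  "fps_eval (f * g) U V = fps_eval f U V * fps_eval g U V"
  "fps_eval (const2 c) U V = fps_const c"
  "fps_eval [:[:0, 1:]:] U V = U" "fps_eval [:0, 1:] U V = V"
  "fps_eval 1 U V = 1" "fps_eval 0 U V = 0"
  "fps_eval [:p:] U V = poly (map_poly fps_const p) U"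
  by (simp_all add: fps_eval_def map_poly_ring_hom[OF poly_fps_hom] const2_def map_poly_const
      map_poly_pCons one_pCons)

lemma fps_eval_nth_0: "fps_eval f U V $ 0 = eval2 f (U $ 0, V $ 0)"
  by (induction f rule: poly2_induct)
    (simp_all add: fps_eval_hom eval2_ring_hom eval2_vars del: mult_pCons_left mult_pCons_right)

lemma fps_eval_deriv:
  "fps_deriv (fps_eval f U V) =
     fps_eval (partial_u f) U V * fps_deriv U + fps_eval (partial_v f) U V * fps_deriv V"
  by (induction f rule: poly2_induct)
    (simp_all add: fps_eval_hom partial_uv_vars partial_uv_add partial_u_mult partial_v_mult algebra_simps
      del: mult_pCons_left mult_pCons_right)

lemma fps_eval_cong_dvd:
  assumes "T dvd U' - U" "T dvd V' - V"
  shows "T dvd fps_eval f U' V' - fps_eval f U V"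
proof (induction f rule: poly2_induct)
  case (add p q)
  have "fps_eval (p + q) U' V' - fps_eval (p + q) U V =
      (fps_eval p U' V' - fps_eval p U V) + (fps_eval q U' V' - fps_eval q U V)"
    by (simp add: fps_eval_hom)
  then show ?case using dvd_add[OF add.IH] by simp
next
  case (mult p q)
  have "fps_eval (p * q) U' V' - fps_eval (p * q) U V =
      (fps_eval p U' V' - fps_eval p U V) * fps_eval q U' V' + fps_eval p U V * (fps_eval q U' V' - fps_eval q U V)"
    by (simp add: fps_eval_hom algebra_simps)
  then show ?case using mult by simp
qed (use assms in \<open>simp_all add: fps_eval_hom\<close>)

lemma fps_eval_taylor:
  "T * T dvd fps_eval f (U + a * T) (V + b * T) - fps_eval f U V
     - T * (a * fps_eval (partial_u f) U V + b * fps_eval (partial_v f) U V)"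
proof (induction f rule: poly2_induct)
  case (add p q)
  have *: "fps_eval (p + q) (U + a * T) (V + b * T) - fps_eval (p + q) U V
     - T * (a * fps_eval (partial_u (p + q)) U V + b * fps_eval (partial_v (p + q)) U V)
    = (fps_eval p (U + a * T) (V + b * T) - fps_eval p U V
     - T * (a * fps_eval (partial_u p) U V + b * fps_eval (partial_v p) U V))
    + (fps_eval q (U + a * T) (V + b * T) - fps_eval q U V
     - T * (a * fps_eval (partial_u q) U V + b * fps_eval (partial_v q) U V))"
    by (simp add: fps_eval_hom partial_uv_add algebra_simps)
  show ?case unfolding * by (rule dvd_add[OF add.IH])
next
  case (mult p q)
  define p' q' where "p' = a * fps_eval (partial_u p) U V + b * fps_eval (partial_v p) U V"
    and "q' = a * fps_eval (partial_u q) U V + b * fps_eval (partial_v q) U V"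
  obtain r where "fps_eval p (U + a * T) (V + b * T) - fps_eval p U V - T * p' = T * T * r"
    using mult.IH(1) unfolding p'_def by blast
  then have r: "fps_eval p (U + a * T) (V + b * T) = fps_eval p U V + T * p' + T * T * r"
    by (simp add: algebra_simps)
  obtain s where "fps_eval q (U + a * T) (V + b * T) - fps_eval q U V - T * q' = T * T * s"
    using mult.IH(2) unfolding q'_def by blast
  then have s: "fps_eval q (U + a * T) (V + b * T) = fps_eval q U V + T * q' + T * T * s"
    by (simp add: algebra_simps)
  have pq': "a * fps_eval (partial_u (p * q)) U V + b * fps_eval (partial_v (p * q)) U V
      = fps_eval p U V * q' + fps_eval q U V * p'"
    by (simp add: fps_eval_hom partial_u_mult partial_v_mult p'_def q'_def algebra_simps)
  have "fps_eval (p * q) (U + a * T) (V + b * T) - fps_eval (p * q) U V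
     - T * (fps_eval p U V * q' + fps_eval q U V * p')
    = T * T * (p' * q' + r * fps_eval q U V + s * fps_eval p U V + T * p' * s + T * q' * r + T * T * r * s)"
    unfolding fps_eval_hom(3) r s by (simp add: algebra_simps)
  then show ?case unfolding pq' by (metis dvd_triv_left)
qed (simp_all add: fps_eval_hom partial_uv_vars)

lemma fps_X_power_dvd_iff: "fps_X ^ n dvd F \<longleftrightarrow> (\<forall>k<n. F $ k = (0 :: complex))"
proof
  assume "fps_X ^ n dvd F"
  then obtain G where "F = fps_X ^ n * G" by blast
  then show "\<forall>k<n. F $ k = 0" by (simp add: fps_X_power_mult_nth)
next
  assume *: "\<forall>k<n. F $ k = 0"
  have "F = fps_X ^ n * Abs_fps (\<lambda>k. F $ (k + n))"
    by (rule fps_ext) (use * in \<open>auto simp: fps_X_power_mult_nth\<close>)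
  then show "fps_X ^ n dvd F" by (rule dvdI)
qed

lemma fps_X_deriv_nth: "(fps_X * fps_deriv F) $ k = of_nat k * (F $ k :: complex)"
  by (cases k) simp_all

text \<open>The quadratic remainder of the Taylor expansion starts at order 2N, beyond N, so a
  change of order N is felt at order N through the linear part only.\<close>

lemma fps_eval_perturb:
  assumes "N \<ge> 1" "k \<le> N"
  shows "fps_eval f (U + fps_const a * fps_X ^ N) (V + fps_const b * fps_X ^ N) $ k =
    fps_eval f U V $ k + (if k = N then a * eval2 (partial_u f) (U $ 0, V $ 0) + b * eval2 (partial_v f) (U $ 0, V $ 0) else 0)"
proof -
  define R where "R = fps_eval f (U + fps_const a * fps_X ^ N) (V + fps_const b * fps_X ^ N) - fps_eval f U V
     - fps_X ^ N * (fps_const a * fps_eval (partial_u f) U V + fps_const b * fps_eval (partial_v f) U V)"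
  have "fps_X ^ (N + N) dvd R"
    unfolding R_def power_add by (rule fps_eval_taylor)
  then have "R $ k = 0" unfolding fps_X_power_dvd_iff using assms by simp
  moreover have "(fps_X ^ N * (fps_const a * fps_eval (partial_u f) U V + fps_const b * fps_eval (partial_v f) U V)) $ k
      = (if k = N then a * eval2 (partial_u f) (U $ 0, V $ 0) + b * eval2 (partial_v f) (U $ 0, V $ 0) else 0)"
    using assms(2) by (simp add: fps_X_power_mult_nth fps_eval_nth_0)
  ultimately show ?thesis by (simp add: R_def algebra_simps)
qed

lemma linear_solve2:
  fixes a b c d :: complex
  assumes "a * d - b * c \<noteq> 0"
  shows "\<exists>x y. a * x + b * y = s \<and> c * x + d * y = t"
proof (intro exI conjI)
  define D where "D = a * d - b * c"
  have D: "D \<noteq> 0" using assms by (simp add: D_def)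
  have "a * ((s * d - b * t) / D) + b * ((a * t - s * c) / D) = s * D / D"
    unfolding D_def by (simp add: algebra_simps add_divide_distrib diff_divide_distrib)
  then show "a * ((s * d - b * t) / D) + b * ((a * t - s * c) / D) = s" using D by simp
  have "c * ((s * d - b * t) / D) + d * ((a * t - s * c) / D) = t * D / D"
    unfolding D_def by (simp add: algebra_simps add_divide_distrib diff_divide_distrib)
  then show "c * ((s * d - b * t) / D) + d * ((a * t - s * c) / D) = t" using D by simp
qed

lemma eigenvector2:
  fixes a b c d \<mu> :: complex
  assumes "(a - \<mu>) * (d - \<mu>) - b * c = 0"
  shows "\<exists>x y. (x \<noteq> 0 \<or> y \<noteq> 0) \<and> a * x + b * y = \<mu> * x \<and> c * x + d * y = \<mu> * y"
proof -
  consider "b \<noteq> 0 \<or> \<mu> \<noteq> a" | "c \<noteq> 0 \<or> \<mu> \<noteq> d" | "b = 0" "c = 0" "\<mu> = a" "\<mu> = d" by blast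
  then show ?thesis
  proof cases
    case 1
    then show ?thesis using assms by (intro exI[of _ b] exI[of _ "\<mu> - a"]) (auto simp: algebra_simps)
  next
    case 2
    then show ?thesis using assms by (intro exI[of _ "\<mu> - d"] exI[of _ c]) (auto simp: algebra_simps)
  next
    case 3
    then show ?thesis by (intro exI[of _ 1] exI[of _ 0]) simp
  qed
qed

text \<open>The formal curve (U, V) is tangent to an eigenvector for \<open>\<mu>\<close>, and the
  field restricts to it as \<open>\<mu>\<close> t d/dt. Coefficients are found order by order: order
  N \<ge> 2 is a linear system with matrix J - N \<open>\<mu>\<close>, where J is the linear part,
  of determinant (N \<open>\<mu>\<close> - \<open>\<nu>\<close>)(N \<open>\<mu>\<close> -
  \<open>\<mu>\<close>), and \<open>nonres\<close> keeps it nonzero. Formal series avoid all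
  questions of convergence.\<close>

lemma formal_separatrix:
  fixes P Q :: poly2 and q1 q2 \<nu> \<mu> :: complex
  assumes PQ: "eval2 P (q1, q2) = 0" "eval2 Q (q1, q2) = 0"
    and tr: "eval2 (partial_u P) (q1, q2) + eval2 (partial_v Q) (q1, q2) = \<nu> + \<mu>"
    and det: "eval2 (partial_u P) (q1, q2) * eval2 (partial_v Q) (q1, q2)
      - eval2 (partial_v P) (q1, q2) * eval2 (partial_u Q) (q1, q2) = \<nu> * \<mu>"
    and mu: "\<mu> \<noteq> 0" and nonres: "\<And>n :: nat. n \<ge> 2 \<Longrightarrow> \<nu> \<noteq> of_nat n * \<mu>"
  shows "\<exists>U V. U $ 0 = q1 \<and> V $ 0 = q2 \<and> (U $ 1 \<noteq> 0 \<or> V $ 1 \<noteq> 0) \<and>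
    fps_eval P U V = fps_const \<mu> * (fps_X * fps_deriv U) \<and>
    fps_eval Q U V = fps_const \<mu> * (fps_X * fps_deriv V)"
proof -
  define a b c d where "a = eval2 (partial_u P) (q1, q2)" and "b = eval2 (partial_v P) (q1, q2)"
    and "c = eval2 (partial_u Q) (q1, q2)" and "d = eval2 (partial_v Q) (q1, q2)"
  have char: "(a - x) * (d - x) - b * c = (x - \<nu>) * (x - \<mu>)" for x
  proof -
    have "(a - x) * (d - x) - b * c = x * x - (a + d) * x + (a * d - b * c)" by (simp add: algebra_simps)
    also have "\<dots> = (x - \<nu>) * (x - \<mu>)"
      using tr det unfolding a_def b_def c_def d_def by (simp add: algebra_simps)
    finally show ?thesis .
  qed
  obtain e1 e2 where e: "e1 \<noteq> 0 \<or> e2 \<noteq> 0" "a * e1 + b * e2 = \<mu> * e1" "c * e1 + d * e2 = \<mu> * e2"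
    using eigenvector2[of a \<mu> d b c] char[of \<mu>] by auto
  \<comment> \<open>\<open>res\<close> is the coefficient of order k of the error in the
    differential equation. In \<open>good n\<close> it vanishes below order n + 2, because orders 0
    and 1 are settled by the point and the eigenvector before the recursion starts.\<close>
  define res where "res = (\<lambda>f (W :: complex fps) (S :: complex fps \<times> complex fps) k.
     fps_eval f (fst S) (snd S) $ k - \<mu> * (of_nat k * W $ k))"
  define good where "good = (\<lambda>n S. fst S $ 0 = q1 \<and> snd S $ 0 = q2 \<and> fst S $ 1 = e1 \<and> snd S $ 1 = e2 \<and>
     (\<forall>k<n + 2. res P (fst S) S k = 0 \<and> res Q (snd S) S k = 0))"
  define agree where "agree = (\<lambda>n (S :: complex fps \<times> complex fps) S'. \<forall>k<n + 2. fst S' $ k = fst S $ k \<and> snd S' $ k = snd S $ k)"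
  have start: "\<exists>S. good 0 S"
  proof
    define U V where "U = fps_const q1 + fps_const e1 * fps_X" and "V = fps_const q2 + fps_const e2 * fps_X"
    have UV: "U $ 0 = q1" "U $ 1 = e1" "V $ 0 = q2" "V $ 1 = e2" by (simp_all add: U_def V_def)
    have 1: "fps_eval f U V $ 1 = eval2 (partial_u f) (q1, q2) * e1 + eval2 (partial_v f) (q1, q2) * e2" for f
    proof -
      have "fps_eval f U V $ 1 = fps_deriv (fps_eval f U V) $ 0" by simp
      then show ?thesis unfolding fps_eval_deriv using UV by (simp add: fps_eval_nth_0)
    qed
    have "res P U (U, V) k = 0 \<and> res Q V (U, V) k = 0" if k: "k < 2" for k
    proof -
      consider "k = 0" | "k = 1" using k by linarith
      then show ?thesis
      proof cases
        case 1 then show ?thesis using UV PQ by (simp add: res_def fps_eval_nth_0)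
      next
        case 2 then show ?thesis using UV e 1 by (simp add: res_def a_def b_def c_def d_def)
      qed
    qed
    then show "good 0 (U, V)" using UV by (simp add: good_def)
  qed
  have step: "\<exists>S'. good (Suc n) S' \<and> agree n S S'" if S: "good n S" for n S
  proof -
    define N where "N = n + 2"
    obtain U V where UV: "S = (U, V)" by (cases S)
    have q: "U $ 0 = q1" "V $ 0 = q2" using S by (simp_all add: good_def UV)
    have "of_nat N * \<mu> \<noteq> \<nu>" using nonres[of N] by (simp add: N_def)
    moreover have "of_nat N * \<mu> \<noteq> \<mu>"
    proof
      assume "of_nat N * \<mu> = \<mu>"
      then have "of_nat N = (of_nat 1 :: complex)" using mu by simp
      then have "N = 1" by (simp only: of_nat_eq_iff)
      then show False by (simp add: N_def)
    qed
    ultimately have "(a - of_nat N * \<mu>) * (d - of_nat N * \<mu>) - b * c \<noteq> 0" unfolding char by simp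
    \<comment> \<open>The new coefficients must cancel the error of order N, which they enter
      linearly.\<close>
    then obtain x y where xy: "(a - of_nat N * \<mu>) * x + b * y = - res P U S N"
      "c * x + (d - of_nat N * \<mu>) * y = - res Q V S N"
      using linear_solve2 by blast
    define U' V' where "U' = U + fps_const x * fps_X ^ N" and "V' = V + fps_const y * fps_X ^ N"
    have nth: "U' $ k = U $ k + (if k = N then x else 0)" "V' $ k = V $ k + (if k = N then y else 0)" for k
      by (simp_all add: U'_def V'_def)
    have "N \<ge> 1" by (simp add: N_def)
    have ev: "fps_eval f U' V' $ k = fps_eval f U V $ k +
        (if k = N then x * eval2 (partial_u f) (q1, q2) + y * eval2 (partial_v f) (q1, q2) else 0)" if "k \<le> N" for f k
      unfolding U'_def V'_def using fps_eval_perturb[OF \<open>N \<ge> 1\<close> that] q by simp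
    have "res P U' (U', V') k = 0 \<and> res Q V' (U', V') k = 0" if "k < Suc n + 2" for k
    proof (cases "k = N")
      case True
      have "res P U' (U', V') N = res P U S N + ((a - of_nat N * \<mu>) * x + b * y)"
        using ev[of N P] by (simp add: res_def UV nth a_def b_def algebra_simps)
      moreover have "res Q V' (U', V') N = res Q V S N + (c * x + (d - of_nat N * \<mu>) * y)"
        using ev[of N Q] by (simp add: res_def UV nth c_def d_def algebra_simps)
      ultimately show ?thesis using xy True by simp
    next
      case False
      then have k: "k < n + 2" "k \<le> N" "k \<noteq> N" using that by (simp_all add: N_def)
      have "res P U' (U', V') k = res P U S k" "res Q V' (U', V') k = res Q V S k"
        using ev[OF k(2), of P] ev[OF k(2), of Q] k(3) by (simp_all add: res_def UV nth)
      then show ?thesis using S k(1) by (simp add: good_def UV)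
    qed
    moreover have "U' $ 0 = q1" "V' $ 0 = q2" "U' $ 1 = e1" "V' $ 1 = e2"
      using S by (simp_all add: nth good_def UV N_def)
    ultimately have "good (Suc n) (U', V')" by (simp add: good_def)
    moreover have "agree n S (U', V')" by (simp add: agree_def UV nth N_def)
    ultimately show ?thesis by blast
  qed
  obtain F where F: "\<And>n. good n (F n)" "\<And>n. agree n (F n) (F (Suc n))"
    using dependent_nat_choice[of good agree] start step by blast
  have stable: "fst (F m) $ k = fst (F n) $ k \<and> snd (F m) $ k = snd (F n) $ k" if "n \<le> m" "k < n + 2" for m n k
    using that(1)
  proof (induction m rule: dec_induct)
    case (step m)
    then show ?case using F(2)[of m] that(2) unfolding agree_def by auto
  qed simp
  define U V where "U = Abs_fps (\<lambda>k. fst (F k) $ k)" and "V = Abs_fps (\<lambda>k. snd (F k) $ k)"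
  have UV: "U $ j = fst (F k) $ j" "V $ j = snd (F k) $ j" if "j \<le> k" for j k
    using stable[of j k j] that by (simp_all add: U_def V_def)
  have ev: "fps_eval f U V $ k = fps_eval f (fst (F k)) (snd (F k)) $ k" for f k
  proof -
    have "fps_X ^ Suc k dvd fps_eval f U V - fps_eval f (fst (F k)) (snd (F k))"
      by (rule fps_eval_cong_dvd; unfold fps_X_power_dvd_iff) (simp_all add: UV)
    then show ?thesis unfolding fps_X_power_dvd_iff by simp
  qed
  have "fps_eval P U V = fps_const \<mu> * (fps_X * fps_deriv U)" "fps_eval Q U V = fps_const \<mu> * (fps_X * fps_deriv V)"
  proof -
    show "fps_eval P U V = fps_const \<mu> * (fps_X * fps_deriv U)"
    proof (rule fps_ext)
      fix k
      have "res P (fst (F k)) (F k) k = 0" using F(1)[of k] by (simp add: good_def)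
      then show "fps_eval P U V $ k = (fps_const \<mu> * (fps_X * fps_deriv U)) $ k"
        unfolding fps_mult_left_const_nth fps_X_deriv_nth ev by (simp add: res_def UV[of k k])
    qed
    show "fps_eval Q U V = fps_const \<mu> * (fps_X * fps_deriv V)"
    proof (rule fps_ext)
      fix k
      have "res Q (snd (F k)) (F k) k = 0" using F(1)[of k] by (simp add: good_def)
      then show "fps_eval Q U V $ k = (fps_const \<mu> * (fps_X * fps_deriv V)) $ k"
        unfolding fps_mult_left_const_nth fps_X_deriv_nth ev by (simp add: res_def UV[of k k])
    qed
  qed
  moreover have "U $ 0 = q1" "V $ 0 = q2" "U $ 1 = e1" "V $ 1 = e2"
    using F(1)[of 1] UV[of 0 1] UV[of 1 1] by (simp_all add: good_def)
  ultimately show ?thesis using e(1) by blast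
qed

text \<open>The polynomial splits into linear factors, and one of them must vanish at
  \<open>U\<close> since power series form a domain: nonconstant series are transcendental.\<close>

lemma poly_fps_root_const:
  assumes "c \<noteq> 0" "poly (map_poly fps_const c) U = 0"
  shows "\<exists>z :: complex. U = fps_const z"
  using assms
proof (induction "degree c" arbitrary: c)
  case 0
  then obtain b where "c = [:b:]" by (auto elim: degree_eq_zeroE)
  then show ?case using 0 by (simp add: map_poly_const)
next
  case (Suc n)
  then obtain z where "poly c z = 0"
    using fundamental_theorem_of_algebra_alt[of c] by (metis degree_pCons_0 nat.distinct(1))
  then obtain h where h: "c = [:- z, 1:] * h" using poly_eq_0_iff_dvd by blast
  then have "h \<noteq> 0" "n = degree h" using Suc by (auto simp: degree_mult_eq simp del: mult_pCons_left)
  have "poly (map_poly fps_const c) U = (U - fps_const z) * poly (map_poly fps_const h) U"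
    unfolding h map_poly_ring_hom[OF fps_const_hom] poly_mult by (simp add: map_poly_pCons)
  then consider "U = fps_const z" | "poly (map_poly fps_const h) U = 0" using Suc.prems(2) by auto
  then show ?case using Suc.hyps(1)[OF \<open>n = degree h\<close> \<open>h \<noteq> 0\<close>] by cases blast+
qed

lemma fps_eval_const:
  "fps_eval f (fps_const z) V = poly (map_poly fps_const (map_poly (\<lambda>p. poly p z) f)) V"
  by (induction f rule: poly2_induct)
    (simp_all add: fps_eval_hom map_poly_ring_hom[OF poly_comm_ring_hom] map_poly_ring_hom[OF fps_const_hom]
      map_poly_const map_poly_pCons const2_def del: mult_pCons_left mult_pCons_right)

text \<open>The polynomials that vanish on the formal curve form an ideal; elimination finds one in
  u alone, so \<open>U\<close> is a constant z. If \<open>V\<close> had a linear term, vanishing on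
  the curve would mean divisibility by u - z, and \<open>f\<close> and \<open>g\<close> would have a
  common factor.\<close>

lemma fps_eval_coprime:
  assumes cop: "\<And>D. D dvd f \<Longrightarrow> D dvd g \<Longrightarrow> is_unit D"
    and zero: "fps_eval f U V = 0" "fps_eval g U V = 0"
  shows "U $ 1 = 0 \<and> V $ 1 = 0"
proof -
  have "ideal_set {h. fps_eval h U V = 0}" by (simp add: ideal_set_def fps_eval_hom)
  moreover have "is_unit D" if "\<And>h. h \<in> {h. fps_eval h U V = 0} \<Longrightarrow> D dvd h" for D
    using cop[of D] that[of f] that[of g] zero by simp
  ultimately obtain c where c: "c \<noteq> 0" "fps_eval [:c:] U V = 0"
    using elimination[of "{h. fps_eval h U V = 0}"] by auto
  then obtain z where z: "U = fps_const z"
    using poly_fps_root_const[of c U] unfolding fps_eval_hom(9) by blast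
  have dvd: "[:[:- z, 1:]:] dvd h" if h: "fps_eval h U V = 0" "V $ 1 \<noteq> 0" for h
  proof (rule ccontr)
    assume "\<not> [:[:- z, 1:]:] dvd h"
    then have "map_poly (\<lambda>p. poly p z) h \<noteq> 0" by (simp add: const_dvd_iff)
    then obtain y where "V = fps_const y"
      using poly_fps_root_const[of "map_poly (\<lambda>p. poly p z) h" V] h(1) unfolding z fps_eval_const by blast
    then show False using h(2) by simp
  qed
  have "\<not> is_unit [:[:- z, 1:]:]" by (simp add: is_unit_const_poly_iff is_unit_iff_degree)
  then have "V $ 1 = 0" using dvd[OF zero(1)] dvd[OF zero(2)] cop[of "[:[:- z, 1:]:]"] by blast
  then show ?thesis by (simp add: z)
qed

text \<open>Both \<open>f\<close> and \<open>g\<close> vanish along the formal separatrix with eigenvalue \<open>\<mu>\<close>: along it they solve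
  \<open>\<mu> t \<phi>' = h \<phi>\<close>, which has no nonzero formal solution unless \<open>h(q)\<close> is a multiple of \<open>\<mu>\<close>.\<close>

lemma cofactor_multiple_of_eigenvalue:
  fixes P Q f g h :: poly2 and \<nu> \<mu> :: complex
  assumes PQ: "eval2 P q = 0" "eval2 Q q = 0"
    and tr: "eval2 (partial_u P) q + eval2 (partial_v Q) q = \<nu> + \<mu>"
    and det: "eval2 (partial_u P) q * eval2 (partial_v Q) q - eval2 (partial_v P) q * eval2 (partial_u Q) q = \<nu> * \<mu>"
    and mu: "\<mu> \<noteq> 0" and nonres: "\<And>n :: nat. n \<ge> 2 \<Longrightarrow> \<nu> \<noteq> of_nat n * \<mu>"
    and f: "P * partial_u f + Q * partial_v f = h * f" and g: "P * partial_u g + Q * partial_v g = h * g"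
    and cop: "\<And>D. D dvd f \<Longrightarrow> D dvd g \<Longrightarrow> is_unit D"
  shows "\<exists>n :: nat. eval2 h q = of_nat n * \<mu>"
proof (rule ccontr)
  assume neq: "\<nexists>n :: nat. eval2 h q = of_nat n * \<mu>"
  obtain q1 q2 where q: "q = (q1, q2)" by (cases q)
  obtain U V where UV: "U $ 0 = q1" "V $ 0 = q2" "U $ 1 \<noteq> 0 \<or> V $ 1 \<noteq> 0"
    and eq: "fps_eval P U V = fps_const \<mu> * (fps_X * fps_deriv U)"
      "fps_eval Q U V = fps_const \<mu> * (fps_X * fps_deriv V)"
    using formal_separatrix[OF PQ[unfolded q] tr[unfolded q] det[unfolded q] mu nonres] by blast
  have zero: "fps_eval p U V = 0" if p: "P * partial_u p + Q * partial_v p = h * p" for p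
  proof (rule ccontr)
    define \<phi> where "\<phi> = fps_eval p U V"
    assume "fps_eval p U V \<noteq> 0"
    then have "\<phi> \<noteq> 0" by (simp add: \<phi>_def)
    define j where "j = subdegree \<phi>"
    have j: "\<phi> $ j \<noteq> 0" using \<open>\<phi> \<noteq> 0\<close> by (simp add: j_def)
    have less_j: "\<phi> $ i = 0" if "i < j" for i
      using that unfolding j_def by (rule nth_less_subdegree_zero)
    have "fps_const \<mu> * (fps_X * fps_deriv \<phi>) = fps_eval (P * partial_u p + Q * partial_v p) U V"
      unfolding \<phi>_def fps_eval_deriv fps_eval_hom eq by (simp add: algebra_simps)
    then have "fps_const \<mu> * (fps_X * fps_deriv \<phi>) = fps_eval h U V * \<phi>"
      by (simp add: p fps_eval_hom \<phi>_def)
    from arg_cong[OF this, of "\<lambda>F. F $ j"]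
    have "\<mu> * (of_nat j * \<phi> $ j) = (fps_eval h U V * \<phi>) $ j"
      by (simp only: fps_mult_left_const_nth fps_X_deriv_nth)
    also have "\<dots> = (\<Sum>i=0..j. fps_eval h U V $ i * \<phi> $ (j - i))" by (rule fps_mult_nth)
    also have "\<dots> = (\<Sum>i=0..j. if i = 0 then fps_eval h U V $ 0 * \<phi> $ j else 0)"
      by (intro sum.cong refl) (auto intro: less_j)
    also have "\<dots> = eval2 h q * \<phi> $ j" by (simp add: fps_eval_nth_0 UV q)
    finally have "(of_nat j * \<mu>) * \<phi> $ j = eval2 h q * \<phi> $ j" by (simp only: mult_ac)
    then have "eval2 h q = of_nat j * \<mu>" using j by simp
    then show False using neq by blast
  qed
  have "U $ 1 = 0 \<and> V $ 1 = 0" by (rule fps_eval_coprime[OF _ zero[OF f] zero[OF g]]) (rule cop)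
  then show False using UV(3) by blast
qed

section \<open>The vector field annihilating the first integral\<close>

text \<open>The cancelled gcd is not known to be homogeneous, so the degrees are recovered from
  Euler's operator: it annihilates the quotient, so coprimality makes \<open>F\<close> divide
  \<open>euler F\<close>, and \<open>G\<close> gets the same eigenvalue. A common degree 0 would
  make \<open>S\<close> constant.\<close>

lemma reduced_first_integral:
  assumes S: "S \<in> rational_functions" "S \<notin> range (\<lambda>c. to_fract (const3 c))"
  shows "\<exists>d F G. homogeneous d F \<and> homogeneous d G \<and> coprime F G \<and> d > 0 \<and> F \<noteq> 0 \<and> G \<noteq> 0 \<and>
    S = Fraction_Field.Fract F G"
proof -
  obtain F0 G0 d0 where S0: "S = Fraction_Field.Fract F0 G0" "G0 \<noteq> 0" "homogeneous d0 F0" "homogeneous d0 G0"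
    using S(1) unfolding rational_functions_def by blast
  obtain F G D where FG: "F0 = F * D" "G0 = G * D" "coprime F G" "D \<noteq> 0"
  proof
    let ?D = "gcd F0 G0"
    show "?D \<noteq> 0" "F0 = (F0 div ?D) * ?D" "G0 = (G0 div ?D) * ?D" using S0(2) by auto
    show "coprime (F0 div ?D) (G0 div ?D)" using S0(2) by (intro div_gcd_coprime) simp
  qed
  have "G \<noteq> 0" using S0(2) FG by auto
  have SFG: "S = Fraction_Field.Fract F G"
    using \<open>G \<noteq> 0\<close> S0(2) FG by (simp add: S0(1) eq_fract)
  have const: "S = to_fract (const3 (a / b))" if "F = const3 a" "G = const3 b" "b \<noteq> 0" for a b
  proof -
    have "Fraction_Field.Fract (const3 a) (const3 b) = Fraction_Field.Fract (const3 (a / b)) 1"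
      using that(3) by (simp add: eq_fract const3_eq_0_iff const3_mult[symmetric])
    then show ?thesis using that SFG by (simp add: to_fract_def)
  qed
  have "F \<noteq> 0"
  proof
    assume "F = 0"
    then have "S = to_fract (const3 0)" using SFG by (simp add: const3_0 Zero_fract_def to_fract_def eq_fract)
    then show False using S(2) by blast
  qed
  have "euler F0 * G0 = F0 * euler G0"
    using S0 by (simp add: homogeneous_iff_euler)
  moreover have "D * D * (euler F * G - F * euler G) = euler F0 * G0 - F0 * euler G0"
    unfolding FG(1,2) euler_mult by (simp add: algebra_simps)
  ultimately have "D * D * (euler F * G - F * euler G) = 0" by simp
  then have eq: "euler F * G = F * euler G" using \<open>D \<noteq> 0\<close> by (simp only: mult_eq_0_iff right_minus_eq simp_thms)
  then have "F dvd euler F * G" by simp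
  then have "F dvd euler F" using coprime_dvd_mult_left_iff[OF FG(3)] by simp
  then obtain c where "euler F = F * c" by (rule dvdE)
  then have c: "euler F = c * F" by (simp only: mult.commute)
  have "F * (c * G) = euler F * G" by (simp only: c mult_ac)
  then have "F * euler G = F * (c * G)" by (simp only: eq)
  then have c': "euler G = c * G" unfolding mult_left_cancel[OF \<open>F \<noteq> 0\<close>] .
  obtain d where d: "c = of_nat d" "homogeneous d F" using euler_eigenvalue[OF \<open>F \<noteq> 0\<close> c] by blast
  then have "homogeneous d G" using c' by (simp add: homogeneous_iff_euler)
  moreover have "d > 0"
  proof (rule ccontr)
    assume "\<not> d > 0"
    then have "homogeneous 0 F" "homogeneous 0 G" using d \<open>homogeneous d G\<close> by simp_all
    then obtain a b where ab: "F = const3 a" "G = const3 b"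
      using homogeneous_degree_0[of F] homogeneous_degree_0[of G] by blast
    then have "b \<noteq> 0" using \<open>G \<noteq> 0\<close> by (auto simp: const3_0)
    then show False using const[OF ab] S(2) by blast
  qed
  ultimately show ?thesis using d FG(3) SFG \<open>F \<noteq> 0\<close> \<open>G \<noteq> 0\<close>
    by - (intro exI[of _ d] exI[of _ F] exI[of _ G] conjI; assumption)
qed

lemma homogeneous_dvd_degree:
  assumes "homogeneous n P" "homogeneous m Q" "P dvd Q" "Q \<noteq> 0"
  shows "n \<le> m"
proof -
  obtain R where R: "Q = P * R" using assms(3) by blast
  then show ?thesis using homogeneous_factor(1)[of m P R n] assms by auto
qed

text \<open>Up to a factor, X is the cross product W of the gradients of \<open>F\<close> and
  \<open>G\<close>, which annihilates both. Euler's formula turns R x W into the degree times G dF -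
  F dG, that is, into a multiple of the given form; the work lies in dividing W by that
  multiple.\<close>

lemma vector_field_exists:
  assumes fol: "foliation r (A, B, C)" and int: "rational_first_integral (A, B, C) S"
  shows "\<exists>d F G X1 X2 X3. d > 0 \<and> homogeneous d F \<and> homogeneous d G \<and> coprime F G \<and>
    homogeneous r X1 \<and> homogeneous r X2 \<and> homogeneous r X3 \<and>
    A = varY * X3 - varZ * X2 \<and> B = varZ * X1 - varX * X3 \<and> C = varX * X2 - varY * X1 \<and>
    X1 * partial_X F + X2 * partial_Y F + X3 * partial_Z F = 0 \<and>
    X1 * partial_X G + X2 * partial_Y G + X3 * partial_Z G = 0"
proof -
  have hom: "homogeneous (r + 1) A" "homogeneous (r + 1) B" "homogeneous (r + 1) C"
    and cop: "coprime3 A B C" and radial: "varX * A + varY * B + varZ * C = 0"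
    using fol by (simp_all add: foliation_def coprime3_def)
  have S: "S \<in> rational_functions" "S \<notin> range (\<lambda>c. to_fract (const3 c))"
    and wedge: "fract_partial_X S * to_fract B - fract_partial_Y S * to_fract A = 0"
      "fract_partial_X S * to_fract C - fract_partial_Z S * to_fract A = 0"
      "fract_partial_Y S * to_fract C - fract_partial_Z S * to_fract B = 0"
    using int unfolding rational_first_integral_def by simp_all
  obtain d' F G where FG: "homogeneous d' F" "homogeneous d' G" "coprime F G" "d' > 0" "F \<noteq> 0" "G \<noteq> 0"
    and SFG: "S = Fraction_Field.Fract F G"
    using reduced_first_integral[OF S] by blast
  obtain d where d': "d' = Suc d" using FG(4) by (cases d') auto
  define Fx Fy Fz where "Fx = partial_X F" and "Fy = partial_Y F" and "Fz = partial_Z F"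
  define Gx Gy Gz where "Gx = partial_X G" and "Gy = partial_Y G" and "Gz = partial_Z G"
  have homF: "homogeneous d Fx" "homogeneous d Fy" "homogeneous d Fz"
    and homG: "homogeneous d Gx" "homogeneous d Gy" "homogeneous d Gz"
    unfolding Fx_def Fy_def Fz_def Gx_def Gy_def Gz_def
    using FG(1,2) unfolding d' by (simp_all add: homogeneous_partial)
  define D :: poly3 where "D = of_nat d'"
  have "D \<noteq> 0" using FG(4) by (simp add: D_def)
  have eulF: "varX * Fx + varY * Fy + varZ * Fz = D * F"
    and eulG: "varX * Gx + varY * Gy + varZ * Gz = D * G"
    using FG(1,2) by (simp_all add: homogeneous_iff_euler euler_def D_def Fx_def Fy_def Fz_def Gx_def Gy_def Gz_def)
  define n1 n2 n3 where "n1 = G * Fx - F * Gx" and "n2 = G * Fy - F * Gy" and "n3 = G * Fz - F * Gz"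
  have clear: "a * P = b * Q"
    if "Fraction_Field.Fract a (G * G) * to_fract P - Fraction_Field.Fract b (G * G) * to_fract Q = 0" for a b P Q
  proof -
    have "Fraction_Field.Fract (a * P) (G * G) = Fraction_Field.Fract (b * Q) (G * G)"
      using that by (simp only: to_fract_def mult_fract mult_1_right right_minus_eq)
    then have "a * P * (G * G) = b * Q * (G * G)" using FG(6) by (simp add: eq_fract)
    then show ?thesis using FG(6) by simp
  qed
  have "n1 * B = n2 * A" "n1 * C = n3 * A" "n2 * C = n3 * B"
    unfolding n1_def n2_def n3_def Fx_def Fy_def Fz_def Gx_def Gy_def Gz_def
    using wedge unfolding SFG fract_partial_Fract[OF FG(6)] by (blast intro: clear)+
  then obtain q where q: "n1 = q * A" "n2 = q * B" "n3 = q * C"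
    using parallel3[OF cop] by blast
  have homn: "homogeneous (Suc (d + d)) n1" "homogeneous (Suc (d + d)) n2" "homogeneous (Suc (d + d)) n3"
    unfolding n1_def n2_def n3_def using homogeneous_mult[OF FG(2)] homogeneous_mult[OF FG(1)] homF homG
    by (intro homogeneous_diff; simp add: d')+
  have "q \<noteq> 0"
  proof
    assume "q = 0"
    \<comment> \<open>For \<open>q = 0\<close> the form \<open>F\<close> would divide its own
      partial derivatives, which have smaller degree.\<close>
    have zero: "H = 0" if "G * H = F * K" "homogeneous d H" for H K
    proof (rule ccontr)
      assume "H \<noteq> 0"
      have "F dvd G * H" using that(1) by simp
      then have "F dvd H" using FG(3) coprime_dvd_mult_right_iff by blast
      then show False using homogeneous_dvd_degree[OF FG(1) that(2)] \<open>H \<noteq> 0\<close> by (simp add: d')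
    qed
    have "Fx = 0" "Fy = 0" "Fz = 0"
      using zero[of Fx Gx] zero[of Fy Gy] zero[of Fz Gz] homF q \<open>q = 0\<close> by (simp_all add: n1_def n2_def n3_def)
    then show False using eulF \<open>D \<noteq> 0\<close> FG(5) by simp
  qed
  define W1 W2 W3 where "W1 = Fy * Gz - Fz * Gy" and "W2 = Fz * Gx - Fx * Gz" and "W3 = Fx * Gy - Fy * Gx"
  have W: "varY * W3 - varZ * W2 = D * q * A" "varZ * W1 - varX * W3 = D * q * B" "varX * W2 - varY * W1 = D * q * C"
  proof -
    have "varY * W3 - varZ * W2 = Fx * (varX * Gx + varY * Gy + varZ * Gz) - Gx * (varX * Fx + varY * Fy + varZ * Fz)"
      by (simp add: W1_def W2_def W3_def algebra_simps)
    also have "\<dots> = D * n1" unfolding eulF eulG n1_def by (simp add: algebra_simps)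
    finally show "varY * W3 - varZ * W2 = D * q * A" by (simp add: q)
    have "varZ * W1 - varX * W3 = Fy * (varX * Gx + varY * Gy + varZ * Gz) - Gy * (varX * Fx + varY * Fy + varZ * Fz)"
      by (simp add: W1_def W2_def W3_def algebra_simps)
    also have "\<dots> = D * n2" unfolding eulF eulG n2_def by (simp add: algebra_simps)
    finally show "varZ * W1 - varX * W3 = D * q * B" by (simp add: q)
    have "varX * W2 - varY * W1 = Fz * (varX * Gx + varY * Gy + varZ * Gz) - Gz * (varX * Fx + varY * Fy + varZ * Fz)"
      by (simp add: W1_def W2_def W3_def algebra_simps)
    also have "\<dots> = D * n3" unfolding eulF eulG n3_def by (simp add: algebra_simps)
    finally show "varX * W2 - varY * W1 = D * q * C" by (simp add: q)
  qed
  obtain u v w where uvw: "A = varZ * v - varY * w" "B = varX * w - varZ * u" "C = varY * u - varX * v"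
    using koszul[OF radial] by blast
  \<comment> \<open>The field (u, v, w) from \<open>koszul\<close> has the right cross product with
    R up to sign, so W is its multiple by \<open>- D * q\<close> up to a multiple h R of the radial
    field.\<close>
  have "\<exists>h. W1 + D * q * u = h * varX \<and> W2 + D * q * v = h * varY \<and> W3 + D * q * w = h * varZ"
  proof (rule parallel3[OF coprime3_vars])
    show "(W1 + D * q * u) * varY = (W2 + D * q * v) * varX" using W(3) unfolding uvw by (simp add: algebra_simps)
    show "(W1 + D * q * u) * varZ = (W3 + D * q * w) * varX" using W(2) unfolding uvw by (simp add: algebra_simps)
    show "(W2 + D * q * v) * varZ = (W3 + D * q * w) * varY" using W(1) unfolding uvw by (simp add: algebra_simps)
  qed
  then obtain h where "W1 + D * q * u = h * varX" "W2 + D * q * v = h * varY" "W3 + D * q * w = h * varZ"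
    by blast
  then have h: "W1 = h * varX - D * q * u" "W2 = h * varY - D * q * v" "W3 = h * varZ - D * q * w"
    by (simp_all add: eq_diff_eq)
  have WF: "W1 * Fx + W2 * Fy + W3 * Fz = 0" and WG: "W1 * Gx + W2 * Gy + W3 * Gz = 0"
    by (simp_all add: W1_def W2_def W3_def algebra_simps)
  \<comment> \<open>W annihilates \<open>F\<close>, and R multiplies it by \<open>D\<close>; hence q
    divides h F, and likewise h G. As \<open>F\<close> and \<open>G\<close> are coprime, q divides h
    and thus all of W.\<close>
  have "D * (h * F - q * (u * Fx + v * Fy + w * Fz)) = h * (D * F) - D * q * (u * Fx + v * Fy + w * Fz)"
    by (simp add: algebra_simps)
  also have "\<dots> = W1 * Fx + W2 * Fy + W3 * Fz" unfolding h eulF[symmetric] by (simp add: algebra_simps)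
  finally have "h * F = q * (u * Fx + v * Fy + w * Fz)" using \<open>D \<noteq> 0\<close> WF by simp
  then have qF: "q dvd h * F" by simp
  have "D * (h * G - q * (u * Gx + v * Gy + w * Gz)) = h * (D * G) - D * q * (u * Gx + v * Gy + w * Gz)"
    by (simp add: algebra_simps)
  also have "\<dots> = W1 * Gx + W2 * Gy + W3 * Gz" unfolding h eulG[symmetric] by (simp add: algebra_simps)
  finally have "h * G = q * (u * Gx + v * Gy + w * Gz)" using \<open>D \<noteq> 0\<close> WG by simp
  then have qG: "q dvd h * G" by simp
  have "q dvd gcd (h * F) (h * G)" using qF qG by (rule gcd_greatest)
  then have "q dvd normalize (h * gcd F G)" by (simp only: gcd_mult_left)
  then have "q dvd h" using FG(3) by simp
  then obtain k where k: "h = q * k" by blast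
  \<comment> \<open>The inverse of the degree, as a constant: division of W by q leaves the unit
    \<open>D\<close>.\<close>
  define e where "e = const3 (inverse (of_nat d'))"
  have De: "D * e = 1" unfolding D_def e_def const3_of_nat[symmetric]
    by (rule const3_inverse) (use FG(4) in simp)
  define X1 X2 X3 where "X1 = e * k * varX - u" and "X2 = e * k * varY - v" and "X3 = e * k * varZ - w"
  have DqX: "D * q * X1 = W1" "D * q * X2 = W2" "D * q * X3 = W3"
  proof -
    have "D * q * (e * k * x - y) = (D * e) * (q * k) * x - D * q * y" for x y by (simp add: algebra_simps)
    then show "D * q * X1 = W1" "D * q * X2 = W2" "D * q * X3 = W3"
      unfolding X1_def X2_def X3_def h k De by simp_all
  qed
  have Dq: "D * q \<noteq> 0" using \<open>D \<noteq> 0\<close> \<open>q \<noteq> 0\<close> by simp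
  have "D * q * (X1 * Fx + X2 * Fy + X3 * Fz) = W1 * Fx + W2 * Fy + W3 * Fz"
    unfolding DqX[symmetric] by (simp add: algebra_simps)
  then have XF: "X1 * Fx + X2 * Fy + X3 * Fz = 0" using Dq WF by simp
  have "D * q * (X1 * Gx + X2 * Gy + X3 * Gz) = W1 * Gx + W2 * Gy + W3 * Gz"
    unfolding DqX[symmetric] by (simp add: algebra_simps)
  then have XG: "X1 * Gx + X2 * Gy + X3 * Gz = 0" using Dq WG by simp
  have ABC: "A = varY * X3 - varZ * X2" "B = varZ * X1 - varX * X3" "C = varX * X2 - varY * X1"
    unfolding uvw X1_def X2_def X3_def by (simp_all add: algebra_simps)
  have "A \<noteq> 0 \<or> B \<noteq> 0 \<or> C \<noteq> 0"
    using cop unfolding coprime3_def by (metis dvd_0_right not_is_unit_0)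
  then obtain P where P: "homogeneous (r + 1) P" "P \<noteq> 0" "homogeneous (Suc (d + d)) (P * q)"
    using hom homn unfolding q by (metis mult.commute)
  have r: "r + 1 \<le> Suc (d + d)" and homq: "homogeneous (Suc (d + d) - (r + 1)) q"
    using homogeneous_factor[OF P(3,1,2) \<open>q \<noteq> 0\<close>] by simp_all
  \<comment> \<open>W has degree 2d. Since q times a form of degree r + 1 has degree 2d + 1, q has
    degree 2d - r, and the quotient has degree r.\<close>
  have homDq: "homogeneous (d + d - r) (D * q)"
    using homogeneous_const3_mult[OF homq, of "of_nat d'"] by (simp add: D_def const3_of_nat)
  have homX: "homogeneous r X" if "homogeneous (d + d) (D * q * X)" for X
  proof (cases "X = 0")
    case False
    then show ?thesis using homogeneous_factor(2)[OF that homDq Dq False] r by simp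
  qed simp
  have "homogeneous (d + d) W1" "homogeneous (d + d) W2" "homogeneous (d + d) W3"
    unfolding W1_def W2_def W3_def using homF homG by (auto intro!: homogeneous_diff homogeneous_mult)
  then have "homogeneous r X1" "homogeneous r X2" "homogeneous r X3"
    using homX unfolding DqX[symmetric] by blast+
  then show ?thesis
    using FG ABC XF XG unfolding Fx_def Fy_def Fz_def Gx_def Gy_def Gz_def
    by - (intro exI[of _ d'] exI[of _ F] exI[of _ G] exI[of _ X1] exI[of _ X2] exI[of _ X3] conjI; assumption)
qed

section \<open>Saturation\<close>

text \<open>Expanding the double cross product, a vector orthogonal to both (x, y, z) and (X1, X2,
  X3) has zero cross product with their cross product; coprimality of the latter and
  \<open>parallel3\<close> do the rest.\<close>

lemma perp_parallel:
  fixes x :: poly3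
  assumes cop: "coprime3 (y * X3 - z * X2) (z * X1 - x * X3) (x * X2 - y * X1)"
    and "u * x + v * y + w * z = 0" and "u * X1 + v * X2 + w * X3 = 0"
  shows "\<exists>p. u = p * (y * X3 - z * X2) \<and> v = p * (z * X1 - x * X3) \<and> w = p * (x * X2 - y * X1)"
proof (rule parallel3[OF cop])
  have "u * (z * X1 - x * X3) - v * (y * X3 - z * X2)
      = z * (u * X1 + v * X2 + w * X3) - X3 * (u * x + v * y + w * z)" by (simp add: algebra_simps)
  then show "u * (z * X1 - x * X3) = v * (y * X3 - z * X2)" by (simp add: assms)
  have "u * (x * X2 - y * X1) - w * (y * X3 - z * X2)
      = X2 * (u * x + v * y + w * z) - y * (u * X1 + v * X2 + w * X3)" by (simp add: algebra_simps)
  then show "u * (x * X2 - y * X1) = w * (y * X3 - z * X2)" by (simp add: assms)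
  have "v * (x * X2 - y * X1) - w * (z * X1 - x * X3)
      = x * (u * X1 + v * X2 + w * X3) - X1 * (u * x + v * y + w * z)" by (simp add: algebra_simps)
  then show "v * (x * X2 - y * X1) = w * (z * X1 - x * X3)" by (simp add: assms)
qed


text \<open>The triple product moves the radial field: (a, b, c) . (R x X) = ((a, b, c) x R) . X,
  and by \<open>koszul\<close> the vectors (a, b, c) x R are exactly those orthogonal to R.\<close>

lemma mem_ideal3_iff:
  assumes ABC: "A = varY * X3 - varZ * X2" "B = varZ * X1 - varX * X3" "C = varX * X2 - varY * X1"
  shows "F \<in> ideal3 A B C \<longleftrightarrow>
    (\<exists>u v w. F = u * X1 + v * X2 + w * X3 \<and> varX * u + varY * v + varZ * w = 0)"
proof
  assume "F \<in> ideal3 A B C"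
  then obtain a b c where F: "F = a * A + b * B + c * C" unfolding ideal3_def by blast
  have "F = (b * varZ - c * varY) * X1 + (c * varX - a * varZ) * X2 + (a * varY - b * varX) * X3"
    unfolding F ABC by (simp add: algebra_simps)
  moreover have "varX * (b * varZ - c * varY) + varY * (c * varX - a * varZ) + varZ * (a * varY - b * varX) = 0"
    by (simp add: algebra_simps)
  ultimately show "\<exists>u v w. F = u * X1 + v * X2 + w * X3 \<and> varX * u + varY * v + varZ * w = 0" by blast
next
  assume "\<exists>u v w. F = u * X1 + v * X2 + w * X3 \<and> varX * u + varY * v + varZ * w = 0"
  then obtain u v w where F: "F = u * X1 + v * X2 + w * X3" and "varX * u + varY * v + varZ * w = 0" by blast
  then obtain a b c where uvw: "u = varZ * b - varY * c" "v = varX * c - varZ * a" "w = varY * a - varX * b"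
    using koszul by blast
  have "F = a * A + b * B + c * C" unfolding F ABC uvw by (simp add: algebra_simps)
  then show "F \<in> ideal3 A B C" unfolding ideal3_def by blast
qed

text \<open>The memberships give vectors U1, U2, U3 orthogonal to R whose products with X are x F, y
  F, z F. A difference such as y U1 - x U2 is orthogonal to R and X, hence p3 (A, B, C), and p1, p2,
  p3 satisfy the Koszul relation. The vector g obtained from it corrects the three: U1 - g1 (A, B,
  C) = x U, and similarly with y and z. This U exhibits \<open>F\<close> as a member.\<close>

lemma saturated_step:
  assumes ABC: "A = varY * X3 - varZ * X2" "B = varZ * X1 - varX * X3" "C = varX * X2 - varY * X1"
    and cop: "coprime3 A B C"
    and X: "varX * F \<in> ideal3 A B C" and Y: "varY * F \<in> ideal3 A B C" and Z: "varZ * F \<in> ideal3 A B C"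
  shows "F \<in> ideal3 A B C"
proof -
  note iff = mem_ideal3_iff[OF ABC]
  obtain u1 v1 w1 where 1: "varX * F = u1 * X1 + v1 * X2 + w1 * X3" "varX * u1 + varY * v1 + varZ * w1 = 0"
    using X unfolding iff by blast
  obtain u2 v2 w2 where 2: "varY * F = u2 * X1 + v2 * X2 + w2 * X3" "varX * u2 + varY * v2 + varZ * w2 = 0"
    using Y unfolding iff by blast
  obtain u3 v3 w3 where 3: "varZ * F = u3 * X1 + v3 * X2 + w3 * X3" "varX * u3 + varY * v3 + varZ * w3 = 0"
    using Z unfolding iff by blast
  have par: "\<exists>p. y * u - x * u' = p * A \<and> y * v - x * v' = p * B \<and> y * w - x * w' = p * C"
    if a: "x * F = u * X1 + v * X2 + w * X3" "varX * u + varY * v + varZ * w = 0"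
      and b: "y * F = u' * X1 + v' * X2 + w' * X3" "varX * u' + varY * v' + varZ * w' = 0"
    for x y u v w u' v' w'
    unfolding ABC
  proof (rule perp_parallel[OF cop[unfolded ABC]])
    have "(y * u - x * u') * varX + (y * v - x * v') * varY + (y * w - x * w') * varZ
        = y * (varX * u + varY * v + varZ * w) - x * (varX * u' + varY * v' + varZ * w')" by (simp add: algebra_simps)
    then show "(y * u - x * u') * varX + (y * v - x * v') * varY + (y * w - x * w') * varZ = 0" by (simp add: a b)
    have "(y * u - x * u') * X1 + (y * v - x * v') * X2 + (y * w - x * w') * X3
        = y * (u * X1 + v * X2 + w * X3) - x * (u' * X1 + v' * X2 + w' * X3)" by (simp add: algebra_simps)
    also have "\<dots> = y * (x * F) - x * (y * F)" by (simp only: a b)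
    finally show "(y * u - x * u') * X1 + (y * v - x * v') * X2 + (y * w - x * w') * X3 = 0" by simp
  qed
  obtain p3 where p3: "varY * u1 - varX * u2 = p3 * A" "varY * v1 - varX * v2 = p3 * B" "varY * w1 - varX * w2 = p3 * C"
    using par[OF 1 2] by blast
  obtain p1 where p1: "varZ * u2 - varY * u3 = p1 * A" "varZ * v2 - varY * v3 = p1 * B" "varZ * w2 - varY * w3 = p1 * C"
    using par[OF 2 3] by blast
  obtain p2 where p2: "varX * u3 - varZ * u1 = p2 * A" "varX * v3 - varZ * v1 = p2 * B" "varX * w3 - varZ * w1 = p2 * C"
    using par[OF 3 1] by blast
  \<comment> \<open>The cyclic sum of the terms x (z U2 - y U3) cancels.\<close>
  have zero: "(varX * p1 + varY * p2 + varZ * p3) * A = 0" "(varX * p1 + varY * p2 + varZ * p3) * B = 0"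
    "(varX * p1 + varY * p2 + varZ * p3) * C = 0"
  proof -
    have *: "(varX * p1 + varY * p2 + varZ * p3) * H = varX * (p1 * H) + varY * (p2 * H) + varZ * (p3 * H)" for H
      by (simp add: algebra_simps)
    show "(varX * p1 + varY * p2 + varZ * p3) * A = 0" "(varX * p1 + varY * p2 + varZ * p3) * B = 0"
      "(varX * p1 + varY * p2 + varZ * p3) * C = 0"
      unfolding * p1[symmetric] p2[symmetric] p3[symmetric] by (simp_all add: algebra_simps)
  qed
  have "A \<noteq> 0 \<or> B \<noteq> 0 \<or> C \<noteq> 0"
    using cop unfolding coprime3_def by (metis dvd_0_right not_is_unit_0)
  then have "varX * p1 + varY * p2 + varZ * p3 = 0" using zero by auto
  then obtain g1 g2 g3 where g: "p1 = varZ * g2 - varY * g3" "p2 = varX * g3 - varZ * g1" "p3 = varY * g1 - varX * g2"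
    using koszul by blast
  have radial: "\<exists>t. z1 - g1 * H = t * varX \<and> z2 - g2 * H = t * varY \<and> z3 - g3 * H = t * varZ"
    if "varY * z1 - varX * z2 = p3 * H" "varZ * z2 - varY * z3 = p1 * H" "varX * z3 - varZ * z1 = p2 * H" for z1 z2 z3 H
  proof (rule parallel3[OF coprime3_vars])
    show "(z1 - g1 * H) * varY = (z2 - g2 * H) * varX" using that(1) unfolding g by (simp add: algebra_simps)
    show "(z2 - g2 * H) * varZ = (z3 - g3 * H) * varY" using that(2) unfolding g by (simp add: algebra_simps)
    show "(z1 - g1 * H) * varZ = (z3 - g3 * H) * varX" using that(3) unfolding g by (simp add: algebra_simps)
  qed
  obtain u where u: "u1 - g1 * A = u * varX" using radial[OF p3(1) p1(1) p2(1)] by blast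
  obtain v where v: "v1 - g1 * B = v * varX" using radial[OF p3(2) p1(2) p2(2)] by blast
  obtain w where w: "w1 - g1 * C = w * varX" using radial[OF p3(3) p1(3) p2(3)] by blast
  have "varX * (u * X1 + v * X2 + w * X3) = (u * varX) * X1 + (v * varX) * X2 + (w * varX) * X3"
    by (simp add: algebra_simps)
  also have "\<dots> = varX * F - g1 * (A * X1 + B * X2 + C * X3)"
    unfolding u[symmetric] v[symmetric] w[symmetric] 1(1) by (simp add: algebra_simps)
  also have "A * X1 + B * X2 + C * X3 = 0" unfolding ABC by (simp add: algebra_simps)
  finally have "F = u * X1 + v * X2 + w * X3" by simp
  moreover have "varX * (varX * u + varY * v + varZ * w) = varX * (u * varX) + varY * (v * varX) + varZ * (w * varX)"
    by (simp add: algebra_simps)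
  then have "varX * (varX * u + varY * v + varZ * w) =
      (varX * u1 + varY * v1 + varZ * w1) - g1 * (varX * A + varY * B + varZ * C)"
    unfolding u[symmetric] v[symmetric] w[symmetric] by (simp add: algebra_simps)
  moreover have "varX * A + varY * B + varZ * C = 0" unfolding ABC by (simp add: algebra_simps)
  ultimately show ?thesis unfolding iff using 1(2) by auto
qed

text \<open>Descending induction on the exponents of a monomial factor: once an exponent reaches its
  bound the product lies in the ideal; otherwise \<open>saturated_step\<close> applies to the
  products with one more variable.\<close>

lemma saturated:
  assumes ABC: "A = varY * X3 - varZ * X2" "B = varZ * X1 - varX * X3" "C = varX * X2 - varY * X1"
    and cop: "coprime3 A B C"
    and n: "varX ^ n1 * F \<in> ideal3 A B C" "varY ^ n2 * F \<in> ideal3 A B C" "varZ ^ n3 * F \<in> ideal3 A B C"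
  shows "F \<in> ideal3 A B C"
proof -
  note mult = ideal_setD(2)[OF ideal_set_ideal3[of A B C]]
  have "varX ^ i * varY ^ j * varZ ^ k * F \<in> ideal3 A B C" for i j k
  proof (induction "(n1 - i) + (n2 - j) + (n3 - k)" arbitrary: i j k rule: less_induct)
    case less
    consider "i \<ge> n1" | "j \<ge> n2" | "k \<ge> n3" | "i < n1" "j < n2" "k < n3" by linarith
    then show ?case
    proof cases
      case 1
      then have *: "varX ^ i = varX ^ (i - n1) * varX ^ n1" by (simp flip: power_add)
      have eq: "varX ^ i * varY ^ j * varZ ^ k * F = (varX ^ (i - n1) * varY ^ j * varZ ^ k) * (varX ^ n1 * F)"
        by (subst *) (simp only: mult_ac)
      show ?thesis by (subst eq) (rule mult[OF n(1)])
    next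
      case 2
      then have *: "varY ^ j = varY ^ (j - n2) * varY ^ n2" by (simp flip: power_add)
      have eq: "varX ^ i * varY ^ j * varZ ^ k * F = (varX ^ i * varY ^ (j - n2) * varZ ^ k) * (varY ^ n2 * F)"
        by (subst *) (simp only: mult_ac)
      show ?thesis by (subst eq) (rule mult[OF n(2)])
    next
      case 3
      then have *: "varZ ^ k = varZ ^ (k - n3) * varZ ^ n3" by (simp flip: power_add)
      have eq: "varX ^ i * varY ^ j * varZ ^ k * F = (varX ^ i * varY ^ j * varZ ^ (k - n3)) * (varZ ^ n3 * F)"
        by (subst *) (simp only: mult_ac)
      show ?thesis by (subst eq) (rule mult[OF n(3)])
    next
      case 4
      define M where "M = varX ^ i * varY ^ j * varZ ^ k"
      have "varX ^ Suc i * varY ^ j * varZ ^ k * F \<in> ideal3 A B C"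
        by (rule less.hyps) (use 4 in linarith)
      moreover have "varX ^ Suc i * varY ^ j * varZ ^ k * F = varX * (M * F)"
        by (simp only: M_def power_Suc mult_ac)
      ultimately have 1: "varX * (M * F) \<in> ideal3 A B C" by (simp only:)
      have "varX ^ i * varY ^ Suc j * varZ ^ k * F \<in> ideal3 A B C"
        by (rule less.hyps) (use 4 in linarith)
      moreover have "varX ^ i * varY ^ Suc j * varZ ^ k * F = varY * (M * F)"
        by (simp only: M_def power_Suc mult_ac)
      ultimately have 2: "varY * (M * F) \<in> ideal3 A B C" by (simp only:)
      have "varX ^ i * varY ^ j * varZ ^ Suc k * F \<in> ideal3 A B C"
        by (rule less.hyps) (use 4 in linarith)
      moreover have "varX ^ i * varY ^ j * varZ ^ Suc k * F = varZ * (M * F)"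
        by (simp only: M_def power_Suc mult_ac)
      ultimately have 3: "varZ * (M * F) \<in> ideal3 A B C" by (simp only:)
      show ?thesis using saturated_step[OF ABC cop 1 2 3] by (simp only: M_def)
    qed
  qed
  from this[of 0 0 0] show ?thesis by simp
qed

section \<open>Non-reduced singularities\<close>

lemma det_2:
  fixes M :: "'a :: comm_ring_1 mat"
  assumes M: "M \<in> carrier_mat 2 2"
  shows "det M = M $$ (0, 0) * M $$ (1, 1) - M $$ (0, 1) * M $$ (1, 0)"
proof -
  have dim: "dim_row M = 2" "dim_col M = 2" using M by auto
  have cof: "cofactor M 0 0 = M $$ (1, 1)" "cofactor M 0 1 = - M $$ (1, 0)"
    unfolding cofactor_def using dim
    by (simp_all add: mat_delete_def det_single)
  have "det M = (\<Sum>j<2. M $$ (0, j) * cofactor M 0 j)"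
    by (rule laplace_expansion_row[OF M]) simp
  also have "\<dots> = M $$ (0, 0) * cofactor M 0 0 + M $$ (0, 1) * cofactor M 0 1"
    by (simp add: numeral_2_eq_2)
  finally show ?thesis unfolding cof by simp
qed

lemma char_poly_2: "char_poly (mat_of_rows_list 2 [[a, b], [c, d]]) = [:a * d - b * c, - (a + d), 1 :: complex:]"
proof -
  let ?M = "mat_of_rows_list 2 [[a, b], [c, d]]"
  have M: "?M \<in> carrier_mat 2 2"
    unfolding mat_of_rows_list_def by (rule carrier_matI) (simp_all add: numeral_2_eq_2)
  have ent: "char_poly_matrix ?M $$ (0, 0) = [:- a, 1:]" "char_poly_matrix ?M $$ (1, 1) = [:- d, 1:]"
    "char_poly_matrix ?M $$ (0, 1) = [:- b:]" "char_poly_matrix ?M $$ (1, 0) = [:- c:]"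
    by (simp_all add: char_poly_matrix_def mat_of_rows_list_def)
  have C: "char_poly_matrix ?M \<in> carrier_mat 2 2" using M by simp
  show ?thesis unfolding char_poly_def det_2[OF C] ent by simp
qed

lemma eigenvalues_2:
  assumes "char_poly (mat_of_rows_list 2 [[a, b], [c, d]]) = [:- \<alpha>, 1:] * [:- \<beta> :: complex, 1:]"
  shows "a + d = \<alpha> + \<beta>" "a * d - b * c = \<alpha> * \<beta>"
proof -
  have "[:- \<alpha>, 1:] * [:- \<beta>, 1:] = [:\<alpha> * \<beta>, - (\<alpha> + \<beta>), 1:]" by simp
  then have "[:a * d - b * c, - (a + d), 1:] = [:\<alpha> * \<beta>, - (\<alpha> + \<beta>), 1:]"
    using assms unfolding char_poly_2 by simp
  then have "- (a + d) = - (\<alpha> + \<beta>)" and "a * d - b * c = \<alpha> * \<beta>" by simp_all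
  then show "a + d = \<alpha> + \<beta>" "a * d - b * c = \<alpha> * \<beta>" by (simp_all only: neg_equal_iff_equal)
qed

text \<open>The local field is the image of X - XT R in the chart, up to a sign \<open>s\<close>
  that depends on the order of the coordinates. X annihilates \<open>F\<close> and \<open>G\<close>
  while R multiplies them by d, so both have the cofactor - s d XT. Its value at the saddle is a
  natural multiple of each eigenvalue, and their ratio is negative, so the value is 0.\<close>

lemma (in chart) field_vanishes_at_saddle:
  fixes XT XU XV F G :: poly3
  assumes F: "homogeneous d F" and G: "homogeneous d G" and "coprime F G" and "d > 0"
    and XF: "XU * dU F + XV * dV F + XT * dT F = 0" and XG: "XU * dU G + XV * dV G + XT * dT G = 0"
    and b: "b = s * D (XU * T - U * XT)" and a: "- a = s * D (XV * T - V * XT)" and s: "s = 1 \<or> s = - 1"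
    and zero: "eval2 a q = 0" "eval2 b q = 0"
    and dim: "quotient_dim (local_ring q) (local_ideal q a b) = 1"
    and char: "char_poly (mat_of_rows_list 2
       [[eval2 (partial_u b) q, eval2 (partial_v b) q], [- eval2 (partial_u a) q, - eval2 (partial_v a) q]])
       = [:- (\<kappa> * of_int \<delta>), 1:] * [:- (\<kappa> * of_int \<rho>), 1:]"
    and not_pos: "\<not> real_of_int \<delta> / real_of_int \<rho> > 0"
  shows "eval3 XT (pt q) = 0"
proof -
  have ev_minus: "eval2 (partial_u (- a)) q = - eval2 (partial_u a) q" "eval2 (partial_v (- a)) q = - eval2 (partial_v a) q"
    using partial_uv_diff[of 0 a] by (simp_all add: eval2_ring_hom partial_u_def partial_v_def)
  note tr_det = eigenvalues_2[OF char]
  have tr: "eval2 (partial_u b) q + eval2 (partial_v (- a)) q = \<kappa> * of_int \<delta> + \<kappa> * of_int \<rho>"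
    and det: "eval2 (partial_u b) q * eval2 (partial_v (- a)) q - eval2 (partial_v b) q * eval2 (partial_u (- a)) q
      = \<kappa> * of_int \<delta> * (\<kappa> * of_int \<rho>)"
    using tr_det by (simp_all add: ev_minus)
  have "\<kappa> * of_int \<delta> * (\<kappa> * of_int \<rho>) \<noteq> 0"
    using milnor_one_det[OF dim zero] tr_det(2) by (auto simp: algebra_simps)
  then have nz: "\<kappa> \<noteq> 0" "\<delta> \<noteq> 0" "\<rho> \<noteq> 0" by auto
  have neg: "\<delta> * \<rho> < 0"
  proof -
    have "\<not> (0 < \<delta> \<and> 0 < \<rho>)" "\<not> (\<delta> < 0 \<and> \<rho> < 0)" using not_pos by (auto simp: zero_less_divide_iff)
    then show ?thesis using nz by (auto simp: mult_less_0_iff)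
  qed
  have no_multiple: "of_nat n * x * y \<noteq> y * y" if "x * y < 0" for n :: nat and x y :: int
  proof -
    have "of_nat n * (x * y) \<le> 0" using that by (simp add: mult_nonneg_nonpos)
    moreover have "y * y > 0" using that by (auto simp: mult_less_0_iff zero_less_mult_iff)
    ultimately have "of_nat n * (x * y) \<noteq> y * y" by linarith
    then show ?thesis by (simp only: mult.assoc not_False_eq_True)
  qed
  \<comment> \<open>Opposite signs exclude every resonance, so both eigenvalues have a formal
    separatrix.\<close>
  have nonres: "\<kappa> * of_int y \<noteq> of_nat n * (\<kappa> * of_int x)" if "x * y < 0" for n :: nat and x y :: int
  proof
    assume "\<kappa> * of_int y = of_nat n * (\<kappa> * of_int x)"
    then have "of_int y = (of_int (of_nat n * x) :: complex)" using nz(1) by (simp add: mult.left_commute)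
    then have "y = of_nat n * x" by (simp only: of_int_eq_iff)
    then show False using no_multiple[OF that, of n] by simp
  qed
  define h where "h = s * (- of_nat d * D XT)"
  have cof: "b * partial_u (D H) + (- a) * partial_v (D H) = h * D H"
    if H: "homogeneous d H" "XU * dU H + XV * dV H + XT * dT H = 0" for H
  proof -
    have "b * partial_u (D H) + (- a) * partial_v (D H)
      = s * D ((XU * T - U * XT) * dU H + (XV * T - V * XT) * dV H)"
      by (simp only: a b partial_D D_mult D_add distrib_left mult.assoc)
    also have "(XU * T - U * XT) * dU H + (XV * T - V * XT) * dV H
        = T * (XU * dU H + XV * dV H + XT * dT H) - XT * (U * dU H + V * dV H + T * dT H)"
      by (simp add: algebra_simps)
    also have "\<dots> = - XT * (of_nat d * H)"
      using H by (simp add: homogeneous_iff_euler euler_vars)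
    finally show ?thesis by (simp add: h_def D_mult D_uminus D_of_nat mult_ac)
  qed
  have cop: "is_unit f" if "f dvd D F" "f dvd D G" for f
  proof (rule is_unit_D[of F G 0])
    show "coprime3 F G 0" using \<open>coprime F G\<close> unfolding coprime3_def by (blast intro: coprime_common_divisor)
  qed (use F G that in auto)
  have zero': "eval2 (- a) q = 0" using zero by (simp add: eval2_ring_hom)
  have "\<exists>n :: nat. eval2 h q = of_nat n * (\<kappa> * of_int \<rho>)"
  proof (rule cofactor_multiple_of_eigenvalue[OF zero(2) zero' tr det _ _ cof[OF F XF] cof[OF G XG] cop])
    show "\<kappa> * of_int \<rho> \<noteq> 0" using nz by simp
    show "\<kappa> * of_int \<delta> \<noteq> of_nat n * (\<kappa> * of_int \<rho>)" for n
      by (rule nonres) (use neg in \<open>simp add: mult.commute\<close>)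
  qed
  then obtain n where n: "eval2 h q = of_nat n * (\<kappa> * of_int \<rho>)" by blast
  have "\<exists>n :: nat. eval2 h q = of_nat n * (\<kappa> * of_int \<delta>)"
  proof (rule cofactor_multiple_of_eigenvalue[OF zero(2) zero' _ _ _ _ cof[OF F XF] cof[OF G XG] cop])
    show "eval2 (partial_u b) q + eval2 (partial_v (- a)) q = \<kappa> * of_int \<rho> + \<kappa> * of_int \<delta>"
      using tr by (simp add: add.commute)
    show "eval2 (partial_u b) q * eval2 (partial_v (- a)) q - eval2 (partial_v b) q * eval2 (partial_u (- a)) q
      = \<kappa> * of_int \<rho> * (\<kappa> * of_int \<delta>)" using det by (simp add: mult_ac)
    show "\<kappa> * of_int \<delta> \<noteq> 0" using nz by simp
    show "\<kappa> * of_int \<rho> \<noteq> of_nat n * (\<kappa> * of_int \<delta>)" for n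
      by (rule nonres) (use neg in simp)
  qed
  then obtain m where m: "eval2 h q = of_nat m * (\<kappa> * of_int \<delta>)" by blast
  have "of_nat n * (\<kappa> * of_int \<rho>) = of_nat m * (\<kappa> * of_int \<delta>)" by (rule trans[OF n[symmetric] m])
  then have "\<kappa> * of_int (of_nat n * \<rho>) = \<kappa> * (of_int (of_nat m * \<delta>) :: complex)"
    by (simp only: of_int_mult of_int_of_nat_eq mult.left_commute)
  then have "of_int (of_nat n * \<rho>) = (of_int (of_nat m * \<delta>) :: complex)"
    by (simp only: mult_left_cancel[OF nz(1)])
  then have nm: "of_nat n * \<rho> = of_nat m * \<delta>" by (simp only: of_int_eq_iff)
  have "n = 0"
  proof (rule ccontr)
    assume "n \<noteq> 0"
    then have "of_nat n * \<rho> * \<rho> > 0" using nz(3) by (simp add: mult.assoc zero_less_mult_iff) (metis linorder_neqE_linordered_idom)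
    moreover have "of_nat n * \<rho> * \<rho> = of_nat m * (\<delta> * \<rho>)" unfolding nm by (simp only: mult.assoc)
    moreover have "of_nat m * (\<delta> * \<rho>) \<le> 0" using neg by (simp add: mult_nonneg_nonpos)
    ultimately show False by linarith
  qed
  then have "eval2 h q = 0" using n by simp
  then have "eval2 s q * (of_nat d * eval3 XT (pt q)) = 0"
    by (simp add: h_def eval2_ring_hom eval_D flip: D_of_nat const3_of_nat) (simp add: eval3_ring_hom)
  moreover have "eval2 s q \<noteq> 0" using s by (auto simp: eval2_ring_hom)
  ultimately show ?thesis using \<open>d > 0\<close> by simp
qed

text \<open>Elimination yields a nonzero polynomial in u alone that vanishes at all common zeros, so
  u takes finitely many values. On each line with constant u one of the restrictions is nonzero, as
  otherwise the equation of the line would be a common factor.\<close>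

lemma (in chart) finite_zeros:
  assumes cop: "coprime3 A B C" and hom: "homogeneous a A" "homogeneous b B" "homogeneous c C"
  shows "finite {q. eval2 (D A) q = 0 \<and> eval2 (D B) q = 0 \<and> eval2 (D C) q = 0}"
proof -
  define Q where "Q = {q. eval2 (D A) q = 0 \<and> eval2 (D B) q = 0 \<and> eval2 (D C) q = 0}"
  define K where "K = {g. \<forall>q\<in>Q. eval2 g q = 0}"
  have K: "ideal_set K" by (simp add: ideal_set_def K_def eval2_ring_hom)
  have unit: "is_unit f" if f: "\<And>g. g \<in> K \<Longrightarrow> f dvd g" for f
  proof (rule is_unit_D[OF cop hom])
    have "D A \<in> K" "D B \<in> K" "D C \<in> K" by (simp_all add: K_def Q_def)
    then show "f dvd D A" "f dvd D B" "f dvd D C" by (simp_all add: f)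
  qed
  have "\<exists>c. c \<noteq> 0 \<and> [:c:] \<in> K" by (rule elimination[OF K]) (rule unit)
  then obtain e where e: "e \<noteq> 0" "[:e:] \<in> K" by blast
  define sp :: "complex \<Rightarrow> poly2 \<Rightarrow> complex poly" where "sp = (\<lambda>z. map_poly (\<lambda>p. poly p z))"
  have fin: "finite {v. poly (sp u (D A)) v = 0 \<and> poly (sp u (D B)) v = 0 \<and> poly (sp u (D C)) v = 0}" for u
  proof (rule ccontr)
    assume inf: "infinite {v. poly (sp u (D A)) v = 0 \<and> poly (sp u (D B)) v = 0 \<and> poly (sp u (D C)) v = 0}"
    have "sp u (D A) = 0" by (rule poly_eq_0_of_infinite_roots[OF _ inf]) simp
    moreover have "sp u (D B) = 0" by (rule poly_eq_0_of_infinite_roots[OF _ inf]) simp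
    moreover have "sp u (D C) = 0" by (rule poly_eq_0_of_infinite_roots[OF _ inf]) simp
    ultimately have "[:[:- u, 1:]:] dvd D A" "[:[:- u, 1:]:] dvd D B" "[:[:- u, 1:]:] dvd D C"
      unfolding const_dvd_iff sp_def .
    then have "is_unit [:[:- u, 1:]:]" by (rule is_unit_D[OF cop hom])
    then show False by (simp add: is_unit_const_poly_iff is_unit_iff_degree)
  qed
  have "Q \<subseteq> (SIGMA u:{u. poly e u = 0}.
      {v. poly (sp u (D A)) v = 0 \<and> poly (sp u (D B)) v = 0 \<and> poly (sp u (D C)) v = 0})"
  proof
    fix q assume q: "q \<in> Q"
    obtain u v where uv: "q = (u, v)" by (cases q)
    have "eval2 [:e:] q = 0" using e(2) q unfolding K_def by blast
    then have "poly e u = 0" by (simp add: uv eval2_vars)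
    then show "q \<in> (SIGMA u:{u. poly e u = 0}.
      {v. poly (sp u (D A)) v = 0 \<and> poly (sp u (D B)) v = 0 \<and> poly (sp u (D C)) v = 0})"
      using q by (simp add: uv Q_def eval2_specialize sp_def)
  qed
  moreover have "finite (SIGMA u:{u. poly e u = 0}.
      {v. poly (sp u (D A)) v = 0 \<and> poly (sp u (D B)) v = 0 \<and> poly (sp u (D C)) v = 0})"
    by (rule finite_SigmaI[OF poly_roots_finite[OF e(1)] fin])
  ultimately show ?thesis unfolding Q_def by (rule finite_subset)
qed

section \<open>Points of the projective plane\<close>

lemma eval3_scale_eq_0:
  assumes "homogeneous d F" "c \<noteq> 0"
  shows "eval3 F (c * x, c * y, c * z) = 0 \<longleftrightarrow> eval3 F (x, y, z) = 0"
  using assms(2) by (simp add: eval3_scale[OF assms(1)])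

lemma eval3_charts:
  assumes "homogeneous d F"
  shows "x \<noteq> 0 \<Longrightarrow> eval3 F (1, y / x, z / x) = 0 \<longleftrightarrow> eval3 F (x, y, z) = 0"
    and "y \<noteq> 0 \<Longrightarrow> eval3 F (x / y, 1, z / y) = 0 \<longleftrightarrow> eval3 F (x, y, z) = 0"
    and "z \<noteq> 0 \<Longrightarrow> eval3 F (x / z, y / z, 1) = 0 \<longleftrightarrow> eval3 F (x, y, z) = 0"
  using eval3_scale_eq_0[OF assms, of x 1 "y / x" "z / x"] eval3_scale_eq_0[OF assms, of y "x / y" 1 "z / y"]
    eval3_scale_eq_0[OF assms, of z "x / z" "y / z" 1] by simp_all

lemma proj_eq_refl: "proj_eq (x, y, z) (x, y, z) \<longleftrightarrow> (x, y, z) \<noteq> (0, 0, 0)"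
  unfolding proj_eq_iff by (auto intro!: exI[of _ 1])

lemma proj_plane_cases:
  obtains x y z where "(x, y, z) \<noteq> (0, 0, 0)" "p = abs_proj_plane (x, y, z)"
proof (induction p rule: proj_plane.abs_induct)
  case (1 w)
  obtain x y z where w: "w = (x, y, z)" by (cases w)
  show ?case using 1(2)[of x y z] 1(1) unfolding w proj_eq_refl by blast
qed

lemma singular_iff:
  assumes "(x, y, z) \<noteq> (0, 0, 0)" and "homogeneous d A" "homogeneous d B" "homogeneous d C"
  shows "singular (A, B, C) (abs_proj_plane (x, y, z)) \<longleftrightarrow>
    eval3 A (x, y, z) = 0 \<and> eval3 B (x, y, z) = 0 \<and> eval3 C (x, y, z) = 0"
proof -
  have refl: "proj_eq (x, y, z) (x, y, z)" unfolding proj_eq_refl by (rule assms(1))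
  have coords: "homogeneous_coords (abs_proj_plane (x, y, z)) = Collect (proj_eq (x, y, z))"
    by (rule homogeneous_coords.abs_eq[OF refl])
  show ?thesis
  proof
    assume "singular (A, B, C) (abs_proj_plane (x, y, z))"
    then have "\<forall>w\<in>Collect (proj_eq (x, y, z)). eval3 A w = 0 \<and> eval3 B w = 0 \<and> eval3 C w = 0"
      by (simp only: singular_def coords prod.case)
    then show "eval3 A (x, y, z) = 0 \<and> eval3 B (x, y, z) = 0 \<and> eval3 C (x, y, z) = 0"
      using refl by blast
  next
    assume zero: "eval3 A (x, y, z) = 0 \<and> eval3 B (x, y, z) = 0 \<and> eval3 C (x, y, z) = 0"
    have "eval3 A w = 0 \<and> eval3 B w = 0 \<and> eval3 C w = 0" if eq: "proj_eq (x, y, z) w" for w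
    proof -
      obtain x' y' z' where w: "w = (x', y', z')" by (cases w)
      obtain c where c: "c \<noteq> 0" "x' = c * x" "y' = c * y" "z' = c * z"
        using eq unfolding w proj_eq_iff by blast
      show ?thesis using zero by (simp add: w c eval3_scale[OF assms(2)] eval3_scale[OF assms(3)] eval3_scale[OF assms(4)])
    qed
    then show "singular (A, B, C) (abs_proj_plane (x, y, z))" by (simp add: singular_def coords)
  qed
qed

lemma local_form_abs:
  assumes "(x, y, z) \<noteq> (0, 0, 0)"
  shows "local_form (A, B, C) (abs_proj_plane (x, y, z)) =
    (if z \<noteq> 0 then (dehomZ A, dehomZ B, (x / z, y / z))
     else if y \<noteq> 0 then (dehomY A, dehomY C, (x / y, z / y))
     else (dehomX B, dehomX C, (y / x, z / x)))"
proof -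
  have "proj_eq (x, y, z) (x, y, z)" unfolding proj_eq_refl by (rule assms)
  from local_form.abs_eq[OF this] show ?thesis by simp
qed

section \<open>Foliations with a first integral\<close>

locale integrable_foliation =
  fixes r d :: nat and A B C F G X1 X2 X3 :: poly3
  assumes hom: "homogeneous (r + 1) A" "homogeneous (r + 1) B" "homogeneous (r + 1) C"
    and cop: "coprime3 A B C"
    and ABC: "A = varY * X3 - varZ * X2" "B = varZ * X1 - varX * X3" "C = varX * X2 - varY * X1"
    and homX: "homogeneous r X1" "homogeneous r X2" "homogeneous r X3"
    and FG: "d > 0" "homogeneous d F" "homogeneous d G" "coprime F G"
    and XF: "X1 * partial_X F + X2 * partial_Y F + X3 * partial_Z F = 0"
    and XG: "X1 * partial_X G + X2 * partial_Y G + X3 * partial_Z G = 0"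
    and nondeg: "nondegenerate (A, B, C)"
    and eig: "\<And>p. singular (A, B, C) p \<Longrightarrow> \<exists>\<delta> \<rho>. coprime_eigenvalue_pair (A, B, C) p \<delta> \<rho>"
begin

text \<open>\<open>card\<close> is 0 on infinite sets, so a lower bound for the number of
  non-reduced singularities presupposes finiteness.\<close>

lemma finite_singular: "finite {p. singular (A, B, C) p}"
proof -
  define ZX where "ZX = {q. eval2 (dehomX A) q = 0 \<and> eval2 (dehomX B) q = 0 \<and> eval2 (dehomX C) q = 0}"
  define ZY where "ZY = {q. eval2 (dehomY A) q = 0 \<and> eval2 (dehomY B) q = 0 \<and> eval2 (dehomY C) q = 0}"
  define ZZ where "ZZ = {q. eval2 (dehomZ A) q = 0 \<and> eval2 (dehomZ B) q = 0 \<and> eval2 (dehomZ C) q = 0}"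
  have fin: "finite ZX" "finite ZY" "finite ZZ"
    unfolding ZX_def ZY_def ZZ_def
    by (rule chartX.finite_zeros[OF cop hom] chartY.finite_zeros[OF cop hom] chartZ.finite_zeros[OF cop hom])+
  have scale: "abs_proj_plane (x, y, z) = abs_proj_plane (x / c, y / c, z / c)"
    if "(x, y, z) \<noteq> (0, 0, 0)" "c \<noteq> 0" for x y z c
  proof -
    have "proj_eq (x, y, z) (x / c, y / c, z / c)"
      unfolding proj_eq_iff using that by (intro conjI exI[of _ "inverse c"]) (simp_all add: field_simps)
    then show ?thesis by (rule Quotient3_rel_abs[OF Quotient3_proj_plane])
  qed
  have "p \<in> (\<lambda>(u, v). abs_proj_plane (1, u, v)) ` ZX \<union> (\<lambda>(u, v). abs_proj_plane (u, 1, v)) ` ZY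
      \<union> (\<lambda>(u, v). abs_proj_plane (u, v, 1)) ` ZZ" if p: "singular (A, B, C) p" for p
  proof -
    obtain x y z where w: "(x, y, z) \<noteq> (0, 0, 0)" "p = abs_proj_plane (x, y, z)" by (rule proj_plane_cases)
    have zero: "eval3 A (x, y, z) = 0" "eval3 B (x, y, z) = 0" "eval3 C (x, y, z) = 0"
      using p unfolding w(2) singular_iff[OF w(1) hom] by blast+
    consider "x \<noteq> 0" | "y \<noteq> 0" | "z \<noteq> 0" using w(1) by auto
    then show ?thesis
    proof cases
      case 1
      then have "(y / x, z / x) \<in> ZX"
        using zero by (simp add: ZX_def eval2_dehom eval3_charts(1)[OF hom(1)] eval3_charts(1)[OF hom(2)] eval3_charts(1)[OF hom(3)])
      moreover have "p = (\<lambda>(u, v). abs_proj_plane (1, u, v)) (y / x, z / x)"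
        using scale[OF w(1) 1] 1 w(2) by simp
      ultimately show ?thesis by blast
    next
      case 2
      then have "(x / y, z / y) \<in> ZY"
        using zero by (simp add: ZY_def eval2_dehom eval3_charts(2)[OF hom(1)] eval3_charts(2)[OF hom(2)] eval3_charts(2)[OF hom(3)])
      moreover have "p = (\<lambda>(u, v). abs_proj_plane (u, 1, v)) (x / y, z / y)"
        using scale[OF w(1) 2] 2 w(2) by simp
      ultimately show ?thesis by blast
    next
      case 3
      then have "(x / z, y / z) \<in> ZZ"
        using zero by (simp add: ZZ_def eval2_dehom eval3_charts(3)[OF hom(1)] eval3_charts(3)[OF hom(2)] eval3_charts(3)[OF hom(3)])
      moreover have "p = (\<lambda>(u, v). abs_proj_plane (u, v, 1)) (x / z, y / z)"
        using scale[OF w(1) 3] 3 w(2) by simp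
      ultimately show ?thesis by blast
    qed
  qed
  then have "{p. singular (A, B, C) p} \<subseteq> (\<lambda>(u, v). abs_proj_plane (1, u, v)) ` ZX
      \<union> (\<lambda>(u, v). abs_proj_plane (u, 1, v)) ` ZY \<union> (\<lambda>(u, v). abs_proj_plane (u, v, 1)) ` ZZ"
    by blast
  then show ?thesis by (rule finite_subset) (use fin in simp)
qed

text \<open>Away from the singularities one of \<open>A\<close>, \<open>B\<close>, \<open>C\<close>
  serves as \<open>g\<close>. At a singularity \<open>milnor_one\<close> gives the multiplier in the
  chart that \<open>local_form\<close> selects; the generator absent from the local form enters with
  factor 0 before homogenising.\<close>

lemma local_membership:
  assumes H: "homogeneous e H" and w: "(x, y, z) \<noteq> (0, 0, 0)"
    and van: "eval3 A (x, y, z) = 0 \<Longrightarrow> eval3 B (x, y, z) = 0 \<Longrightarrow> eval3 C (x, y, z) = 0 \<Longrightarrow> eval3 H (x, y, z) = 0"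
  shows "\<exists>g. eval3 g (x, y, z) \<noteq> 0 \<and> g * H \<in> ideal3 A B C"
proof (cases "eval3 A (x, y, z) = 0 \<and> eval3 B (x, y, z) = 0 \<and> eval3 C (x, y, z) = 0")
  case False
  have in_ideal: "a * A + b * B + c * C \<in> ideal3 A B C" for a b c unfolding ideal3_def by blast
  have "A * H \<in> ideal3 A B C" "B * H \<in> ideal3 A B C" "C * H \<in> ideal3 A B C"
    using in_ideal[of H 0 0] in_ideal[of 0 H 0] in_ideal[of 0 0 H] by (simp_all add: mult.commute)
  then show ?thesis using False by blast
next
  case True
  define p where "p = abs_proj_plane (x, y, z)"
  have "singular (A, B, C) p" unfolding p_def singular_iff[OF w hom] by (rule True)
  then have milnor: "milnor_number (A, B, C) p = 1" using nondeg by (simp add: nondegenerate_def)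
  have zero: "eval3 A (x, y, z) = 0" "eval3 B (x, y, z) = 0" "eval3 C (x, y, z) = 0" "eval3 H (x, y, z) = 0"
    using True van by blast+
  note lf = local_form_abs[OF w, of A B C, folded p_def]
  consider "z \<noteq> 0" | "z = 0" "y \<noteq> 0" | "z = 0" "y = 0" "x \<noteq> 0" using w by auto
  then show ?thesis
  proof cases
    case 1
    let ?q = "(x / z, y / z)"
    have dim: "quotient_dim (local_ring ?q) (local_ideal ?q (dehomZ A) (dehomZ B)) = 1"
      using milnor 1 by (simp add: milnor_number_def lf)
    note ev = eval3_charts(3)[OF _ 1, of _ _ x y]
    obtain g s t where g: "eval2 g ?q \<noteq> 0" "g * dehomZ H = s * dehomZ A + t * dehomZ B"
      using milnor_one[OF dim, of "dehomZ H"] ev[OF hom(1)] ev[OF hom(2)] ev[OF H] zero by (auto simp: eval2_dehom)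
    have "g * dehomZ H = s * dehomZ A + t * dehomZ B + 0 * dehomZ C" using g(2) by simp
    from chartZ.ideal_homogenize[OF H hom this] obtain n k where
      k: "homogeneous n k" "dehomZ k = g" "k * H \<in> ideal3 A B C" by blast
    have "eval3 k (x, y, z) \<noteq> 0" using g(1) ev[OF k(1)] by (simp add: k(2)[symmetric] eval2_dehom)
    then show ?thesis using k(3) by blast
  next
    case 2
    let ?q = "(x / y, z / y)"
    have dim: "quotient_dim (local_ring ?q) (local_ideal ?q (dehomY A) (dehomY C)) = 1"
      using milnor 2 by (simp add: milnor_number_def lf)
    note ev = eval3_charts(2)[OF _ 2(2), of _ _ x z]
    obtain g s t where g: "eval2 g ?q \<noteq> 0" "g * dehomY H = s * dehomY A + t * dehomY C"
      using milnor_one[OF dim, of "dehomY H"] ev[OF hom(1)] ev[OF hom(3)] ev[OF H] zero by (auto simp: eval2_dehom)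
    have "g * dehomY H = s * dehomY A + 0 * dehomY B + t * dehomY C" using g(2) by simp
    from chartY.ideal_homogenize[OF H hom this] obtain n k where
      k: "homogeneous n k" "dehomY k = g" "k * H \<in> ideal3 A B C" by blast
    have "eval3 k (x, y, z) \<noteq> 0" using g(1) ev[OF k(1)] by (simp add: k(2)[symmetric] eval2_dehom)
    then show ?thesis using k(3) by blast
  next
    case 3
    let ?q = "(y / x, z / x)"
    have dim: "quotient_dim (local_ring ?q) (local_ideal ?q (dehomX B) (dehomX C)) = 1"
      using milnor 3 by (simp add: milnor_number_def lf)
    note ev = eval3_charts(1)[OF _ 3(3), of _ _ y z]
    obtain g s t where g: "eval2 g ?q \<noteq> 0" "g * dehomX H = s * dehomX B + t * dehomX C"
      using milnor_one[OF dim, of "dehomX H"] ev[OF hom(2)] ev[OF hom(3)] ev[OF H] zero by (auto simp: eval2_dehom)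
    have "g * dehomX H = 0 * dehomX A + s * dehomX B + t * dehomX C" using g(2) by simp
    from chartX.ideal_homogenize[OF H hom this] obtain n k where
      k: "homogeneous n k" "dehomX k = g" "k * H \<in> ideal3 A B C" by blast
    have "eval3 k (x, y, z) \<noteq> 0" using g(1) ev[OF k(1)] by (simp add: k(2)[symmetric] eval2_dehom)
    then show ?thesis using k(3) by blast
  qed
qed

lemma vanishing_on_singular_imp_mem:
  assumes H: "homogeneous e H"
    and van: "\<And>x y z. (x, y, z) \<noteq> (0, 0, 0) \<Longrightarrow> eval3 A (x, y, z) = 0 \<Longrightarrow> eval3 B (x, y, z) = 0 \<Longrightarrow>
      eval3 C (x, y, z) = 0 \<Longrightarrow> eval3 H (x, y, z) = 0"
  shows "H \<in> ideal3 A B C"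
proof -
  have loc: "\<exists>g. eval3 g (x, y, z) \<noteq> 0 \<and> g * H \<in> ideal3 A B C" if "(x, y, z) \<noteq> (0, 0, 0)" for x y z
    using local_membership[OF H that van[OF that]] by blast
  have "\<exists>n. varX ^ n * H \<in> ideal3 A B C"
    by (rule chartX.power_in_ideal[OF H hom cop]) (auto intro!: loc)
  moreover have "\<exists>n. varY ^ n * H \<in> ideal3 A B C"
    by (rule chartY.power_in_ideal[OF H hom cop]) (auto intro!: loc)
  moreover have "\<exists>n. varZ ^ n * H \<in> ideal3 A B C"
    by (rule chartZ.power_in_ideal[OF H hom cop]) (auto intro!: loc)
  ultimately show ?thesis using saturated[OF ABC cop] by blast
qed

text \<open>The saddle argument kills the component of X that belongs to the coordinate put equal to
  1. At a singular point X is parallel to R, so the other components vanish too.\<close>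

lemma field_vanishes_at_reduced:
  assumes w: "(x, y, z) \<noteq> (0, 0, 0)"
    and zero: "eval3 A (x, y, z) = 0" "eval3 B (x, y, z) = 0" "eval3 C (x, y, z) = 0"
    and reduced: "\<not> non_reduced (A, B, C) (abs_proj_plane (x, y, z))"
  shows "eval3 X1 (x, y, z) = 0 \<and> eval3 X2 (x, y, z) = 0 \<and> eval3 X3 (x, y, z) = 0"
proof -
  define p where "p = abs_proj_plane (x, y, z)"
  have sing: "singular (A, B, C) p" unfolding p_def singular_iff[OF w hom] using zero by blast
  then have milnor: "milnor_number (A, B, C) p = 1" using nondeg by (simp add: nondegenerate_def)
  obtain \<delta> \<rho> where pair: "coprime_eigenvalue_pair (A, B, C) p \<delta> \<rho>" using eig[OF sing] by blast
  then obtain \<kappa> where kappa: "eigenvalue_pair (A, B, C) p (\<kappa> * of_int \<delta>) (\<kappa> * of_int \<rho>)"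
    unfolding coprime_eigenvalue_pair_def by blast
  have not_pos: "\<not> real_of_int \<delta> / real_of_int \<rho> > 0"
    using reduced sing pair unfolding non_reduced_def p_def by blast
  have par: "y * eval3 X3 (x, y, z) = z * eval3 X2 (x, y, z)" "z * eval3 X1 (x, y, z) = x * eval3 X3 (x, y, z)"
    "x * eval3 X2 (x, y, z) = y * eval3 X1 (x, y, z)"
    using zero unfolding ABC by (simp_all add: eval3_ring_hom eval3_vars)
  note lf = local_form_abs[OF w, of A B C, folded p_def]
  note defs = eigenvalue_pair_def linear_part_def lf
  consider "z \<noteq> 0" | "z = 0" "y \<noteq> 0" | "z = 0" "y = 0" "x \<noteq> 0" using w by auto
  then show ?thesis
  proof cases
    case 1
    let ?q = "(x / z, y / z)"
    have dim: "quotient_dim (local_ring ?q) (local_ideal ?q (dehomZ A) (dehomZ B)) = 1"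
      using milnor 1 by (simp add: milnor_number_def lf)
    note ev = eval3_charts(3)[OF _ 1, of _ _ x y]
    have "eval3 X3 (case ?q of (u, v) \<Rightarrow> (u, v, 1)) = 0"
    proof (rule chartZ.field_vanishes_at_saddle[OF FG(2,3,4,1) XF XG, where s = 1])
      show "dehomZ B = 1 * dehomZ (X1 * varZ - varX * X3)" by (simp add: ABC mult.commute)
      show "- dehomZ A = 1 * dehomZ (X2 * varZ - varY * X3)"
        by (simp add: ABC mult.commute flip: chartZ.D_uminus)
      show "eval2 (dehomZ A) ?q = 0" "eval2 (dehomZ B) ?q = 0"
        using ev[OF hom(1)] ev[OF hom(2)] zero by (simp_all add: eval2_dehom)
      show "char_poly (mat_of_rows_list 2
        [[eval2 (partial_u (dehomZ B)) ?q, eval2 (partial_v (dehomZ B)) ?q],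
         [- eval2 (partial_u (dehomZ A)) ?q, - eval2 (partial_v (dehomZ A)) ?q]])
        = [:- (\<kappa> * of_int \<delta>), 1:] * [:- (\<kappa> * of_int \<rho>), 1:]"
        using kappa 1 unfolding defs by simp
      show "quotient_dim (local_ring ?q) (local_ideal ?q (dehomZ A) (dehomZ B)) = 1" by (rule dim)
      show "\<not> real_of_int \<delta> / real_of_int \<rho> > 0" by (rule not_pos)
      show "1 = (1 :: poly2) \<or> 1 = (- 1 :: poly2)" by simp
    qed
    then have "eval3 X3 (x, y, z) = 0" using ev[OF homX(3)] by simp
    then show ?thesis using par 1 by simp
  next
    case 2
    let ?q = "(x / y, z / y)"
    have dim: "quotient_dim (local_ring ?q) (local_ideal ?q (dehomY A) (dehomY C)) = 1"
      using milnor 2 by (simp add: milnor_number_def lf)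
    note ev = eval3_charts(2)[OF _ 2(2), of _ _ x z]
    have XF': "X1 * partial_X F + X3 * partial_Z F + X2 * partial_Y F = 0"
      and XG': "X1 * partial_X G + X3 * partial_Z G + X2 * partial_Y G = 0"
      using XF XG by (simp_all add: ac_simps)
    have "eval3 X2 (case ?q of (u, v) \<Rightarrow> (u, 1, v)) = 0"
    \<comment> \<open>The sign is - 1 because the coordinates X, Z of this chart reverse the cyclic
      order.\<close>
    proof (rule chartY.field_vanishes_at_saddle[OF FG(2,3,4,1) XF' XG', where s = "- 1"])
      show "dehomY C = - 1 * dehomY (X1 * varY - varX * X2)" by (simp add: ABC mult.commute flip: chartY.D_uminus)
      show "- dehomY A = - 1 * dehomY (X3 * varY - varZ * X2)" by (simp add: ABC mult.commute)
      show "eval2 (dehomY A) ?q = 0" "eval2 (dehomY C) ?q = 0"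
        using ev[OF hom(1)] ev[OF hom(3)] zero by (simp_all add: eval2_dehom)
      show "char_poly (mat_of_rows_list 2
        [[eval2 (partial_u (dehomY C)) ?q, eval2 (partial_v (dehomY C)) ?q],
         [- eval2 (partial_u (dehomY A)) ?q, - eval2 (partial_v (dehomY A)) ?q]])
        = [:- (\<kappa> * of_int \<delta>), 1:] * [:- (\<kappa> * of_int \<rho>), 1:]"
        using kappa 2 unfolding defs by simp
      show "quotient_dim (local_ring ?q) (local_ideal ?q (dehomY A) (dehomY C)) = 1" by (rule dim)
      show "\<not> real_of_int \<delta> / real_of_int \<rho> > 0" by (rule not_pos)
      show "- 1 = (1 :: poly2) \<or> - 1 = (- 1 :: poly2)" by simp
    qed
    then have "eval3 X2 (x, y, z) = 0" using ev[OF homX(2)] by simp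
    then show ?thesis using par 2 by simp
  next
    case 3
    let ?q = "(y / x, z / x)"
    have dim: "quotient_dim (local_ring ?q) (local_ideal ?q (dehomX B) (dehomX C)) = 1"
      using milnor 3 by (simp add: milnor_number_def lf)
    note ev = eval3_charts(1)[OF _ 3(3), of _ _ y z]
    have XF': "X2 * partial_Y F + X3 * partial_Z F + X1 * partial_X F = 0"
      and XG': "X2 * partial_Y G + X3 * partial_Z G + X1 * partial_X G = 0"
      using XF XG by (simp_all add: ac_simps)
    have "eval3 X1 (case ?q of (u, v) \<Rightarrow> (1, u, v)) = 0"
    proof (rule chartX.field_vanishes_at_saddle[OF FG(2,3,4,1) XF' XG', where s = 1])
      show "dehomX C = 1 * dehomX (X2 * varX - varY * X1)" by (simp add: ABC mult.commute)
      show "- dehomX B = 1 * dehomX (X3 * varX - varZ * X1)" by (simp add: ABC mult.commute flip: chartX.D_uminus)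
      show "eval2 (dehomX B) ?q = 0" "eval2 (dehomX C) ?q = 0"
        using ev[OF hom(2)] ev[OF hom(3)] zero by (simp_all add: eval2_dehom)
      show "char_poly (mat_of_rows_list 2
        [[eval2 (partial_u (dehomX C)) ?q, eval2 (partial_v (dehomX C)) ?q],
         [- eval2 (partial_u (dehomX B)) ?q, - eval2 (partial_v (dehomX B)) ?q]])
        = [:- (\<kappa> * of_int \<delta>), 1:] * [:- (\<kappa> * of_int \<rho>), 1:]"
        using kappa 3 unfolding defs by simp
      show "quotient_dim (local_ring ?q) (local_ideal ?q (dehomX B) (dehomX C)) = 1" by (rule dim)
      show "\<not> real_of_int \<delta> / real_of_int \<rho> > 0" by (rule not_pos)
      show "1 = (1 :: poly2) \<or> 1 = (- 1 :: poly2)" by simp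
    qed
    then have "eval3 X1 (x, y, z) = 0" using ev[OF homX(1)] by simp
    then show ?thesis using par 3 by simp
  qed
qed

end

section \<open>Counting monomials\<close>

text \<open>Gaussian elimination, one equation at a time: the equation of \<open>p\<close> is solved
  for the unknown \<open>m0\<close> and substituted into the others, which costs one
  unknown.\<close>

lemma homogeneous_system:
  fixes \<phi> :: "'p \<Rightarrow> 'm \<Rightarrow> 'a :: field"
  assumes "finite P" "finite M" "card P < card M"
  shows "\<exists>c. (\<exists>m\<in>M. c m \<noteq> 0) \<and> (\<forall>p\<in>P. (\<Sum>m\<in>M. c m * \<phi> p m) = 0)"
  using assms
proof (induction P arbitrary: M \<phi> rule: finite_induct)
  case empty
  then have "M \<noteq> {}" by auto
  then show ?case by (intro exI[of _ "\<lambda>_. 1"]) auto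
next
  case (insert p P)
  show ?case
  proof (cases "\<forall>m\<in>M. \<phi> p m = 0")
    case True
    have "card P < card M" using insert.prems insert.hyps by simp
    from insert.IH[OF insert.prems(1) this, of \<phi>] obtain c where
      c: "\<exists>m\<in>M. c m \<noteq> 0" "\<forall>q\<in>P. (\<Sum>m\<in>M. c m * \<phi> q m) = 0" by (elim exE conjE)
    have "(\<Sum>m\<in>M. c m * \<phi> p m) = 0" using True by simp
    then show ?thesis using c by (intro exI[of _ c]) simp
  next
    case False
    then obtain m0 where m0: "m0 \<in> M" "\<phi> p m0 \<noteq> 0" by blast
    define M' where "M' = M - {m0}"
    have M': "finite M'" "m0 \<notin> M'" "M = insert m0 M'" using insert.prems(1) m0 by (auto simp: M'_def)
    have "card P < card M'" using insert.prems insert.hyps m0 by (simp add: M'_def)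
    from insert.IH[OF M'(1) this, of "\<lambda>q m. \<phi> q m - \<phi> q m0 * \<phi> p m / \<phi> p m0"] obtain c where
      c: "\<exists>m\<in>M'. c m \<noteq> 0" "\<forall>q\<in>P. (\<Sum>m\<in>M'. c m * (\<phi> q m - \<phi> q m0 * \<phi> p m / \<phi> p m0)) = 0"
      by (elim exE conjE)
    define c0 where "c0 = - (\<Sum>m\<in>M'. c m * \<phi> p m) / \<phi> p m0"
    define c' where "c' = c(m0 := c0)"
    have sum: "(\<Sum>m\<in>M. c' m * \<phi> q m) = c0 * \<phi> q m0 + (\<Sum>m\<in>M'. c m * \<phi> q m)" for q
    proof -
      have "(\<Sum>m\<in>M'. c' m * \<phi> q m) = (\<Sum>m\<in>M'. c m * \<phi> q m)"
        by (intro sum.cong refl) (use M'(2) in \<open>auto simp: c'_def\<close>)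
      then show ?thesis using M' by (simp add: c'_def)
    qed
    have "(\<Sum>m\<in>M. c' m * \<phi> q m) = 0" if q: "q \<in> insert p P" for q
    proof (cases "q = p")
      case True
      then show ?thesis unfolding sum using m0(2) by (simp add: c0_def)
    next
      case False
      then have "0 = (\<Sum>m\<in>M'. c m * (\<phi> q m - \<phi> q m0 * \<phi> p m / \<phi> p m0))" using c(2) q by simp
      also have "\<dots> = (\<Sum>m\<in>M'. c m * \<phi> q m) - (\<Sum>m\<in>M'. (c m * \<phi> p m) * (\<phi> q m0 / \<phi> p m0))"
        by (simp add: sum_subtractf[symmetric] algebra_simps)
      also have "\<dots> = (\<Sum>m\<in>M'. c m * \<phi> q m) - (\<Sum>m\<in>M'. c m * \<phi> p m) * (\<phi> q m0 / \<phi> p m0)"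
        by (simp only: sum_distrib_right)
      finally show ?thesis unfolding sum by (simp add: c0_def)
    qed
    moreover have "\<exists>m\<in>M. c' m \<noteq> 0"
    proof -
      obtain m where m: "m \<in> M'" "c m \<noteq> 0" using c(1) by blast
      then have "m \<in> M" "c' m \<noteq> 0" using M' by (auto simp: c'_def)
      then show ?thesis by blast
    qed
    ultimately show ?thesis by blast
  qed
qed

lemma card_triples: "2 * card (triples u) = (u + 1) * (u + 2)"
proof (induction u)
  case 0
  have "triples 0 = {(0, 0, 0)}" by (auto simp: triples_def)
  then show ?case by simp
next
  case (Suc u)
  define S T where "S = (\<lambda>(i, j, k). (i, j, Suc k)) ` triples u" and "T = (\<lambda>i. (i, Suc u - i, 0 :: nat)) ` {..Suc u}"
  have "triples (Suc u) = S \<union> T"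
  proof (rule Set.set_eqI)
    fix m :: "nat \<times> nat \<times> nat"
    obtain i j k where m: "m = (i, j, k)" by (cases m)
    show "m \<in> triples (Suc u) \<longleftrightarrow> m \<in> S \<union> T"
      unfolding m by (cases k) (auto simp: triples_def S_def T_def image_iff)
  qed
  moreover have "S \<inter> T = {}" by (auto simp: S_def T_def)
  moreover have "finite S" "finite T" by (auto simp: S_def T_def)
  moreover have "card S = card (triples u)" unfolding S_def by (rule card_image) (auto simp: inj_on_def)
  moreover have "card T = Suc u + 1" unfolding T_def by (subst card_image) (auto simp: inj_on_def)
  ultimately have "card (triples (Suc u)) = card (triples u) + (Suc u + 1)" by (simp add: card_Un_disjoint)
  then show ?case using Suc by (simp add: algebra_simps)
qed

text \<open>The multiples of the fixed monomial are its products with the monomials of degree v. For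
  u = v + a + 1, twice the number of the others is (u + 1)(u + 2) - (v + 1)(v + 2) = 2 (2a + v + 2)
  + (2av + a^2 + a). In the application v = r - 2a - 1, and the bound becomes r + 1.\<close>

lemma card_standard_triples:
  assumes "i0 + j0 + k0 = a + 1"
  shows "2 * a + v + 2 \<le> card {m \<in> triples (v + a + 1). \<not> (case m of (i, j, k) \<Rightarrow> i0 \<le> i \<and> j0 \<le> j \<and> k0 \<le> k)}"
proof -
  define u where "u = v + a + 1"
  define M where "M = {m \<in> triples u. \<not> (case m of (i, j, k) \<Rightarrow> i0 \<le> i \<and> j0 \<le> j \<and> k0 \<le> k)}"
  define N where "N = (\<lambda>(i, j, k). (i + i0, j + j0, k + k0)) ` triples v"
  have "triples u = M \<union> N"
  proof (rule Set.set_eqI)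
    fix m :: "nat \<times> nat \<times> nat"
    obtain i j k where m: "m = (i, j, k)" by (cases m)
    have "m \<in> N \<longleftrightarrow> i + j + k = u \<and> i0 \<le> i \<and> j0 \<le> j \<and> k0 \<le> k"
    proof
      assume "m \<in> N"
      then show "i + j + k = u \<and> i0 \<le> i \<and> j0 \<le> j \<and> k0 \<le> k"
        using assms by (auto simp: N_def m triples_def u_def)
    next
      assume *: "i + j + k = u \<and> i0 \<le> i \<and> j0 \<le> j \<and> k0 \<le> k"
      then have "(i - i0, j - j0, k - k0) \<in> triples v" using assms by (auto simp: triples_def u_def)
      then have "(\<lambda>(i, j, k). (i + i0, j + j0, k + k0)) (i - i0, j - j0, k - k0) \<in> N"
        unfolding N_def by (rule imageI)
      then show "m \<in> N" using * by (simp add: m)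
    qed
    then show "m \<in> triples u \<longleftrightarrow> m \<in> M \<union> N" by (auto simp: M_def m triples_def)
  qed
  then have "card (triples u) \<le> card M + card N" by (metis card_Un_le)
  moreover have "card N = card (triples v)" unfolding N_def by (rule card_image) (auto simp: inj_on_def)
  ultimately have "2 * card (triples u) \<le> 2 * card M + 2 * card (triples v)" by linarith
  then have "(u + 1) * (u + 2) \<le> 2 * card M + (v + 1) * (v + 2)" by (simp only: card_triples)
  moreover have "(u + 1) * (u + 2) = 2 * (2 * a + v + 2) + (2 * a * v + a * a + a) + (v + 1) * (v + 2)"
    by (simp add: u_def algebra_simps)
  ultimately have "2 * (2 * a + v + 2) \<le> 2 * card M" by linarith
  then have "2 * a + v + 2 \<le> card M" by simp
  then show ?thesis unfolding M_def u_def .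
qed

text \<open>Leading monomials for the lexicographic order that compares Z first are multiplicative,
  so a nonzero multiple of \<open>g\<close> contains a monomial divisible by that of
  \<open>g\<close>.\<close>

lemma leading_monomial_mult:
  fixes p g :: poly3
  assumes "p \<noteq> 0" "g \<noteq> 0"
  defines "k \<equiv> degree g"
  defines "j \<equiv> degree (coeff g k)"
  defines "i \<equiv> degree (coeff (coeff g k) j)"
  shows "cf g i j k \<noteq> 0" "\<exists>i' j' k'. i \<le> i' \<and> j \<le> j' \<and> k \<le> k' \<and> cf (p * g) i' j' k' \<noteq> 0"
proof -
  define G where "G = coeff g k"
  define H where "H = coeff G j"
  have "G \<noteq> 0" using assms(2) by (simp add: G_def k_def)
  then have "H \<noteq> 0" by (simp add: H_def j_def G_def)
  then show "cf g i j k \<noteq> 0" unfolding i_def G_def[symmetric] H_def[symmetric] by simp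
  define k' where "k' = degree p"
  define P where "P = coeff p k'"
  have "P \<noteq> 0" using assms(1) by (simp add: P_def k'_def)
  define j' where "j' = degree P"
  define Q where "Q = coeff P j'"
  have "Q \<noteq> 0" using \<open>P \<noteq> 0\<close> by (simp add: Q_def j'_def)
  define i' where "i' = degree Q"
  have "coeff (p * g) (k' + k) = P * G"
    unfolding k'_def k_def P_def G_def by (rule coeff_mult_degree_sum)
  moreover have "coeff (P * G) (j' + j) = Q * H"
    unfolding j'_def j_def Q_def H_def G_def[symmetric] by (rule coeff_mult_degree_sum)
  moreover have "coeff (Q * H) (i' + i) = coeff Q i' * coeff H i"
    unfolding i'_def i_def G_def[symmetric] H_def[symmetric] by (rule coeff_mult_degree_sum)
  moreover have "coeff Q i' * coeff H i \<noteq> 0"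
    using \<open>Q \<noteq> 0\<close> \<open>H \<noteq> 0\<close> unfolding i'_def i_def G_def[symmetric] H_def[symmetric] by simp
  ultimately have "cf (p * g) (i' + i) (j' + j) (k' + k) \<noteq> 0" by simp
  then show "\<exists>i' j' k'. i \<le> i' \<and> j \<le> j' \<and> k \<le> k' \<and> cf (p * g) i' j' k' \<noteq> 0"
    by (intro exI[of _ "i' + i"] exI[of _ "j' + j"] exI[of _ "k' + k"]) simp
qed

section \<open>Forms through the non-reduced singularities and syzygies of the field\<close>

context integrable_foliation
begin

definition vanishes_on_non_reduced :: "poly3 \<Rightarrow> bool" where
  "vanishes_on_non_reduced g \<longleftrightarrow> (\<forall>x y z. (x, y, z) \<noteq> (0, 0, 0) \<longrightarrow>
     non_reduced (A, B, C) (abs_proj_plane (x, y, z)) \<longrightarrow> eval3 g (x, y, z) = 0)"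

lemma finite_non_reduced: "finite {p. non_reduced (A, B, C) p}"
  by (rule finite_subset[OF _ finite_singular]) (auto simp: non_reduced_def)

text \<open>Each point imposes one linear condition, at a chosen representative; homogeneity extends
  the vanishing to the others. The set \<open>M\<close> is left free so that multiples of a leading
  monomial can be excluded.\<close>

lemma vanishing_combination:
  assumes M: "M \<subseteq> triples u" and card: "card {p. non_reduced (A, B, C) p} < card M"
  shows "\<exists>g. g \<noteq> 0 \<and> homogeneous u g \<and> vanishes_on_non_reduced g \<and>
    (\<forall>i j k. cf g i j k \<noteq> 0 \<longrightarrow> (i, j, k) \<in> M)"
proof -
  have fin: "finite M" using M finite_triples by (rule finite_subset)
  obtain c where c: "\<exists>m\<in>M. c m \<noteq> 0"
    "\<forall>p\<in>{p. non_reduced (A, B, C) p}. (\<Sum>m\<in>M. c m * eval3 (monom3 m) (rep_proj_plane p)) = 0"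
    using homogeneous_system[OF finite_non_reduced fin card, of "\<lambda>p m. eval3 (monom3 m) (rep_proj_plane p)"]
    by (elim exE conjE)
  define g where "g = (\<Sum>m\<in>M. const3 (c m) * monom3 m)"
  have cf_g: "cf g i j k = (if (i, j, k) \<in> M then c (i, j, k) else 0)" for i j k
    unfolding g_def by (rule cf_sum_monom3[OF fin])
  obtain i j k where "(i, j, k) \<in> M" "c (i, j, k) \<noteq> 0" using c(1) by (metis prod_cases3)
  then have "cf g i j k \<noteq> 0" by (simp add: cf_g)
  then have "g \<noteq> 0" by auto
  have hom_g: "homogeneous u g"
    unfolding homogeneous_def
  proof (intro allI impI)
    fix i j k assume "cf g i j k \<noteq> 0"
    then have "(i, j, k) \<in> M" by (simp add: cf_g split: if_splits)
    then have "(i, j, k) \<in> triples u" using M by (rule rev_subsetD)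
    then show "i + j + k = u" by (simp add: triples_def)
  qed
  have "vanishes_on_non_reduced g"
    unfolding vanishes_on_non_reduced_def
  proof (intro allI impI)
    fix x y z assume w: "(x, y, z) \<noteq> (0, 0, 0)" "non_reduced (A, B, C) (abs_proj_plane (x, y, z))"
    obtain x' y' z' where rep: "rep_proj_plane (abs_proj_plane (x, y, z)) = (x', y', z')" by (metis prod_cases3)
    have "proj_eq (x, y, z) (x, y, z)" unfolding proj_eq_refl by (rule w(1))
    then have "proj_eq (x', y', z') (x, y, z)"
      using Quotient3_rep_abs[OF Quotient3_proj_plane] unfolding rep[symmetric] by blast
    then obtain t where t: "x = t * x'" "y = t * y'" "z = t * z'" unfolding proj_eq_iff by blast
    have "(\<Sum>m\<in>M. c m * eval3 (monom3 m) (rep_proj_plane (abs_proj_plane (x, y, z)))) = 0"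
      using c(2) w(2) by blast
    then have "eval3 g (x', y', z') = 0"
      by (simp add: g_def eval3_sum eval3_ring_hom rep)
    then show "eval3 g (x, y, z) = 0" unfolding t by (simp add: eval3_scale[OF hom_g])
  qed
  moreover have "\<forall>i j k. cf g i j k \<noteq> 0 \<longrightarrow> (i, j, k) \<in> M" by (simp add: cf_g)
  ultimately show ?thesis using \<open>g \<noteq> 0\<close> hom_g by blast
qed

text \<open>At a singular point the vector field is a multiple of the radial one. The multiple vanishes at
  reduced singularities, hence \<open>g\<^sub>1 X\<^sub>1 + g\<^sub>2 X\<^sub>2 + g\<^sub>3 X\<^sub>3\<close> vanishes at all of them.\<close>

lemma combination_mem:
  assumes g: "homogeneous e g1" "homogeneous e g2" "homogeneous e g3"
    and van: "vanishes_on_non_reduced (varX * g1 + varY * g2 + varZ * g3)"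
  shows "g1 * X1 + g2 * X2 + g3 * X3 \<in> ideal3 A B C"
proof (rule vanishing_on_singular_imp_mem)
  show "homogeneous (e + r) (g1 * X1 + g2 * X2 + g3 * X3)"
    by (intro homogeneous_add homogeneous_mult g homX)
  fix x y z
  assume w: "(x, y, z) \<noteq> (0, 0, 0)"
    and zero: "eval3 A (x, y, z) = 0" "eval3 B (x, y, z) = 0" "eval3 C (x, y, z) = 0"
  define a1 a2 a3 where "a1 = eval3 g1 (x, y, z)" and "a2 = eval3 g2 (x, y, z)" and "a3 = eval3 g3 (x, y, z)"
  define b1 b2 b3 where "b1 = eval3 X1 (x, y, z)" and "b2 = eval3 X2 (x, y, z)" and "b3 = eval3 X3 (x, y, z)"
  have par: "y * b3 = z * b2" "z * b1 = x * b3" "x * b2 = y * b1"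
    using zero unfolding ABC by (simp_all add: eval3_ring_hom eval3_vars b1_def b2_def b3_def)
  have "a1 * b1 + a2 * b2 + a3 * b3 = 0"
  proof (cases "non_reduced (A, B, C) (abs_proj_plane (x, y, z))")
    case True
    then have "eval3 (varX * g1 + varY * g2 + varZ * g3) (x, y, z) = 0"
      using van w unfolding vanishes_on_non_reduced_def by blast
    then have g0: "x * a1 + y * a2 + z * a3 = 0" by (simp add: eval3_ring_hom eval3_vars a1_def a2_def a3_def)
    have "x * (a1 * b1 + a2 * b2 + a3 * b3) = a1 * (x * b1) + a2 * (x * b2) + a3 * (x * b3)"
      "y * (a1 * b1 + a2 * b2 + a3 * b3) = a1 * (y * b1) + a2 * (y * b2) + a3 * (y * b3)"
      "z * (a1 * b1 + a2 * b2 + a3 * b3) = a1 * (z * b1) + a2 * (z * b2) + a3 * (z * b3)"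
      by (simp_all add: algebra_simps)
    moreover have "a1 * (x * b1) + a2 * (x * b2) + a3 * (x * b3) = b1 * (x * a1 + y * a2 + z * a3)"
      unfolding par(3) par(2)[symmetric] by (simp add: algebra_simps)
    moreover have "a1 * (y * b1) + a2 * (y * b2) + a3 * (y * b3) = b2 * (x * a1 + y * a2 + z * a3)"
      unfolding par(3)[symmetric] par(1) by (simp add: algebra_simps)
    moreover have "a1 * (z * b1) + a2 * (z * b2) + a3 * (z * b3) = b3 * (x * a1 + y * a2 + z * a3)"
      unfolding par(2) par(1)[symmetric] by (simp add: algebra_simps)
    ultimately show ?thesis using w g0 by auto
  next
    case False
    then show ?thesis using field_vanishes_at_reduced[OF w zero] by (simp add: b1_def b2_def b3_def)
  qed
  then show "eval3 (g1 * X1 + g2 * X2 + g3 * X3) (x, y, z) = 0"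
    by (simp add: eval3_ring_hom a1_def a2_def a3_def b1_def b2_def b3_def)
qed

text \<open>Coefficients may be replaced by their parts of degree \<open>e - (r + 1)\<close>. The
  generators have degree r + 1, so in smaller degrees the ideal contains only 0, which is the other
  branch.\<close>

lemma mem_ideal_homogeneous:
  assumes H: "homogeneous e H" and mem: "H \<in> ideal3 A B C"
  shows "\<exists>a b c. homogeneous (e - (r + 1)) a \<and> homogeneous (e - (r + 1)) b \<and> homogeneous (e - (r + 1)) c \<and>
    H = (if r + 1 \<le> e then a * A + b * B + c * C else 0)"
proof -
  obtain a b c where H': "H = a * A + b * B + c * C" using mem unfolding ideal3_def by blast
  have "H = homogeneous_part e H" using homogeneous_part_homogeneous[OF H, of e] by simp
  also have "\<dots> = homogeneous_part e (a * A) + homogeneous_part e (b * B) + homogeneous_part e (c * C)"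
    unfolding H' homogeneous_part_add ..
  also have "\<dots> = (if r + 1 \<le> e then homogeneous_part (e - (r + 1)) a * A + homogeneous_part (e - (r + 1)) b * B
      + homogeneous_part (e - (r + 1)) c * C else 0)"
    unfolding homogeneous_part_mult[OF hom(1)] homogeneous_part_mult[OF hom(2)] homogeneous_part_mult[OF hom(3)]
    by simp
  finally show ?thesis using homogeneous_homogeneous_part by blast
qed

text \<open>The membership from \<open>combination_mem\<close> has coefficients (a, b, c) of degree
  e - 1. Subtracting (a, b, c) x R from (g1, g2, g3) makes the product with X zero and keeps the
  contraction with R. For e = 0 the product with X has degree r and is already 0.\<close>

lemma syzygy_exists:
  assumes g: "homogeneous (Suc e) g" and van: "vanishes_on_non_reduced g"
  shows "\<exists>u v w. homogeneous e u \<and> homogeneous e v \<and> homogeneous e w \<and>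
    u * X1 + v * X2 + w * X3 = 0 \<and> varX * u + varY * v + varZ * w = g"
proof -
  obtain g1 g2 g3 where hom_g: "homogeneous e g1" "homogeneous e g2" "homogeneous e g3"
    and split: "g = varX * g1 + varY * g2 + varZ * g3"
    using homogeneous_split[OF g] by blast
  define f where "f = g1 * X1 + g2 * X2 + g3 * X3"
  have f: "f \<in> ideal3 A B C" unfolding f_def by (rule combination_mem[OF hom_g van[unfolded split]])
  have hom_f: "homogeneous (e + r) f" unfolding f_def by (intro homogeneous_add homogeneous_mult hom_g homX)
  show ?thesis
  proof (cases e)
    case 0
    then have "f = 0" using mem_ideal_homogeneous[OF hom_f f] by auto
    then show ?thesis using hom_g split f_def by (intro exI[of _ g1] exI[of _ g2] exI[of _ g3]) simp
  next
    case (Suc e')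
    then have deg: "e + r - (r + 1) = e'" "r + 1 \<le> e + r" by simp_all
    obtain a b c where abc: "homogeneous e' a" "homogeneous e' b" "homogeneous e' c" "f = a * A + b * B + c * C"
      using mem_ideal_homogeneous[OF hom_f f] unfolding deg(1) using deg(2) by auto
    define u v w where "u = g1 - (varZ * b - varY * c)" and "v = g2 - (varX * c - varZ * a)"
      and "w = g3 - (varY * a - varX * b)"
    have hom_mult: "homogeneous e (varX * q)" "homogeneous e (varY * q)" "homogeneous e (varZ * q)"
      if "homogeneous e' q" for q
      using homogeneous_mult[OF homogeneous_vars(1) that] homogeneous_mult[OF homogeneous_vars(2) that]
        homogeneous_mult[OF homogeneous_vars(3) that] by (simp_all add: Suc)
    have "homogeneous e u" "homogeneous e v" "homogeneous e w"
      unfolding u_def v_def w_def by (intro homogeneous_diff hom_g hom_mult abc)+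
    moreover have "u * X1 + v * X2 + w * X3 = f - (a * A + b * B + c * C)"
      unfolding u_def v_def w_def f_def ABC by (simp add: algebra_simps)
    moreover have "varX * u + varY * v + varZ * w = g"
      unfolding u_def v_def w_def split by (simp add: algebra_simps)
    ultimately show ?thesis using abc(4) by (intro exI[of _ u] exI[of _ v] exI[of _ w]) simp
  qed
qed

lemma coprime_field: "coprime3 X1 X2 X3"
  unfolding coprime3_def
proof (intro allI impI, elim conjE)
  fix D assume "D dvd X1" "D dvd X2" "D dvd X3"
  then have "D dvd A" "D dvd B" "D dvd C" unfolding ABC by simp_all
  then show "is_unit D" using cop unfolding coprime3_def by blast
qed

lemma syzygies_parallel:
  assumes u: "homogeneous a u1" "homogeneous a u2" "homogeneous a u3" "u1 * X1 + u2 * X2 + u3 * X3 = 0"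
    and v: "homogeneous b v1" "homogeneous b v2" "homogeneous b v3" "v1 * X1 + v2 * X2 + v3 * X3 = 0"
    and "a + b < r"
  shows "v1 * u2 = v2 * u1" "v1 * u3 = v3 * u1" "v2 * u3 = v3 * u2"
proof -
  define c1 c2 c3 where "c1 = u2 * v3 - u3 * v2" and "c2 = u3 * v1 - u1 * v3" and "c3 = u1 * v2 - u2 * v1"
  have "\<exists>p. c1 = p * X1 \<and> c2 = p * X2 \<and> c3 = p * X3"
  proof (rule parallel3[OF coprime_field])
    have "c1 * X2 - c2 * X1 = v3 * (u1 * X1 + u2 * X2 + u3 * X3) - u3 * (v1 * X1 + v2 * X2 + v3 * X3)"
      by (simp add: c1_def c2_def algebra_simps)
    then show "c1 * X2 = c2 * X1" by (simp add: u v)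
    have "c1 * X3 - c3 * X1 = u2 * (v1 * X1 + v2 * X2 + v3 * X3) - v2 * (u1 * X1 + u2 * X2 + u3 * X3)"
      by (simp add: c1_def c3_def algebra_simps)
    then show "c1 * X3 = c3 * X1" by (simp add: u v)
    have "c2 * X3 - c3 * X2 = v1 * (u1 * X1 + u2 * X2 + u3 * X3) - u1 * (v1 * X1 + v2 * X2 + v3 * X3)"
      by (simp add: c2_def c3_def algebra_simps)
    then show "c2 * X3 = c3 * X2" by (simp add: u v)
  qed
  then obtain p where p: "c1 = p * X1" "c2 = p * X2" "c3 = p * X3" by blast
  have homc: "homogeneous (a + b) c1" "homogeneous (a + b) c2" "homogeneous (a + b) c3"
    unfolding c1_def c2_def c3_def using u v by (auto intro!: homogeneous_diff homogeneous_mult)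
  have zero: "c = 0" if "homogeneous (a + b) c" "c = p * X" "homogeneous r X" for c X
  proof (rule ccontr)
    assume "c \<noteq> 0"
    moreover have "X dvd c" using that(2) by simp
    ultimately show False using homogeneous_dvd_degree[OF that(3,1)] \<open>a + b < r\<close> by simp
  qed
  have "c1 = 0" "c2 = 0" "c3 = 0"
    using zero[OF homc(1) p(1) homX(1)] zero[OF homc(2) p(2) homX(2)] zero[OF homc(3) p(3) homX(3)] .
  then show "v1 * u2 = v2 * u1" "v1 * u3 = v3 * u1" "v2 * u3 = v3 * u2"
    by (simp_all add: c1_def c2_def c3_def mult.commute)
qed

definition syzygy :: "nat \<Rightarrow> poly3 \<Rightarrow> poly3 \<Rightarrow> poly3 \<Rightarrow> bool" where
  "syzygy a u v w \<longleftrightarrow> homogeneous a u \<and> homogeneous a v \<and> homogeneous a w \<and>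
     (u \<noteq> 0 \<or> v \<noteq> 0 \<or> w \<noteq> 0) \<and> u * X1 + v * X2 + w * X3 = 0"

text \<open>Coprimality turns every syzygy parallel to this one into a polynomial multiple of it.
  The gcd is not known to be homogeneous; cross-multiplied Euler identities show that
  \<open>euler\<close> multiplies the reduced vector by a single factor, its degree.\<close>

lemma primitive_syzygy:
  assumes "syzygy a u v w"
  shows "\<exists>b u' v' w'. b \<le> a \<and> syzygy b u' v' w' \<and> coprime3 u' v' w'"
proof -
  have hom_u: "homogeneous a u" "homogeneous a v" "homogeneous a w" and nz: "u \<noteq> 0 \<or> v \<noteq> 0 \<or> w \<noteq> 0"
    and syz: "u * X1 + v * X2 + w * X3 = 0" using assms by (simp_all add: syzygy_def)
  define D where "D = gcd u (gcd v w)"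
  have "D \<noteq> 0" using nz by (auto simp: D_def)
  have "D dvd gcd v w" unfolding D_def by (rule gcd_dvd2)
  then have "D dvd v" "D dvd w" by (rule dvd_trans; simp)+
  moreover have "D dvd u" unfolding D_def by (rule gcd_dvd1)
  ultimately obtain u' v' w' where uvw: "u = D * u'" "v = D * v'" "w = D * w'" by (elim dvdE)
  note hom_D = hom_u[unfolded uvw]
  have cop': "coprime3 u' v' w'"
    unfolding coprime3_def
  proof (intro allI impI, elim conjE)
    fix E assume "E dvd u'" "E dvd v'" "E dvd w'"
    then have "D * E dvd u" "D * E dvd v" "D * E dvd w" unfolding uvw by (simp_all add: mult_dvd_mono)
    then have "D * E dvd D" unfolding D_def by (intro gcd_greatest)
    then show "is_unit E" using \<open>D \<noteq> 0\<close> by simp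
  qed
  have nz': "u' \<noteq> 0 \<or> v' \<noteq> 0 \<or> w' \<noteq> 0" using nz uvw by auto
  have "D * (u' * X1 + v' * X2 + w' * X3) = 0" using syz unfolding uvw by (simp add: algebra_simps)
  then have syz': "u' * X1 + v' * X2 + w' * X3 = 0" using \<open>D \<noteq> 0\<close> by simp
  have cross: "euler p * q = euler q * p" if "homogeneous a (D * p)" "homogeneous a (D * q)" for p q
  proof -
    have "D * D * (euler p * q - euler q * p) = euler (D * p) * (D * q) - euler (D * q) * (D * p)"
      unfolding euler_mult by (simp add: algebra_simps)
    also have "\<dots> = 0" using that by (simp add: homogeneous_iff_euler)
    finally have "euler p * q - euler q * p = 0" using \<open>D \<noteq> 0\<close> by (simp only: mult_eq_0_iff simp_thms)
    then show ?thesis by simp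
  qed
  have "\<exists>c. euler u' = c * u' \<and> euler v' = c * v' \<and> euler w' = c * w'"
    by (rule parallel3[OF cop' cross[OF hom_D(1,2)] cross[OF hom_D(1,3)] cross[OF hom_D(2,3)]])
  then obtain c where c: "euler u' = c * u'" "euler v' = c * v'" "euler w' = c * w'" by blast
  have "\<exists>b. c = of_nat b"
    using nz'
  proof (elim disjE)
    show "u' \<noteq> 0 \<Longrightarrow> \<exists>b. c = of_nat b" using euler_eigenvalue[OF _ c(1)] by blast
    show "v' \<noteq> 0 \<Longrightarrow> \<exists>b. c = of_nat b" using euler_eigenvalue[OF _ c(2)] by blast
    show "w' \<noteq> 0 \<Longrightarrow> \<exists>b. c = of_nat b" using euler_eigenvalue[OF _ c(3)] by blast
  qed
  then obtain b where b: "c = of_nat b" by blast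
  have hom_u': "homogeneous b u'" "homogeneous b v'" "homogeneous b w'"
    using c by (simp_all add: b homogeneous_iff_euler)
  have le: "b \<le> a" if "homogeneous a (D * p)" "homogeneous b p" "p \<noteq> 0" for p
    using homogeneous_dvd_degree[OF that(2,1)] that(3) \<open>D \<noteq> 0\<close> by simp
  have "b \<le> a"
    using nz' le[OF hom_D(1) hom_u'(1)] le[OF hom_D(2) hom_u'(2)] le[OF hom_D(3) hom_u'(3)] by blast
  then show ?thesis using hom_u' nz' syz' cop' unfolding syzygy_def by blast
qed

text \<open>The obvious relations between the components of X have degree r. This keeps the minimal
  degree below r + 1, the degree of the syzygy \<open>(A, B, C)\<close>, whose contraction with R is
  0.\<close>

lemma syzygy_degree_le: "\<exists>a u v w. a \<le> r \<and> syzygy a u v w"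
proof -
  have nz: "X1 \<noteq> 0 \<or> X2 \<noteq> 0 \<or> X3 \<noteq> 0"
    using coprime_field unfolding coprime3_def by (metis dvd_0_right not_is_unit_0)
  show ?thesis
  proof (cases "X1 = 0 \<and> X2 = 0")
    case True
    then have "syzygy r X3 0 0" unfolding syzygy_def using nz homX by simp
    then show ?thesis by blast
  next
    case False
    then have "syzygy r X2 (- X1) 0" using homX by (auto simp: syzygy_def homogeneous_uminus)
    then show ?thesis by blast
  qed
qed

lemma card_non_reduced_ge: "r + 1 \<le> card {p. non_reduced (A, B, C) p}"
proof (rule ccontr)
  let ?n = "card {p. non_reduced (A, B, C) p}"
  assume "\<not> r + 1 \<le> ?n"
  then have n: "?n \<le> r" by simp
  define a where "a = (LEAST a. \<exists>u v w. syzygy a u v w)"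
  have ex: "\<exists>u v w. syzygy a u v w"
    unfolding a_def using syzygy_degree_le by (intro LeastI_ex[of "\<lambda>a. \<exists>u v w. syzygy a u v w"]) blast
  have min: "a \<le> b" if "syzygy b u v w" for b u v w
    unfolding a_def by (rule Least_le) (use that in blast)
  have "a \<le> r" using syzygy_degree_le min le_trans by blast
  obtain u v w where "syzygy a u v w" using ex by blast
  then obtain b u v w where b: "b \<le> a" "syzygy b u v w" "coprime3 u v w" using primitive_syzygy by blast
  then have "b = a" using min by (simp add: le_antisym)
  then have syz: "syzygy a u v w" using b by simp
  then have hom_u: "homogeneous a u" "homogeneous a v" "homogeneous a w"
    and syz0: "u * X1 + v * X2 + w * X3 = 0" and nz: "u \<noteq> 0 \<or> v \<noteq> 0 \<or> w \<noteq> 0"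
    by (simp_all add: syzygy_def)
  define g0 where "g0 = varX * u + varY * v + varZ * w"
  \<comment> \<open>A syzygy with zero contraction is orthogonal to R and X, hence a multiple of
    \<open>(A, B, C)\<close>, whose degree r + 1 exceeds a.\<close>
  have "g0 \<noteq> 0"
  proof
    assume "g0 = 0"
    then have "u * varX + v * varY + w * varZ = 0" by (simp add: g0_def mult.commute)
    from perp_parallel[OF cop[unfolded ABC] this syz0] obtain p where
      p: "u = p * A" "v = p * B" "w = p * C" unfolding ABC[symmetric] by blast
    have "r + 1 \<le> a" if "homogeneous a q" "homogeneous (r + 1) Q" "q = p * Q" "q \<noteq> 0" for q Q
      using homogeneous_dvd_degree[OF that(2,1)] that(3,4) by simp
    then have "r + 1 \<le> a" using nz hom_u hom p by blast
    then show False using \<open>a \<le> r\<close> by simp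
  qed
  have hom_g0: "homogeneous (Suc a) g0"
    unfolding g0_def using homogeneous_mult[OF homogeneous_vars(1) hom_u(1)]
      homogeneous_mult[OF homogeneous_vars(2) hom_u(2)] homogeneous_mult[OF homogeneous_vars(3) hom_u(3)]
    by (simp add: homogeneous_add)
  \<comment> \<open>In the second case a form of degree a through the non-reduced singularities
    gives a syzygy of degree a - 1, which makes sense only for a \<ge> 1. The case r = 0 stands
    apart because r - 2a - 1 has to be a natural number in the third.\<close>
  consider "r = 0" | "a \<ge> 1" "?n < card (triples a)" | "r \<ge> 1" "a = 0 \<or> card (triples a) \<le> r"
    using n by linarith
  then show False
  proof cases
    case 1
    \<comment> \<open>Without non-reduced singularities every form meets the vanishing condition, so
      the constants \<open>X1\<close>, \<open>X2\<close>, \<open>X3\<close> lie in an ideal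
      generated in degree 1.\<close>
    then have "{p. non_reduced (A, B, C) p} = {}" using n finite_non_reduced by simp
    then have van: "vanishes_on_non_reduced g" for g by (auto simp: vanishes_on_non_reduced_def)
    have const: "homogeneous 0 (1 :: poly3)" using homogeneous_const3[of 1] by (simp add: const3_1)
    have zero: "H = 0" if "homogeneous 0 H" "H \<in> ideal3 A B C" for H
      using mem_ideal_homogeneous[OF that] by auto
    have "X1 = 0" using zero[of X1] combination_mem[of 0 1 0 0] van const homX 1 by simp
    moreover have "X2 = 0" using zero[of X2] combination_mem[of 0 0 1 0] van const homX 1 by simp
    moreover have "X3 = 0" using zero[of X3] combination_mem[of 0 0 0 1] van const homX 1 by simp
    ultimately show False using coprime_field unfolding coprime3_def by (metis dvd_0_right not_is_unit_0)
  next
    case 2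
    obtain g where g: "g \<noteq> 0" "homogeneous a g" "vanishes_on_non_reduced g"
      using vanishing_combination[OF subset_refl 2(2)] by blast
    obtain e where e: "a = Suc e" using 2(1) by (cases a) auto
    obtain u' v' w' where s: "homogeneous e u'" "homogeneous e v'" "homogeneous e w'"
      "u' * X1 + v' * X2 + w' * X3 = 0" "varX * u' + varY * v' + varZ * w' = g"
      using syzygy_exists[OF g(2)[unfolded e] g(3)] by blast
    then have "syzygy e u' v' w'" using g(1) by (auto simp: syzygy_def)
    then show False using min e by fastforce
  next
    case 3
    \<comment> \<open>With this constant r - a = v0 + a + 1. For a \<ge> 1, at most r monomials of
      degree a means (a + 1)(a + 2) \<le> 2r, and a \<le> a^2 then gives 2a + 1 \<le> r.\<close>
    define v0 where "v0 = r - (2 * a + 1)"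
    have v0: "r = v0 + 2 * a + 1"
    proof (cases "a = 0")
      case False
      then have "(a + 1) * (a + 2) \<le> 2 * r" using 3(2) card_triples[of a] by linarith
      moreover have "a \<le> a * a" by (rule le_square)
      moreover have "(a + 1) * (a + 2) = a * a + 3 * a + 2" by (simp add: algebra_simps)
      ultimately have "2 * a + 1 \<le> r" using False by linarith
      then show ?thesis by (simp add: v0_def)
    qed (use 3(1) in \<open>simp add: v0_def\<close>)
    define k0 where "k0 = degree g0"
    define j0 where "j0 = degree (coeff g0 k0)"
    define i0 where "i0 = degree (coeff (coeff g0 k0) j0)"
    have "cf g0 i0 j0 k0 \<noteq> 0"
      using leading_monomial_mult(1)[OF \<open>g0 \<noteq> 0\<close> \<open>g0 \<noteq> 0\<close>] unfolding i0_def j0_def k0_def .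
    then have sum0: "i0 + j0 + k0 = a + 1" using hom_g0 unfolding homogeneous_def by simp
    define M where "M = {m \<in> triples (v0 + a + 1). \<not> (case m of (i, j, k) \<Rightarrow> i0 \<le> i \<and> j0 \<le> j \<and> k0 \<le> k)}"
    have M: "M \<subseteq> triples (v0 + a + 1)" by (auto simp: M_def)
    have "2 * a + v0 + 2 \<le> card M" unfolding M_def by (rule card_standard_triples[OF sum0])
    then have "?n < card M" using n v0 by simp
    from vanishing_combination[OF M this] obtain g where g: "g \<noteq> 0" "homogeneous (v0 + a + 1) g"
      "vanishes_on_non_reduced g" "\<forall>i j k. cf g i j k \<noteq> 0 \<longrightarrow> (i, j, k) \<in> M" by blast
    have "homogeneous (Suc (v0 + a)) g" using g(2) by simp
    from syzygy_exists[OF this g(3)] obtain u' v' w' where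
      s: "homogeneous (v0 + a) u'" "homogeneous (v0 + a) v'" "homogeneous (v0 + a) w'"
        "u' * X1 + v' * X2 + w' * X3 = 0" "varX * u' + varY * v' + varZ * w' = g" by blast
    have less: "a + (v0 + a) < r" using v0 by simp
    obtain p where p: "u' = p * u" "v' = p * v" "w' = p * w"
      using parallel3[OF b(3) syzygies_parallel[OF hom_u syz0 s(1,2,3,4) less]] by blast
    have gp: "g = p * g0" unfolding s(5)[symmetric] p g0_def by (simp add: algebra_simps)
    \<comment> \<open>A nonzero multiple of \<open>g0\<close> contains a monomial divisible by the
      leading monomial of \<open>g0\<close>, and these were all excluded from
      \<open>M\<close>.\<close>
    then have "p \<noteq> 0" using g(1) by auto
    from leading_monomial_mult(2)[OF this \<open>g0 \<noteq> 0\<close>] obtain i j k where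
      "i0 \<le> i" "j0 \<le> j" "k0 \<le> k" "cf g i j k \<noteq> 0"
      unfolding gp i0_def j0_def k0_def by blast
    then show False using g(4) unfolding M_def by blast
  qed
qed

end

theorem theorem2:
  fixes r :: nat and \<Omega> :: form3
  assumes "foliation r \<Omega>"
    and "nondegenerate \<Omega>"
    and "\<And>p. singular \<Omega> p \<Longrightarrow> \<exists>\<delta> \<rho>. coprime_eigenvalue_pair \<Omega> p \<delta> \<rho>"
    and "\<exists>S. rational_first_integral \<Omega> S"
  shows "r + 1 \<le> card {p. non_reduced \<Omega> p}"
proof -
  obtain A B C where \<Omega>: "\<Omega> = (A, B, C)" by (cases \<Omega>)
  have hom: "homogeneous (r + 1) A" "homogeneous (r + 1) B" "homogeneous (r + 1) C" and cop: "coprime3 A B C"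
    using assms(1) unfolding \<Omega> by (simp_all add: foliation_def coprime3_def)
  obtain S where "rational_first_integral (A, B, C) S" using assms(4) unfolding \<Omega> by blast
  from vector_field_exists[OF assms(1)[unfolded \<Omega>] this] obtain d F G X1 X2 X3 where
    *: "d > 0" "homogeneous d F" "homogeneous d G" "coprime F G"
      "homogeneous r X1" "homogeneous r X2" "homogeneous r X3"
      "A = varY * X3 - varZ * X2" "B = varZ * X1 - varX * X3" "C = varX * X2 - varY * X1"
      "X1 * partial_X F + X2 * partial_Y F + X3 * partial_Z F = 0"
      "X1 * partial_X G + X2 * partial_Y G + X3 * partial_Z G = 0"
    by (elim exE conjE)
  interpret integrable_foliation r d A B C F G X1 X2 X3
    using hom cop * assms(2,3) unfolding \<Omega> by unfold_locales
  show ?thesis unfolding \<Omega> by (rule card_non_reduced_ge)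
qed

end
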